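(* Let $\Gamma$ be a Coxeter graph with finite vertex set $S$, let $(W,S)$ be its Coxeter system, let $G$ be a group of symmetries of $\Gamma$, and let $(V,\langle .,.\rangle,\Pi)$, $\Pi=\{\epsilon_s\mid s\in S\}$, be a root basis of $\Gamma$. Assume that $G$ embeds in $\mathrm{GL}(V)$ in such a way that $g(\epsilon_s)=\epsilon_{g(s)}$ for all $g\in G$ and all $s\in S$, and the form $\langle .,.\rangle$ is invariant under $G$. Let $\mathcal S$ be the set of orbits $X$ of $G$ in $S$ such that $W_X$ is finite, let $\tilde M=(\tilde m_{X,Y})_{X,Y\in\mathcal S}$ and $\tilde\Gamma$ be the Coxeter matrix and Coxeter graph defined in the context, and let $\tilde\Pi=\{\tilde\epsilon_X\mid X\in\mathcal S\}\subset V^G$. Then: (1) The set $\mathcal S_W=\{w_X\mid X\in\mathcal S\}$ generates $W^G$, and $(W^G,\mathcal S_W)$ is a Coxeter system of $\tilde\Gamma$ (with $w_X$ corresponding to the vertex $X$). (2) The triple $(V^G,\langle .,.\rangle,\tilde\Pi)$ (with the restricted form) is a root basis of $\tilde\Gamma$, and the induced representation $f^G:W^G\to\mathrm{GL}(V^G)$ is the rooted representation associated with $(V^G,\langle .,.\rangle,\tilde\Pi)$. In particular, $f^G$ is faithful.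
   Context: A Coxeter graph $\Gamma$ with vertex set $S$ encodes a Coxeter matrix $(m_{s,t})_{s,t\in S}$ ($m_{s,s}=1$, $m_{s,t}=m_{t,s}\in\{2,3,\dots\}\cup\{\infty\}$ for $s\ne t$): two distinct vertices $s,t$ are joined by an edge iff $m_{s,t}\ge 3$, and the edge is labelled $m_{s,t}$ (label 3 usually omitted). Its Coxeter system is $(W,S)$ with $W=\langle S\mid (st)^{m_{s,t}}=1 \text{ for all } s,t\in S \text{ with } m_{s,t}\neq\infty\rangle$. A symmetry of $\Gamma$ is a permutation $g$ of $S$ with $m_{g(s),g(t)}=m_{s,t}$ for all $s,t\in S$. A group $G$ of symmetries acts on $W$ by automorphisms extending its action on $S$; $W^G$ is the subgroup of elements of $W$ fixed by all of $G$. For $X\subset S$, $\Gamma_X$ is the full subgraph of $\Gamma$ spanned by $X$ and $W_X$ is the subgroup of $W$ generated by $X$; $(W_X,X)$ is a Coxeter system of $\Gamma_X$. If $W_X$ is finite, $w_X$ denotes its unique longest element (with respect to word length over $X$). A root basis of $\Gamma$ is a triple $(V,\langle .,.\rangle,\Pi)$, where $V$ is a finite dimensional real vector space, $\langle .,.\rangle$ is a symmetric bilinear form on $V$, and $\Pi=\{\epsilon_s\mid s\in S\}$ is a collection of vectors of $V$ in one-to-one correspondence with $S$ such that: (a) $\langle\epsilon_s,\epsilon_s\rangle=1$ for all $s\in S$; (b) for all $s\ne t$ in $S$, $\langle\epsilon_s,\epsilon_t\rangle=-\cos(\pi/m_{s,t})$ if $m_{s,t}\ne\infty$, and $\langle\epsilon_s,\epsilon_t\rangle\in(-\infty,-1]$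 if $m_{s,t}=\infty$; (c) there exists $\chi\in V^*$ with $\chi(\epsilon_s)>0$ for all $s\in S$. ($\Pi$ is not required to be a basis of $V$.) For $s\in S$ let $f_s:V\to V$, $f_s(x)=x-2\langle x,\epsilon_s\rangle\epsilon_s$. The map $s\mapsto f_s$ extends to a faithful linear representation $f:W\to\mathrm{GL}(V)$ (a theorem of Krammer), called the rooted representation of $W$ associated with $(V,\langle .,.\rangle,\Pi)$. Let $V^G=\{x\in V\mid g(x)=x\text{ for all }g\in G\}$. Under the assumptions on $G$, $f(g(w))=g\circ f(w)\circ g^{-1}$ for all $g\in G$, $w\in W$, so $f$ induces $f^G:W^G\to\mathrm{GL}(V^G)$, $f^G(w)=f(w)|_{V^G}$. Definition of $\tilde M$ and $\tilde\Gamma$. Let $\mathcal S$ be the set of orbits $X$ of $G$ in $S$ with $W_X$ finite. Set $\tilde m_{X,X}=1$. Let $X,Y\in\mathcal S$, $X\ne Y$. If $m_{s,t}=2$ for all $s\in X$, $t\in Y$, set $\tilde m_{X,Y}=\tilde m_{Y,X}=2$. For $k\in\{1,\dots,5\}$, the pair $(X,Y)$ is called a bi-orbit of type $k$ if $\Gamma_{X\cup Y}$ is a disjoint union of copies of the following labelled graph (k), with vertices called $x_i$ lying in $X$ and vertices called $y_i$ lying in $Y$ (unlabelled edges have label 3): (1) a single edge $x_1 - y_1$ with label $m$, $m\ge3$ or $m=\infty$; (2) the path $y_1 - x_1 - y_2$; (3) the path $x_1 - y_1 - y_2 - x_2$; (4) the path $x_1 - y_1 \overset{4}{-} y_2 -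 x_2$, with middle edge labelled 4; (5) the star with centre $x_1$ and three leaves $y_1,y_2,y_3$. If $(X,Y)$ is a bi-orbit of type $k$, set $\tilde m_{X,Y}=\tilde m_{Y,X}=m$ if $k=1$, $=4$ if $k\in\{2,3\}$, $=8$ if $k=4$, $=6$ if $k=5$. In all remaining cases set $\tilde m_{X,Y}=\tilde m_{Y,X}=\infty$. $\tilde\Gamma$ is the Coxeter graph of the Coxeter matrix $\tilde M=(\tilde m_{X,Y})_{X,Y\in\mathcal S}$. Definition of $\tilde\Pi$. For $X\in\mathcal S$ put $a_X=\sum_{s\in X}\epsilon_s\in V^G$. Since $W_X$ is finite, the restriction of $\langle .,.\rangle$ to the span of $\{\epsilon_s\mid s\in X\}$ is a scalar product and these vectors are linearly independent, so $\|a_X\|=\sqrt{\langle a_X,a_X\rangle}>0$. Put $\tilde\epsilon_X=a_X/\|a_X\|$. *)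

theory Defs
  imports
    Complex_Main
    "HOL-Library.Extended_Nat"
    "HOL-Library.Disjoint_Sets"
    "HOL-Algebra.Group_Action"
    "HOL-Algebra.Generated_Groups"
begin

section \<open>Group presentations and Coxeter systems\<close>

text \<open>
  Words in the generators and their formal inverses: the letter \<open>(s, True)\<close> stands for \<open>s\<close>,
  the letter \<open>(s, False)\<close> for its inverse. Two words over \<open>S\<close> are related by \<open>pres_rel S R\<close> iff
  they represent the same element of the group with generators \<open>S\<close> and relators \<open>R\<close>.
\<close>

abbreviation words :: "'s set \<Rightarrow> ('s \<times> bool) list set" where
  "words S \<equiv> lists (S \<times> UNIV)"

inductive_set pres_rel ::
  "'s set \<Rightarrow> ('s \<times> bool) list set \<Rightarrow> (('s \<times> bool) list \<times> ('s \<times> bool) list) set"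
  for S R where
  refl: "u \<in> words S \<Longrightarrow> (u, u) \<in> pres_rel S R"
| sym: "(u, v) \<in> pres_rel S R \<Longrightarrow> (v, u) \<in> pres_rel S R"
| trans: "(u, v) \<in> pres_rel S R \<Longrightarrow> (v, w) \<in> pres_rel S R \<Longrightarrow> (u, w) \<in> pres_rel S R"
| cancel: "u \<in> words S \<Longrightarrow> v \<in> words S \<Longrightarrow> s \<in> S \<Longrightarrow>
    (u @ [(s, b), (s, \<not> b)] @ v, u @ v) \<in> pres_rel S R"
| relator: "u \<in> words S \<Longrightarrow> v \<in> words S \<Longrightarrow> r \<in> words S \<Longrightarrow> r \<in> R \<Longrightarrow>
    (u @ r @ v, u @ v) \<in> pres_rel S R"

definition presented_group ::
  "'s set \<Rightarrow> ('s \<times> bool) list set \<Rightarrow> ('s \<times> bool) list set monoid" where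
  "presented_group S R =
    \<lparr>carrier = words S // pres_rel S R,
     mult = \<lambda>A B. \<Union>u\<in>A. \<Union>v\<in>B. pres_rel S R `` {u @ v},
     one = pres_rel S R `` {[]}\<rparr>"

definition pres_gen :: "'s set \<Rightarrow> ('s \<times> bool) list set \<Rightarrow> 's \<Rightarrow> ('s \<times> bool) list set" where
  "pres_gen S R s = pres_rel S R `` {[(s, True)]}"

definition coxeter_matrix :: "'s set \<Rightarrow> ('s \<Rightarrow> 's \<Rightarrow> enat) \<Rightarrow> bool" where
  "coxeter_matrix S m \<longleftrightarrow>
    (\<forall>s\<in>S. m s s = 1) \<and> (\<forall>s\<in>S. \<forall>t\<in>S. s \<noteq> t \<longrightarrow> m s t = m t s \<and> 2 \<le> m s t)"

definition coxeter_relators :: "'s set \<Rightarrow> ('s \<Rightarrow> 's \<Rightarrow> enat) \<Rightarrow> ('s \<times> bool) list set" where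
  "coxeter_relators S m =
    {concat (replicate n [(s, True), (t, True)]) | s t n. s \<in> S \<and> t \<in> S \<and> m s t = enat n}"

text \<open>
  The group \<open>W\<close>, together with the family \<open>\<iota>\<close> of elements indexed by \<open>S\<close>, is a Coxeter system of
  the Coxeter graph with matrix \<open>m\<close>. The isomorphism forces \<open>\<iota>\<close> to have its values in \<open>W\<close> and
  \<open>\<iota> ` S\<close> to generate \<open>W\<close>.
\<close>

definition coxeter_system ::
  "('w, 'b) monoid_scheme \<Rightarrow> 's set \<Rightarrow> ('s \<Rightarrow> 's \<Rightarrow> enat) \<Rightarrow> ('s \<Rightarrow> 'w) \<Rightarrow> bool" where
  "coxeter_system W S m \<iota> \<longleftrightarrow> coxeter_matrix S m \<and> group W \<and>
    (\<exists>\<phi> \<in> iso (presented_group S (coxeter_relators S m)) W.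
      \<forall>s\<in>S. \<phi> (pres_gen S (coxeter_relators S m) s) = \<iota> s)"

definition word_length :: "('w, 'b) monoid_scheme \<Rightarrow> 'w set \<Rightarrow> 'w \<Rightarrow> nat" where
  "word_length W A w =
    (LEAST n. \<exists>us \<in> lists (A \<union> (\<lambda>a. inv\<^bsub>W\<^esub> a) ` A).
      length us = n \<and> foldr (\<otimes>\<^bsub>W\<^esub>) us \<one>\<^bsub>W\<^esub> = w)"

definition parabolic :: "('w, 'b) monoid_scheme \<Rightarrow> ('s \<Rightarrow> 'w) \<Rightarrow> 's set \<Rightarrow> 'w set" where
  "parabolic W \<iota> X = generate W (\<iota> ` X)"

definition longest_element :: "('w, 'b) monoid_scheme \<Rightarrow> ('s \<Rightarrow> 'w) \<Rightarrow> 's set \<Rightarrow> 'w" where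
  "longest_element W \<iota> X =
    (THE w. w \<in> parabolic W \<iota> X \<and>
      (\<forall>u \<in> parabolic W \<iota> X. word_length W (\<iota> ` X) u \<le> word_length W (\<iota> ` X) w))"


section \<open>Symmetries\<close>

definition symmetries :: "'s set \<Rightarrow> ('s \<Rightarrow> 's \<Rightarrow> enat) \<Rightarrow> ('s \<Rightarrow> 's) set" where
  "symmetries S m = {g \<in> Bij S. \<forall>s\<in>S. \<forall>t\<in>S. m (g s) (g t) = m s t}"

definition symmetry_group :: "('s \<Rightarrow> 's) set \<Rightarrow> 's set \<Rightarrow> ('s \<Rightarrow> 's \<Rightarrow> enat) \<Rightarrow> bool" where
  "symmetry_group G S m \<longleftrightarrow> subgroup G (BijGroup S) \<and> G \<subseteq> symmetries S m"

definition induced_auto ::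
  "('w, 'b) monoid_scheme \<Rightarrow> 's set \<Rightarrow> ('s \<Rightarrow> 'w) \<Rightarrow> ('s \<Rightarrow> 's) \<Rightarrow> 'w \<Rightarrow> 'w" where
  "induced_auto W S \<iota> g = (THE \<alpha>. \<alpha> \<in> auto W \<and> (\<forall>s\<in>S. \<alpha> (\<iota> s) = \<iota> (g s)))"

definition fixed_subgroup ::
  "('w, 'b) monoid_scheme \<Rightarrow> 's set \<Rightarrow> ('s \<Rightarrow> 'w) \<Rightarrow> ('s \<Rightarrow> 's) set \<Rightarrow> 'w set" where
  "fixed_subgroup W S \<iota> G = {w \<in> carrier W. \<forall>g\<in>G. induced_auto W S \<iota> g w = w}"

definition finite_orbits ::
  "('w, 'b) monoid_scheme \<Rightarrow> 's set \<Rightarrow> ('s \<Rightarrow> 'w) \<Rightarrow> ('s \<Rightarrow> 's) set \<Rightarrow> 's set set" where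
  "finite_orbits W S \<iota> G =
    {X \<in> orbits (BijGroup S\<lparr>carrier := G\<rparr>) S (\<lambda>g. g). finite (parabolic W \<iota> X)}"


section \<open>Bi-orbits and the folded Coxeter matrix\<close>

text \<open>
  A finite labelled graph without isolated vertices is given by the list of its labelled edges;
  the constructor of a vertex records on which side (\<open>X\<close> or \<open>Y\<close>) it has to lie.
\<close>

datatype bivertex = XV nat | YV nat

type_synonym bigraph = "(bivertex \<times> enat \<times> bivertex) list"

definition bigraph_vertices :: "bigraph \<Rightarrow> bivertex set" where
  "bigraph_vertices E = (\<Union>(a, l, b) \<in> set E. {a, b})"

definition bigraph_matrix :: "bigraph \<Rightarrow> bivertex \<Rightarrow> bivertex \<Rightarrow> enat" where
  "bigraph_matrix E a b =
    (if a = b then 1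
     else if \<exists>l. (a, l, b) \<in> set E \<or> (b, l, a) \<in> set E
     then (THE l. (a, l, b) \<in> set E \<or> (b, l, a) \<in> set E)
     else 2)"

definition graph1 :: "enat \<Rightarrow> bigraph" where
  "graph1 l = [(XV 1, l, YV 1)]"
definition graph2 :: bigraph where
  "graph2 = [(YV 1, 3, XV 1), (XV 1, 3, YV 2)]"
definition graph3 :: bigraph where
  "graph3 = [(XV 1, 3, YV 1), (YV 1, 3, YV 2), (YV 2, 3, XV 2)]"
definition graph4 :: bigraph where
  "graph4 = [(XV 1, 3, YV 1), (YV 1, 4, YV 2), (YV 2, 3, XV 2)]"
definition graph5 :: bigraph where
  "graph5 = [(XV 1, 3, YV 1), (XV 1, 3, YV 2), (XV 1, 3, YV 3)]"

text \<open>
  The full subgraph on \<open>C\<close> is a copy of \<open>E\<close>; equality of the Coxeter matrices says that edges and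
  their labels correspond.
\<close>

definition bigraph_copy ::
  "('s \<Rightarrow> 's \<Rightarrow> enat) \<Rightarrow> 's set \<Rightarrow> 's set \<Rightarrow> bigraph \<Rightarrow> 's set \<Rightarrow> bool" where
  "bigraph_copy m X Y E C \<longleftrightarrow>
    (\<exists>\<phi>. bij_betw \<phi> (bigraph_vertices E) C \<and>
      (\<forall>a \<in> bigraph_vertices E. \<forall>b \<in> bigraph_vertices E.
        m (\<phi> a) (\<phi> b) = bigraph_matrix E a b) \<and>
      (\<forall>i. XV i \<in> bigraph_vertices E \<longrightarrow> \<phi> (XV i) \<in> X) \<and>
      (\<forall>i. YV i \<in> bigraph_vertices E \<longrightarrow> \<phi> (YV i) \<in> Y))"

definition bi_orbit :: "('s \<Rightarrow> 's \<Rightarrow> enat) \<Rightarrow> bigraph \<Rightarrow> 's set \<Rightarrow> 's set \<Rightarrow> bool" where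
  "bi_orbit m E X Y \<longleftrightarrow>
    (\<exists>P. partition_on (X \<union> Y) P \<and>
      (\<forall>C\<in>P. \<forall>D\<in>P. C \<noteq> D \<longrightarrow> (\<forall>s\<in>C. \<forall>t\<in>D. m s t = 2)) \<and>
      (\<forall>C\<in>P. bigraph_copy m X Y E C))"

text \<open>
  Being a bi-orbit of a given type is a property of an ordered pair, whereas the folded matrix is symmetric.
\<close>

definition bi_orbit_sym :: "('s \<Rightarrow> 's \<Rightarrow> enat) \<Rightarrow> bigraph \<Rightarrow> 's set \<Rightarrow> 's set \<Rightarrow> bool" where
  "bi_orbit_sym m E X Y \<longleftrightarrow> bi_orbit m E X Y \<or> bi_orbit m E Y X"

definition folded_matrix :: "('s \<Rightarrow> 's \<Rightarrow> enat) \<Rightarrow> 's set \<Rightarrow> 's set \<Rightarrow> enat" where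
  "folded_matrix m X Y =
    (if X = Y then 1
     else if \<forall>s\<in>X. \<forall>t\<in>Y. m s t = 2 then 2
     else if \<exists>l\<ge>3. bi_orbit_sym m (graph1 l) X Y
       then (THE l. 3 \<le> l \<and> bi_orbit_sym m (graph1 l) X Y)
     else if bi_orbit_sym m graph2 X Y \<or> bi_orbit_sym m graph3 X Y then 4
     else if bi_orbit_sym m graph4 X Y then 8
     else if bi_orbit_sym m graph5 X Y then 6
     else \<infinity>)"


section \<open>Root bases and rooted representations\<close>

text \<open>Vector spaces are linear subspaces \<open>V\<close> of a type of class \<^class>\<open>real_vector\<close>.\<close>

definition linear_on :: "'v::real_vector set \<Rightarrow> ('v \<Rightarrow> 'u::real_vector) \<Rightarrow> bool" where
  "linear_on V \<phi> \<longleftrightarrow>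
    (\<forall>x\<in>V. \<forall>y\<in>V. \<phi> (x + y) = \<phi> x + \<phi> y) \<and> (\<forall>c. \<forall>x\<in>V. \<phi> (c *\<^sub>R x) = c *\<^sub>R \<phi> x)"

definition finite_dim_space :: "'v::real_vector set \<Rightarrow> bool" where
  "finite_dim_space V \<longleftrightarrow> (\<exists>b. finite b \<and> V = span b)"

definition symmetric_bilinear_on :: "'v::real_vector set \<Rightarrow> ('v \<Rightarrow> 'v \<Rightarrow> real) \<Rightarrow> bool" where
  "symmetric_bilinear_on V B \<longleftrightarrow>
    (\<forall>x\<in>V. linear_on V (B x)) \<and> (\<forall>x\<in>V. \<forall>y\<in>V. B x y = B y x)"

definition root_basis ::
  "'v::real_vector set \<Rightarrow> ('v \<Rightarrow> 'v \<Rightarrow> real) \<Rightarrow> 's set \<Rightarrow> ('s \<Rightarrow> 's \<Rightarrow> enat) \<Rightarrow> ('s \<Rightarrow> 'v) \<Rightarrow> bool"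
  where
  "root_basis V B S m \<epsilon> \<longleftrightarrow>
    finite_dim_space V \<and> symmetric_bilinear_on V B \<and>
    \<epsilon> ` S \<subseteq> V \<and> inj_on \<epsilon> S \<and>
    (\<forall>s\<in>S. B (\<epsilon> s) (\<epsilon> s) = 1) \<and>
    (\<forall>s\<in>S. \<forall>t\<in>S. s \<noteq> t \<longrightarrow>
      (case m s t of enat n \<Rightarrow> B (\<epsilon> s) (\<epsilon> t) = - cos (pi / real n)
                   | \<infinity> \<Rightarrow> B (\<epsilon> s) (\<epsilon> t) \<le> -1)) \<and>
    (\<exists>\<chi> :: 'v \<Rightarrow> real. linear_on V \<chi> \<and> (\<forall>s\<in>S. 0 < \<chi> (\<epsilon> s)))"

definition GL :: "'v::real_vector set \<Rightarrow> ('v \<Rightarrow> 'v) monoid" where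
  "GL V = (BijGroup V)\<lparr>carrier := {\<phi> \<in> Bij V. linear_on V \<phi>}\<rparr>"

definition reflection_on ::
  "'v::real_vector set \<Rightarrow> ('v \<Rightarrow> 'v \<Rightarrow> real) \<Rightarrow> 'v \<Rightarrow> 'v \<Rightarrow> 'v" where
  "reflection_on V B e = (\<lambda>x\<in>V. x - (2 * B x e) *\<^sub>R e)"

definition is_rooted_rep ::
  "('w, 'b) monoid_scheme \<Rightarrow> 's set \<Rightarrow> ('s \<Rightarrow> 'w) \<Rightarrow>
   'v::real_vector set \<Rightarrow> ('v \<Rightarrow> 'v \<Rightarrow> real) \<Rightarrow> ('s \<Rightarrow> 'v) \<Rightarrow> ('w \<Rightarrow> 'v \<Rightarrow> 'v) \<Rightarrow> bool" where
  "is_rooted_rep W S \<iota> V B \<epsilon> f \<longleftrightarrow>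
    f \<in> hom W (GL V) \<and> (\<forall>s\<in>S. f (\<iota> s) = reflection_on V B (\<epsilon> s))"

definition rooted_rep ::
  "('w, 'b) monoid_scheme \<Rightarrow> 's set \<Rightarrow> ('s \<Rightarrow> 'w) \<Rightarrow>
   'v::real_vector set \<Rightarrow> ('v \<Rightarrow> 'v \<Rightarrow> real) \<Rightarrow> ('s \<Rightarrow> 'v) \<Rightarrow> 'w \<Rightarrow> 'v \<Rightarrow> 'v" where
  "rooted_rep W S \<iota> V B \<epsilon> =
    (THE f. f \<in> extensional (carrier W) \<and> is_rooted_rep W S \<iota> V B \<epsilon> f)"

definition equivariant_embedding ::
  "('s \<Rightarrow> 's) set \<Rightarrow> 's set \<Rightarrow> 'v::real_vector set \<Rightarrow> ('v \<Rightarrow> 'v \<Rightarrow> real) \<Rightarrow> ('s \<Rightarrow> 'v) \<Rightarrow>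
   (('s \<Rightarrow> 's) \<Rightarrow> 'v \<Rightarrow> 'v) \<Rightarrow> bool" where
  "equivariant_embedding G S V B \<epsilon> \<rho> \<longleftrightarrow>
    \<rho> \<in> hom (BijGroup S\<lparr>carrier := G\<rparr>) (GL V) \<and> inj_on \<rho> G \<and>
    (\<forall>g\<in>G. \<forall>s\<in>S. \<rho> g (\<epsilon> s) = \<epsilon> (g s)) \<and>
    (\<forall>g\<in>G. \<forall>x\<in>V. \<forall>y\<in>V. B (\<rho> g x) (\<rho> g y) = B x y)"

definition fixed_space ::
  "('s \<Rightarrow> 's) set \<Rightarrow> (('s \<Rightarrow> 's) \<Rightarrow> 'v \<Rightarrow> 'v) \<Rightarrow> 'v set \<Rightarrow> 'v set" where
  "fixed_space G \<rho> V = {x \<in> V. \<forall>g\<in>G. \<rho> g x = x}"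

definition folded_root ::
  "('v::real_vector \<Rightarrow> 'v \<Rightarrow> real) \<Rightarrow> ('s \<Rightarrow> 'v) \<Rightarrow> 's set \<Rightarrow> 'v" where
  "folded_root B \<epsilon> X =
    (let a = (\<Sum>s\<in>X. \<epsilon> s) in (1 / sqrt (B a a)) *\<^sub>R a)"


section \<open>Every Coxeter matrix has a Coxeter system\<close>

lemma pres_rel_words: "(u, v) \<in> pres_rel S R \<Longrightarrow> u \<in> words S \<and> v \<in> words S"
  by (induction rule: pres_rel.induct) auto

lemma equiv_pres_rel: "equiv (words S) (pres_rel S R)"
proof (rule equivI)
  show "pres_rel S R \<subseteq> words S \<times> words S"
    by (rule subrelI) (simp only: mem_Sigma_iff pres_rel_words)
  show "refl_on (words S) (pres_rel S R)"
    by (rule refl_onI) (rule pres_rel.refl)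
  show "sym (pres_rel S R)"
    by (rule symI) (rule pres_rel.sym)
  show "trans (pres_rel S R)"
    by (rule transI) (rule pres_rel.trans)
qed

lemma pres_rel_context:
  assumes "(u, v) \<in> pres_rel S R" "a \<in> words S" "b \<in> words S"
  shows "(a @ u @ b, a @ v @ b) \<in> pres_rel S R"
  using assms(1)
proof (induction rule: pres_rel.induct)
  case (refl u)
  show ?case
    by (rule pres_rel.refl) (use refl assms in simp)
next
  case (sym u v)
  then show ?case by (blast intro: pres_rel.sym)
next
  case (trans u v w)
  then show ?case by (blast intro: pres_rel.trans)
next
  case (cancel u v s c)
  have "a @ u \<in> words S" "v @ b \<in> words S"
    using cancel assms by simp_all
  from pres_rel.cancel[OF this cancel(3), of c R] show ?case by simp
next
  case (relator u v r)
  have "a @ u \<in> words S" "v @ b \<in> words S"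
    using relator assms by simp_all
  from pres_rel.relator[OF this relator(3,4)] show ?case by simp
qed

lemma pres_rel_append:
  assumes "(u, u') \<in> pres_rel S R" "(v, v') \<in> pres_rel S R"
  shows "(u @ v, u' @ v') \<in> pres_rel S R"
proof -
  have "(u @ v, u' @ v) \<in> pres_rel S R"
    using pres_rel_context[OF assms(1), of "[]" v] pres_rel_words[OF assms(2)] by simp
  moreover have "(u' @ v, u' @ v') \<in> pres_rel S R"
    using pres_rel_context[OF assms(2), of u' "[]"] pres_rel_words[OF assms(1)] by simp
  ultimately show ?thesis by (rule pres_rel.trans)
qed

lemma presented_group_mult:
  assumes "u \<in> words S" "v \<in> words S"
  shows "(pres_rel S R `` {u}) \<otimes>\<^bsub>presented_group S R\<^esub> (pres_rel S R `` {v})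
    = pres_rel S R `` {u @ v}"
proof -
  have "congruent2 (pres_rel S R) (pres_rel S R) (\<lambda>u v. pres_rel S R `` {u @ v})"
    by (intro congruent2I' equiv_class_eq[OF equiv_pres_rel] pres_rel_append)
  from UN_equiv_class2[OF equiv_pres_rel equiv_pres_rel this assms]
  show ?thesis by (simp add: presented_group_def)
qed

lemma pres_rel_inverse:
  assumes "u \<in> words S"
  shows "(rev (map (\<lambda>(s, b). (s, \<not> b)) u) @ u, []) \<in> pres_rel S R"
  using assms
proof (induction u rule: list.induct)
  case Nil
  show ?case by (simp add: pres_rel.refl)
next
  case (Cons x u)
  obtain s b where x: "x = (s, b)" by (cases x)
  let ?i = "rev (map (\<lambda>(s, b). (s, \<not> b)) u)"
  have u: "u \<in> words S" and s: "s \<in> S" using Cons.prems x by simp_all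
  have i: "?i \<in> words S" using u by (induction u) auto
  have "(?i @ [(s, \<not> b), (s, \<not> \<not> b)] @ u, ?i @ u) \<in> pres_rel S R"
    by (rule pres_rel.cancel[OF i u s])
  then show ?case using Cons.IH[OF u] x by (auto intro: pres_rel.trans)
qed

lemma group_presented_group: "group (presented_group S R)"
proof (rule groupI)
  let ?P = "presented_group S R" and ?c = "\<lambda>u. pres_rel S R `` {u}"
  have carr: "carrier ?P = ?c ` words S"
    by (auto simp: presented_group_def quotient_def)
  have one: "\<one>\<^bsub>?P\<^esub> = ?c []"
    by (simp add: presented_group_def)
  show "\<one>\<^bsub>?P\<^esub> \<in> carrier ?P"
    unfolding carr one by (rule imageI) simp
  fix x assume "x \<in> carrier ?P"
  then obtain u where u: "u \<in> words S" and x: "x = ?c u" unfolding carr by auto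
  show "\<one>\<^bsub>?P\<^esub> \<otimes>\<^bsub>?P\<^esub> x = x"
    using presented_group_mult[of "[]" S u R] u unfolding one x by simp
  let ?i = "rev (map (\<lambda>(s, b). (s, \<not> b)) u)"
  have i: "?i \<in> words S" using u by (induction u) auto
  have "?c ?i \<otimes>\<^bsub>?P\<^esub> x = \<one>\<^bsub>?P\<^esub>"
    unfolding one x presented_group_mult[OF i u]
    by (rule equiv_class_eq[OF equiv_pres_rel pres_rel_inverse[OF u]])
  then show "\<exists>y\<in>carrier ?P. y \<otimes>\<^bsub>?P\<^esub> x = \<one>\<^bsub>?P\<^esub>"
    unfolding carr using i by blast
  fix y assume "y \<in> carrier ?P"
  then obtain v where v: "v \<in> words S" and y: "y = ?c v" unfolding carr by auto
  have uv: "u @ v \<in> words S" using u v by simp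
  show "x \<otimes>\<^bsub>?P\<^esub> y \<in> carrier ?P"
    unfolding x y presented_group_mult[OF u v] carr using uv by (rule imageI)
  fix z assume "z \<in> carrier ?P"
  then obtain w where w: "w \<in> words S" and z: "z = ?c w" unfolding carr by auto
  have vw: "v @ w \<in> words S" using v w by simp
  show "x \<otimes>\<^bsub>?P\<^esub> y \<otimes>\<^bsub>?P\<^esub> z = x \<otimes>\<^bsub>?P\<^esub> (y \<otimes>\<^bsub>?P\<^esub> z)"
    unfolding x y z
    by (simp only: presented_group_mult u v w uv vw append_assoc)
qed

lemma coxeter_system_presented_group:
  assumes "coxeter_matrix S m"
  shows "coxeter_system (presented_group S (coxeter_relators S m)) S m
    (pres_gen S (coxeter_relators S m))"
  unfolding coxeter_system_def
  using assms group_presented_group id_iso by (metis id_apply)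

end

theory Submission
  imports Defs
begin

text \<open>
  The proof rests on Krammer's theorem, for any group generated by elements that satisfy the Coxeter
  relations and act on a root basis by reflections: if appending \<open>s\<close> to \<open>w\<close> does not shorten \<open>w\<close>,
  then \<open>w\<close> maps the simple root of \<open>s\<close> to a nonnegative combination of simple roots. So such an action
  is faithful, and the group is automatically a Coxeter group, because the action of the presented
  group, which factors through it, is faithful too.

  The theorem follows by applying this to \<open>W^G\<close> acting on \<open>V^G\<close>. The descents of an element of \<open>W^G\<close>
  form a union of orbits, and if \<open>X\<close> is an orbit of descents then \<open>W_X\<close> is finite and \<open>w_X\<close> can be
  split off; hence the \<open>w_X\<close> generate \<open>W^G\<close>, and \<open>W^G\<close> acts faithfully on \<open>V^G\<close>. On \<open>V^G\<close> the
  element \<open>w_X\<close> is the reflection in \<open>a_X\<close>: it changes vectors only by multiples of \<open>a_X\<close>, as these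
  are the \<open>G\<close>-fixed vectors in the span of \<open>X\<close>, and it negates \<open>a_X\<close>. Finally, for \<open>s \<in> X\<close> and \<open>t \<in> Y\<close>
  the squared inner product of the normalized \<open>a_X\<close> and \<open>a_Y\<close> is
  \<open>\<langle>a_Y, \<epsilon>_s\<rangle>\<langle>a_X, \<epsilon>_t\<rangle> / (\<langle>a_X, \<epsilon>_s\<rangle>\<langle>a_Y, \<epsilon>_t\<rangle>)\<close>. An edge at \<open>s\<close> contributes at most \<open>- 1/2\<close> to these
  products, so only the five types of bi-orbits keep the quotient below 1.
\<close>


section \<open>Homomorphisms out of a presented group\<close>

text \<open>The obstacle is circularity. That the \<open>w_X\<close> satisfy the relations of the
  folded matrix is part of the claim, so nothing about \<open>W^G\<close> may be drawn from a
  presentation of it. Faithfulness of the action on \<open>V^G\<close> is therefore obtained inside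
  \<open>W\<close> first: a nontrivial fixed element sends some orbit sum of simple roots into the
  negative cone. The relation \<open>(w_X w_Y)^n = 1\<close> is then checked in
  \<open>GL(V^G)\<close>, where it is plane trigonometry for two reflections at angle pi/n, and
  faithfulness lifts it to \<open>W\<close>. Only after that does Krammer's theorem yield the
  presentation. This is why \<open>coxeter_generators\<close> asks for generation and relations
  only. For an infinite label no order of a product is computed: an inner product of at most -1 is
  all that the argument with dihedral pairs asks for. The simple roots may be linearly dependent, in
  \<open>V\<close> as in \<open>V^G\<close>, so the sign of a root is not the sign of coordinates
  but membership in a cone; the functional of the root basis keeps that cone free of lines.\<close>

locale coxeter_generators = group W for W :: "('w, 'b) monoid_scheme" (structure) +
  fixes S :: "'s set" and m :: "'s \<Rightarrow> 's \<Rightarrow> enat" and \<iota> :: "'s \<Rightarrow> 'w"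
  assumes coxeter_matrix: "coxeter_matrix S m"
    and gen_closed [simp]: "s \<in> S \<Longrightarrow> \<iota> s \<in> carrier W"
    and generate_gen: "generate W (\<iota> ` S) = carrier W"
    and gen_rel: "\<lbrakk>s \<in> S; t \<in> S; m s t = enat n\<rbrakk> \<Longrightarrow> (\<iota> s \<otimes> \<iota> t) [^] n = \<one>"

abbreviation coxeter_group :: "'s set \<Rightarrow> ('s \<Rightarrow> 's \<Rightarrow> enat) \<Rightarrow> ('s \<times> bool) list set monoid" where
  "coxeter_group S m \<equiv> presented_group S (coxeter_relators S m)"

abbreviation coxeter_gen :: "'s set \<Rightarrow> ('s \<Rightarrow> 's \<Rightarrow> enat) \<Rightarrow> 's \<Rightarrow> ('s \<times> bool) list set" where
  "coxeter_gen S m \<equiv> pres_gen S (coxeter_relators S m)"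

lemma presented_group_carrier:
  "carrier (presented_group S R) = (\<lambda>u. pres_rel S R `` {u}) ` words S"
  by (auto simp: presented_group_def quotient_def)

lemma presented_group_one: "\<one>\<^bsub>presented_group S R\<^esub> = pres_rel S R `` {[]}"
  by (simp add: presented_group_def)

lemma pres_class_eq: "(u, v) \<in> pres_rel S R \<Longrightarrow> pres_rel S R `` {u} = pres_rel S R `` {v}"
  by (rule equiv_class_eq[OF equiv_pres_rel])

lemma pres_class_pow:
  assumes "u \<in> words S"
  shows "pres_rel S R `` {concat (replicate n u)} = (pres_rel S R `` {u}) [^]\<^bsub>presented_group S R\<^esub> n"
proof (induction n)
  case 0
  interpret group "presented_group S R" by (rule group_presented_group)
  show ?case by (simp add: presented_group_one)
next
  case (Suc n)
  interpret group "presented_group S R" by (rule group_presented_group)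
  have "concat (replicate n u) \<in> words S" using assms by (induction n) auto
  moreover have "pres_rel S R `` {u} \<in> carrier (presented_group S R)"
    using assms by (auto simp: presented_group_carrier)
  note nat_pow_Suc2[OF this, of n]
  ultimately show ?case
    using Suc presented_group_mult[OF assms, of "concat (replicate n u)" R]
    by simp
qed

lemma pres_class_inverse_letter:
  assumes "s \<in> S"
  shows "pres_rel S R `` {[(s, False)]} = inv\<^bsub>presented_group S R\<^esub> (pres_gen S R s)"
proof -
  interpret group "presented_group S R" by (rule group_presented_group)
  have w: "[(s, b)] \<in> words S" for b using assms by auto
  have "([] @ [(s, False), (s, \<not> False)] @ [], [] @ []) \<in> pres_rel S R"
    by (rule pres_rel.cancel) (use assms in auto)
  then have "pres_rel S R `` {[(s, False)]} \<otimes>\<^bsub>presented_group S R\<^esub> pres_gen S R s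
      = \<one>\<^bsub>presented_group S R\<^esub>"
    using presented_group_mult[of "[(s, False)]" S "[(s, True)]" R] w
      pres_class_eq[of "[(s, False), (s, True)]" "[]" S R]
    by (simp add: pres_gen_def presented_group_one)
  moreover have "pres_rel S R `` {[(s, b)]} \<in> carrier (presented_group S R)" for b
    using w by (auto simp: presented_group_carrier)
  ultimately show ?thesis
    by (metis inv_equality pres_gen_def)
qed

lemma pres_gen_closed: "s \<in> S \<Longrightarrow> pres_gen S R s \<in> carrier (presented_group S R)"
  by (auto simp: pres_gen_def presented_group_carrier)

lemma generate_pres_gen:
  "generate (presented_group S R) (pres_gen S R ` S) = carrier (presented_group S R)"
proof
  interpret group "presented_group S R" by (rule group_presented_group)
  show "generate (presented_group S R) (pres_gen S R ` S) \<subseteq> carrier (presented_group S R)"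
    by (intro generate_incl) (auto simp: pres_gen_closed)
  have "pres_rel S R `` {u} \<in> generate (presented_group S R) (pres_gen S R ` S)"
    if "u \<in> words S" for u
    using that
  proof (induction u rule: list.induct)
    case Nil
    then show ?case by (metis generate.one presented_group_one)
  next
    case (Cons x u)
    obtain s b where x: "x = (s, b)" by (cases x)
    have s: "s \<in> S" and u: "u \<in> words S" using Cons.prems x by auto
    have "pres_rel S R `` {[(s, b)]} \<in> generate (presented_group S R) (pres_gen S R ` S)"
      using s by (cases b) (auto simp: pres_class_inverse_letter pres_gen_def[symmetric]
          intro: generate.incl generate.inv)
    moreover have "pres_rel S R `` {x # u}
        = pres_rel S R `` {[(s, b)]} \<otimes>\<^bsub>presented_group S R\<^esub> pres_rel S R `` {u}"
      using presented_group_mult[of "[(s, b)]" S u R] s u x by simp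
    ultimately show ?case using Cons.IH[OF u] by (metis generate.eng)
  qed
  then show "carrier (presented_group S R) \<subseteq> generate (presented_group S R) (pres_gen S R ` S)"
    by (auto simp: presented_group_carrier)
qed

lemma coxeter_group_generators:
  assumes "coxeter_matrix S m"
  shows "coxeter_generators (coxeter_group S m) S m (coxeter_gen S m)"
proof (intro coxeter_generators.intro coxeter_generators_axioms.intro group_presented_group
    assms pres_gen_closed generate_pres_gen)
  fix s t n assume st: "s \<in> S" "t \<in> S" "m s t = enat n"
  let ?R = "coxeter_relators S m" and ?w = "[(s, True), (t, True)]"
  have w: "?w \<in> words S" using st by auto
  have rw: "concat (replicate n ?w) \<in> words S" using w by (induction n) auto
  have "concat (replicate n ?w) \<in> ?R" using st by (auto simp: coxeter_relators_def)
  then have "([] @ concat (replicate n ?w) @ [], [] @ []) \<in> pres_rel S ?R"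
    by (intro pres_rel.relator rw) auto
  then have "pres_rel S ?R `` {concat (replicate n ?w)} = \<one>\<^bsub>coxeter_group S m\<^esub>"
    unfolding presented_group_one by (intro pres_class_eq) simp
  moreover have "pres_rel S ?R `` {?w} = coxeter_gen S m s \<otimes>\<^bsub>coxeter_group S m\<^esub> coxeter_gen S m t"
    using presented_group_mult[of "[(s, True)]" S "[(t, True)]" ?R] st by (simp add: pres_gen_def)
  ultimately show "(coxeter_gen S m s \<otimes>\<^bsub>coxeter_group S m\<^esub> coxeter_gen S m t)
      [^]\<^bsub>coxeter_group S m\<^esub> n = \<one>\<^bsub>coxeter_group S m\<^esub>"
    using pres_class_pow[OF w, of ?R n] by simp
qed

section \<open>Evaluating words in a group, and the universal property of a presentation\<close>

definition word_value :: "('h, 'c) monoid_scheme \<Rightarrow> ('s \<Rightarrow> 'h) \<Rightarrow> ('s \<times> bool) list \<Rightarrow> 'h" where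
  "word_value H j u =
    foldr (\<lambda>(s, b) x. (if b then j s else inv\<^bsub>H\<^esub> (j s)) \<otimes>\<^bsub>H\<^esub> x) u \<one>\<^bsub>H\<^esub>"

context group
begin

lemma word_value_Nil: "word_value G j [] = \<one>"
  by (simp add: word_value_def)

lemma word_value_Cons:
  "word_value G j ((s, b) # u) = (if b then j s else inv (j s)) \<otimes> word_value G j u"
  by (simp add: word_value_def)

lemma word_value_closed:
  "\<lbrakk>u \<in> words S; j \<in> S \<rightarrow> carrier G\<rbrakk> \<Longrightarrow> word_value G j u \<in> carrier G"
proof (induction u rule: list.induct)
  case (Cons x u)
  then show ?case by (cases x) (auto simp: word_value_Cons Pi_iff)
qed (simp add: word_value_Nil)

lemma word_value_append:
  "\<lbrakk>u \<in> words S; v \<in> words S; j \<in> S \<rightarrow> carrier G\<rbrakk> \<Longrightarrow>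
    word_value G j (u @ v) = word_value G j u \<otimes> word_value G j v"
proof (induction u rule: list.induct)
  case Nil
  then show ?case using word_value_closed[of v S j] by (simp add: word_value_Nil)
next
  case (Cons x u)
  then show ?case
    using word_value_closed[of v S j] word_value_closed[of u S j]
    by (cases x) (auto simp: word_value_Cons Pi_iff m_assoc)
qed

lemma word_value_concat_replicate:
  assumes "u \<in> words S" "j \<in> S \<rightarrow> carrier G"
  shows "word_value G j (concat (replicate n u)) = word_value G j u [^] n"
proof (induction n)
  case (Suc n)
  have "concat (replicate n u) \<in> words S" using assms(1) by (induction n) auto
  then show ?case
    using Suc assms nat_pow_Suc2[OF word_value_closed[OF assms], of n]
    by (simp add: word_value_append)
qed (simp add: word_value_Nil)

lemma word_value_pres_rel:
  assumes "(u, v) \<in> pres_rel S R" "j \<in> S \<rightarrow> carrier G"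
    "\<And>r. \<lbrakk>r \<in> R; r \<in> words S\<rbrakk> \<Longrightarrow> word_value G j r = \<one>"
  shows "word_value G j u = word_value G j v"
  using assms(1)
proof (induction rule: pres_rel.induct)
  case (cancel u v s b)
  have "word_value G j [(s, b), (s, \<not> b)] = \<one>"
    using assms(2) cancel(3) by (auto simp: word_value_Cons word_value_Nil Pi_iff)
  moreover have "[(s, b), (s, \<not> b)] \<in> words S" using cancel by auto
  ultimately show ?case
    using cancel assms(2) word_value_closed[of _ S j]
    by (simp add: word_value_append[where S = S] del: append.simps lists.Cons)
next
  case (relator u v r)
  then show ?case
    using assms word_value_closed[of _ S j]
    by (simp add: word_value_append[where S = S])
qed auto

text \<open>Von Dyck's theorem. A class is evaluated at an arbitrarily chosen representative;
  \<open>word_value_pres_rel\<close> makes the choice immaterial.\<close>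

lemma presented_group_hom_exists:
  assumes j: "j \<in> S \<rightarrow> carrier G"
    and R: "\<And>r. \<lbrakk>r \<in> R; r \<in> words S\<rbrakk> \<Longrightarrow> word_value G j r = \<one>"
  shows "\<exists>\<phi> \<in> hom (presented_group S R) G. \<forall>s\<in>S. \<phi> (pres_gen S R s) = j s"
proof -
  define \<phi> where "\<phi> A = word_value G j (SOME u. u \<in> A)" for A
  have val: "\<phi> (pres_rel S R `` {u}) = word_value G j u" if "u \<in> words S" for u
  proof -
    have "u \<in> pres_rel S R `` {u}" using that by (auto intro: pres_rel.refl)
    then have "(SOME v. v \<in> pres_rel S R `` {u}) \<in> pres_rel S R `` {u}" by (rule someI)
    then show ?thesis
      unfolding \<phi>_def using word_value_pres_rel[OF _ j R, of u _ R] by auto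
  qed
  have "\<phi> \<in> hom (presented_group S R) G"
  proof (rule homI)
    fix x y assume "x \<in> carrier (presented_group S R)" "y \<in> carrier (presented_group S R)"
    then obtain u v where uv: "u \<in> words S" "v \<in> words S"
      and xy: "x = pres_rel S R `` {u}" "y = pres_rel S R `` {v}"
      by (auto simp only: presented_group_carrier)
    have "u @ v \<in> words S" using uv by simp
    then show "\<phi> (x \<otimes>\<^bsub>presented_group S R\<^esub> y) = \<phi> x \<otimes> \<phi> y"
      unfolding xy presented_group_mult[OF uv] val[OF uv(1)] val[OF uv(2)]
      by (subst val) (simp_all only: word_value_append[OF uv j])
    show "\<phi> x \<in> carrier G" unfolding xy val[OF uv(1)] by (rule word_value_closed[OF uv(1) j])
  qed
  moreover have "\<phi> (pres_gen S R s) = j s" if "s \<in> S" for s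
    using val[of "[(s, True)]"] that j
    by (auto simp: pres_gen_def word_value_Cons word_value_Nil Pi_iff)
  ultimately show ?thesis by blast
qed

lemma coxeter_group_hom_exists:
  assumes j: "j \<in> S \<rightarrow> carrier G"
    and R: "\<And>s t n. \<lbrakk>s \<in> S; t \<in> S; m s t = enat n\<rbrakk> \<Longrightarrow> (j s \<otimes> j t) [^] n = \<one>"
  shows "\<exists>\<phi> \<in> hom (coxeter_group S m) G. \<forall>s\<in>S. \<phi> (coxeter_gen S m s) = j s"
proof (rule presented_group_hom_exists[OF j])
  fix r assume "r \<in> coxeter_relators S m" "r \<in> words S"
  then obtain s t n where r: "r = concat (replicate n [(s, True), (t, True)])"
    and st: "s \<in> S" "t \<in> S" "m s t = enat n"
    unfolding coxeter_relators_def by auto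
  have "word_value G j r = word_value G j [(s, True), (t, True)] [^] n"
    unfolding r by (rule word_value_concat_replicate[OF _ j]) (use st in auto)
  also have "word_value G j [(s, True), (t, True)] = j s \<otimes> j t"
    using st j by (auto simp: word_value_Cons word_value_Nil Pi_iff)
  finally show "word_value G j r = \<one>" using R[OF st] by simp
qed

end

lemma coxeter_system_hom_exists:
  assumes W: "coxeter_system W S m \<iota>" and H: "group H" and j: "j \<in> S \<rightarrow> carrier H"
    and R: "\<And>s t n. \<lbrakk>s \<in> S; t \<in> S; m s t = enat n\<rbrakk> \<Longrightarrow> (j s \<otimes>\<^bsub>H\<^esub> j t) [^]\<^bsub>H\<^esub> n = \<one>\<^bsub>H\<^esub>"
  shows "\<exists>\<phi> \<in> hom W H. \<forall>s\<in>S. \<phi> (\<iota> s) = j s"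
proof -
  obtain \<psi> where \<psi>: "\<psi> \<in> iso (coxeter_group S m) W"
    "\<And>s. s \<in> S \<Longrightarrow> \<psi> (coxeter_gen S m s) = \<iota> s"
    using W unfolding coxeter_system_def by blast
  obtain \<phi> where \<phi>: "\<phi> \<in> hom (coxeter_group S m) H"
    "\<And>s. s \<in> S \<Longrightarrow> \<phi> (coxeter_gen S m s) = j s"
    using group.coxeter_group_hom_exists[OF H j R] by blast
  let ?i = "inv_into (carrier (coxeter_group S m)) \<psi>"
  have "?i \<in> hom W (coxeter_group S m)"
    using group.iso_set_sym[OF group_presented_group \<psi>(1)] by (simp add: iso_def)
  then have "\<phi> \<circ> ?i \<in> hom W H" using \<phi>(1) by (rule hom_compose)
  moreover have "(\<phi> \<circ> ?i) (\<iota> s) = j s" if "s \<in> S" for s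
  proof -
    have "?i (\<iota> s) = coxeter_gen S m s"
      unfolding \<psi>(2)[OF that, symmetric] using \<psi>(1) that
      by (intro inv_into_f_f pres_gen_closed) (auto simp: iso_def bij_betw_def)
    then show ?thesis using \<phi>(2)[OF that] by simp
  qed
  ultimately show ?thesis by blast
qed

lemma coxeter_system_generators:
  assumes "coxeter_system W S m \<iota>"
  shows "coxeter_generators W S m \<iota>"
proof -
  obtain \<psi> where \<psi>: "\<psi> \<in> iso (coxeter_group S m) W"
    "\<And>s. s \<in> S \<Longrightarrow> \<psi> (coxeter_gen S m s) = \<iota> s"
    and m: "coxeter_matrix S m" and W: "group W"
    using assms unfolding coxeter_system_def by blast
  interpret P: coxeter_generators "coxeter_group S m" S m "coxeter_gen S m"
    by (rule coxeter_group_generators[OF m])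
  interpret h: group_hom "coxeter_group S m" W \<psi>
    using \<psi>(1) W by (intro group_hom.intro group_hom_axioms.intro P.is_group) (auto simp: iso_def)
  have im: "\<psi> ` carrier (coxeter_group S m) = carrier W"
    using \<psi>(1) by (auto simp: iso_def bij_betw_def)
  have img: "\<iota> ` S = \<psi> ` coxeter_gen S m ` S"
    using \<psi>(2) by (auto simp: image_image)
  show ?thesis
  proof (intro coxeter_generators.intro coxeter_generators_axioms.intro m W)
    show "\<iota> s \<in> carrier W" if "s \<in> S" for s
      using \<psi>(2)[OF that] h.hom_closed P.gen_closed[OF that] by metis
    show "generate W (\<iota> ` S) = carrier W"
      unfolding img using h.generate_img[of "coxeter_gen S m ` S"] P.generate_gen im
      by (simp add: image_subset_iff)
    fix s t n assume st: "s \<in> S" "t \<in> S" "m s t = enat n"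
    show "(\<iota> s \<otimes>\<^bsub>W\<^esub> \<iota> t) [^]\<^bsub>W\<^esub> n = \<one>\<^bsub>W\<^esub>"
      using arg_cong[OF P.gen_rel[OF st], of \<psi>] st
      by (simp add: \<psi>(2)[symmetric] h.hom_nat_pow)
  qed
qed

text \<open>Generation already makes the canonical homomorphism from the presented group surjective,
  so injectivity is all that remains. It is assumed for every such \<open>\<phi>\<close> because the
  homomorphism is only obtained inside the proof.\<close>

lemma (in coxeter_generators) coxeter_systemI:
  assumes "\<And>\<phi>. \<lbrakk>\<phi> \<in> hom (coxeter_group S m) W; \<And>s. s \<in> S \<Longrightarrow> \<phi> (coxeter_gen S m s) = \<iota> s\<rbrakk> \<Longrightarrow>
    inj_on \<phi> (carrier (coxeter_group S m))"
  shows "coxeter_system W S m \<iota>"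
proof -
  obtain \<phi> where \<phi>: "\<phi> \<in> hom (coxeter_group S m) W"
    "\<And>s. s \<in> S \<Longrightarrow> \<phi> (coxeter_gen S m s) = \<iota> s"
    using coxeter_group_hom_exists[of \<iota> S m] gen_rel by auto
  interpret P: coxeter_generators "coxeter_group S m" S m "coxeter_gen S m"
    by (rule coxeter_group_generators[OF coxeter_matrix])
  interpret h: group_hom "coxeter_group S m" W \<phi>
    using \<phi>(1) by (intro group_hom.intro group_hom_axioms.intro P.is_group is_group)
  have "\<iota> ` S = \<phi> ` coxeter_gen S m ` S"
    using \<phi>(2) by (auto simp: image_image)
  then have "\<phi> ` carrier (coxeter_group S m) = carrier W"
    using h.generate_img[of "coxeter_gen S m ` S"] P.generate_gen generate_gen
    by (simp add: image_subset_iff)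
  then have "\<phi> \<in> iso (coxeter_group S m) W"
    using \<phi>(1) assms[OF \<phi>] by (simp add: iso_def bij_betw_def)
  then show ?thesis
    unfolding coxeter_system_def using \<phi>(2) coxeter_matrix is_group by blast
qed

section \<open>Words and length\<close>

text \<open>Words grow at the left and, when nonempty, end in \<open>t\<close>. So shorter ones are
  suffixes of longer ones, and the parity of \<open>k\<close> tells which letter comes next on the
  left.\<close>

primrec alternating :: "'a \<Rightarrow> 'a \<Rightarrow> nat \<Rightarrow> 'a list" where
  "alternating s t 0 = []"
| "alternating s t (Suc k) = (if even k then t else s) # alternating s t k"

lemma length_alternating [simp]: "length (alternating s t k) = k"
  by (induction k) auto

lemma set_alternating: "set (alternating s t k) \<subseteq> {s, t}"
  by (induction k) auto

lemma alternating_split: "\<exists>xs. alternating s t (j + k) = xs @ alternating s t k \<and> length xs = j"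
proof (induction j)
  case (Suc j)
  then obtain xs where "alternating s t (j + k) = xs @ alternating s t k" "length xs = j"
    by blast
  then show ?case by (intro exI[of _ "(if even (j + k) then t else s) # xs"]) simp
qed simp

lemma alternating_Suc_right: "alternating s t (Suc k) = alternating t s k @ [t]"
  by (induction k) auto

lemma (in group) subgroup_generates_itself:
  assumes "subgroup H G" "generate G A = H"
  shows "generate (G\<lparr>carrier := H\<rparr>) A = H"
proof -
  have "A \<subseteq> H" using assms(2) by (auto intro: generate.incl)
  then show ?thesis using generate_consistent[OF _ assms(1)] assms(2) by metis
qed

context coxeter_generators
begin

definition word_prod :: "'s list \<Rightarrow> 'w" where
  "word_prod us = foldr (\<otimes>) (map \<iota> us) \<one>"

abbreviation len :: "'w \<Rightarrow> nat" where
  "len \<equiv> word_length W (\<iota> ` S)"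

lemma gen_square [simp]: "s \<in> S \<Longrightarrow> \<iota> s \<otimes> \<iota> s = \<one>"
  using gen_rel[of s s 1] coxeter_matrix by (simp add: coxeter_matrix_def one_enat_def)

lemma inv_gen [simp]: "s \<in> S \<Longrightarrow> inv (\<iota> s) = \<iota> s"
  by (rule inv_equality) auto

lemma mult_gen_gen [simp]: "\<lbrakk>u \<in> carrier W; s \<in> S\<rbrakk> \<Longrightarrow> u \<otimes> \<iota> s \<otimes> \<iota> s = u"
  by (simp add: m_assoc)

lemma gen_mult_gen [simp]: "\<lbrakk>u \<in> carrier W; s \<in> S\<rbrakk> \<Longrightarrow> \<iota> s \<otimes> (\<iota> s \<otimes> u) = u"
  by (simp add: m_assoc[symmetric])

lemma word_prod_Nil [simp]: "word_prod [] = \<one>"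
  by (simp add: word_prod_def)

lemma word_prod_Cons [simp]: "word_prod (s # us) = \<iota> s \<otimes> word_prod us"
  by (simp add: word_prod_def)

lemma word_prod_closed [simp]: "set us \<subseteq> S \<Longrightarrow> word_prod us \<in> carrier W"
  by (induction us) auto

lemma word_prod_append:
  "\<lbrakk>set us \<subseteq> S; set vs \<subseteq> S\<rbrakk> \<Longrightarrow> word_prod (us @ vs) = word_prod us \<otimes> word_prod vs"
  by (induction us) (auto simp: m_assoc)

lemma word_prod_surj:
  assumes "u \<in> carrier W"
  shows "\<exists>us. set us \<subseteq> S \<and> word_prod us = u"
proof -
  have "u \<in> generate W (\<iota> ` S)" using assms generate_gen by simp
  then show ?thesis
  proof (induction rule: generate.induct)
    case one
    show ?case by (rule exI[of _ "[]"]) simp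
  next
    case (incl h)
    then obtain s where "s \<in> S" "h = \<iota> s" by auto
    then show ?case by (intro exI[of _ "[s]"]) simp
  next
    case (inv h)
    then obtain s where "s \<in> S" "h = \<iota> s" by auto
    then show ?case by (intro exI[of _ "[s]"]) simp
  next
    case (eng h1 h2)
    then show ?case by (metis Un_subset_iff set_append word_prod_append)
  qed
qed

text \<open>\<open>word_length\<close> also admits inverses of generators as letters; the generators
  are involutions, so the minimum may be taken over words in \<open>S\<close> alone.\<close>

lemma len_eq_Least: "len u = (LEAST n. \<exists>us. set us \<subseteq> S \<and> length us = n \<and> word_prod us = u)"
proof -
  have inv: "(\<lambda>a. inv a) ` \<iota> ` S = \<iota> ` S" by force
  have "(\<exists>us \<in> lists (\<iota> ` S \<union> (\<lambda>a. inv a) ` \<iota> ` S). length us = n \<and> foldr (\<otimes>) us \<one> = u)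
    \<longleftrightarrow> (\<exists>us. set us \<subseteq> S \<and> length us = n \<and> word_prod us = u)" for n
    unfolding inv Un_absorb lists_image word_prod_def
    by (auto simp: in_lists_conv_set subset_iff)
  then show ?thesis by (simp add: word_length_def)
qed

lemma len_le: "set us \<subseteq> S \<Longrightarrow> len (word_prod us) \<le> length us"
  unfolding len_eq_Least by (rule Least_le) auto

lemma reduced_word:
  assumes "u \<in> carrier W"
  obtains us where "set us \<subseteq> S" "word_prod us = u" "length us = len u"
proof -
  have "\<exists>n us. set us \<subseteq> S \<and> length us = n \<and> word_prod us = u"
    using word_prod_surj[OF assms] by auto
  from LeastI_ex[OF this] show ?thesis
    using that unfolding len_eq_Least[symmetric] by blast
qed

lemma len_one [simp]: "len \<one> = 0"
  using len_le[of "[]"] by simp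

lemma len_eq_0: "u \<in> carrier W \<Longrightarrow> len u = 0 \<longleftrightarrow> u = \<one>"
  by (metis len_one length_0_conv reduced_word word_prod_Nil)

lemma len_mult: "\<lbrakk>u \<in> carrier W; v \<in> carrier W\<rbrakk> \<Longrightarrow> len (u \<otimes> v) \<le> len u + len v"
proof -
  assume uv: "u \<in> carrier W" "v \<in> carrier W"
  obtain us where us: "set us \<subseteq> S" "word_prod us = u" "length us = len u"
    using reduced_word[OF uv(1)] by blast
  obtain vs where vs: "set vs \<subseteq> S" "word_prod vs = v" "length vs = len v"
    using reduced_word[OF uv(2)] by blast
  show ?thesis using len_le[of "us @ vs"] us vs by (simp add: word_prod_append)
qed

lemma len_mult_word: "\<lbrakk>u \<in> carrier W; set us \<subseteq> S\<rbrakk> \<Longrightarrow> len (u \<otimes> word_prod us) \<le> len u + length us"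
  using len_mult[of u "word_prod us"] len_le[of us] by simp

lemma len_gen_le: "\<lbrakk>u \<in> carrier W; s \<in> S\<rbrakk> \<Longrightarrow> len (u \<otimes> \<iota> s) \<le> len u + 1"
  using len_mult_word[of u "[s]"] by simp

lemma le_len_gen: "\<lbrakk>u \<in> carrier W; s \<in> S\<rbrakk> \<Longrightarrow> len u \<le> len (u \<otimes> \<iota> s) + 1"
  using len_gen_le[of "u \<otimes> \<iota> s" s] by simp

lemma descent_exists:
  assumes "u \<in> carrier W" "u \<noteq> \<one>"
  obtains s where "s \<in> S" "len (u \<otimes> \<iota> s) + 1 = len u"
proof -
  obtain us where us: "set us \<subseteq> S" "word_prod us = u" "length us = len u"
    using reduced_word[OF assms(1)] by blast
  then have "us \<noteq> []" using assms(2) by auto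
  then obtain vs s where v: "us = vs @ [s]" by (metis rev_exhaust)
  have s: "s \<in> S" and vs: "set vs \<subseteq> S" using us(1) v by auto
  have "u \<otimes> \<iota> s = word_prod vs" using s vs v by (simp add: word_prod_append us(2)[symmetric])
  then have "len (u \<otimes> \<iota> s) \<le> len u - 1" using len_le[OF vs] us(3) v by simp
  then show ?thesis using that[OF s] le_len_gen[OF assms(1) s] us(3) v by simp
qed

lemma word_prod_alternating_double:
  "\<lbrakk>s \<in> S; t \<in> S\<rbrakk> \<Longrightarrow> word_prod (alternating s t (2 * j)) = (\<iota> s \<otimes> \<iota> t) [^] j"
proof (induction j)
  case (Suc j)
  then show ?case
    using nat_pow_Suc2[of "\<iota> s \<otimes> \<iota> t" j] by (simp add: m_assoc)
qed auto

text \<open>With p = st, one side is a power of p and the other a power of ts, the inverse of p, up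
  to one extra letter when \<open>n\<close> is odd. Splitting p^n = 1 into exponents j + j, or j +
  (j + 1), identifies the two.\<close>

lemma braid:
  assumes s: "s \<in> S" and t: "t \<in> S" and n: "m s t = enat n"
  shows "word_prod (alternating s t n) = word_prod (alternating t s n)"
proof -
  let ?p = "\<iota> s \<otimes> \<iota> t"
  have p: "?p \<in> carrier W" and pn: "?p [^] n = \<one>" using assms gen_rel by auto
  have "inv ?p = \<iota> t \<otimes> \<iota> s" using s t by (simp add: inv_mult_group)
  then have flip: "(\<iota> t \<otimes> \<iota> s) [^] j = inv (?p [^] j)" for j :: nat
    using nat_pow_inv[OF p] by simp
  show ?thesis
  proof (cases "even n")
    case True
    then obtain j where j: "n = 2 * j" by (metis evenE)
    have "?p [^] j \<otimes> ?p [^] j = \<one>"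
      using pn nat_pow_mult[OF p, of j j] by (simp only: j mult_2)
    then have "inv (?p [^] j) = ?p [^] j" using p by (intro inv_equality) auto
    then show ?thesis using s t by (simp only: j word_prod_alternating_double flip)
  next
    case False
    then obtain j where j: "n = Suc (2 * j)" by (metis oddE Suc_eq_plus1)
    have "?p [^] j \<otimes> ?p [^] Suc j = \<one>"
      using pn nat_pow_mult[OF p, of j "Suc j"] by (simp only: j mult_2 add_Suc_right)
    then have "inv (?p [^] Suc j) = ?p [^] j" using p by (intro inv_equality) auto
    then have eq: "inv (?p [^] j) = ?p \<otimes> ?p [^] j"
      using p nat_pow_Suc2[OF p, of j] by (metis inv_inv nat_pow_closed)
    have "word_prod (alternating t s n) = \<iota> s \<otimes> inv (?p [^] j)"
      unfolding j flip[symmetric] word_prod_alternating_double[OF t s, symmetric] by simp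
    also have "\<dots> = \<iota> t \<otimes> ?p [^] j"
      unfolding eq using s t p by (simp add: m_assoc)
    also have "\<dots> = word_prod (alternating s t n)"
      unfolding j word_prod_alternating_double[OF s t, symmetric] by simp
    finally show ?thesis by simp
  qed
qed

end

text \<open>Serves twice: for parabolic subgroups with their own simple generators, and for the
  fixed subgroup, whose generators are the longest elements of orbits.\<close>

lemma (in coxeter_generators) subgroup_coxeter_generators:
  assumes H: "subgroup H W" and m': "coxeter_matrix S' m'"
    and j: "generate W (j ` S') = H"
    and rel: "\<And>s t n. \<lbrakk>s \<in> S'; t \<in> S'; m' s t = enat n\<rbrakk> \<Longrightarrow> (j s \<otimes> j t) [^] n = \<one>"
  shows "coxeter_generators (W\<lparr>carrier := H\<rparr>) S' m' j"
proof (intro coxeter_generators.intro coxeter_generators_axioms.intro m')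
  show "group (W\<lparr>carrier := H\<rparr>)" by (rule subgroup.subgroup_is_group[OF H is_group])
  show "j s \<in> carrier (W\<lparr>carrier := H\<rparr>)" if "s \<in> S'" for s
    using that j by (auto intro: generate.incl)
  show "generate (W\<lparr>carrier := H\<rparr>) (j ` S') = carrier (W\<lparr>carrier := H\<rparr>)"
    using subgroup_generates_itself[OF H j] by simp
  show "(j s \<otimes>\<^bsub>W\<lparr>carrier := H\<rparr>\<^esub> j t) [^]\<^bsub>W\<lparr>carrier := H\<rparr>\<^esub> n = \<one>\<^bsub>W\<lparr>carrier := H\<rparr>\<^esub>"
    if "s \<in> S'" "t \<in> S'" "m' s t = enat n" for s t n
    using rel[OF that] nat_pow_consistent[of "j s \<otimes> j t" n H] by simp
qed

lemma (in coxeter_generators) parabolic_subgroup: "X \<subseteq> S \<Longrightarrow> subgroup (parabolic W \<iota> X) W"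
  unfolding parabolic_def by (rule generate_is_subgroup) auto

lemma (in coxeter_generators) parabolic_coxeter_generators:
  assumes "X \<subseteq> S"
  shows "coxeter_generators (W\<lparr>carrier := parabolic W \<iota> X\<rparr>) X m \<iota>"
  using assms gen_rel coxeter_matrix
  by (intro subgroup_coxeter_generators parabolic_subgroup)
    (auto simp: parabolic_def coxeter_matrix_def subset_iff)

lemma (in coxeter_generators) parabolic_word_prod:
  assumes "X \<subseteq> S"
  shows "parabolic W \<iota> X = {word_prod us | us. set us \<subseteq> X}"
proof -
  interpret X: coxeter_generators "W\<lparr>carrier := parabolic W \<iota> X\<rparr>" X m \<iota>
    by (rule parabolic_coxeter_generators[OF assms])
  have "X.word_prod us = word_prod us" for us
    by (simp add: X.word_prod_def word_prod_def)
  then show ?thesis using X.word_prod_surj X.word_prod_closed by auto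
qed

text \<open>\<open>longest_element\<close> measures length over \<open>X\<close> inside
  \<open>W\<close>, whereas the locale interpreted in the parabolic subgroup uses the inverses of
  the restricted group. For involutive generators both lengths agree.\<close>

lemma (in coxeter_generators) parabolic_len:
  assumes "X \<subseteq> S"
  shows "word_length (W\<lparr>carrier := parabolic W \<iota> X\<rparr>) (\<iota> ` X) u = word_length W (\<iota> ` X) u"
proof -
  interpret X: coxeter_generators "W\<lparr>carrier := parabolic W \<iota> X\<rparr>" X m \<iota>
    by (rule parabolic_coxeter_generators[OF assms])
  have "(\<lambda>a. inv a) ` \<iota> ` X = \<iota> ` X" using assms by (force simp: subset_iff)
  moreover have "(\<lambda>a. inv\<^bsub>W\<lparr>carrier := parabolic W \<iota> X\<rparr>\<^esub> a) ` \<iota> ` X = \<iota> ` X" by force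
  ultimately show ?thesis by (simp add: word_length_def)
qed

section \<open>Reflections and the rooted representation\<close>

lemma linear_on_add: "\<lbrakk>linear_on V f; x \<in> V; y \<in> V\<rbrakk> \<Longrightarrow> f (x + y) = f x + f y"
  by (simp add: linear_on_def)

lemma linear_on_scale: "\<lbrakk>linear_on V f; x \<in> V\<rbrakk> \<Longrightarrow> f (c *\<^sub>R x) = c *\<^sub>R f x"
  by (simp add: linear_on_def)

lemma linear_on_zero: "\<lbrakk>linear_on V f; subspace V\<rbrakk> \<Longrightarrow> f 0 = 0"
  using linear_on_scale[of V f 0 0] by (simp add: subspace_0)

lemma linear_on_minus: "\<lbrakk>linear_on V f; x \<in> V\<rbrakk> \<Longrightarrow> f (- x) = - f x"
  using linear_on_scale[of V f x "-1"] by simp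

lemma linear_on_diff: "\<lbrakk>linear_on V f; subspace V; x \<in> V; y \<in> V\<rbrakk> \<Longrightarrow> f (x - y) = f x - f y"
  using linear_on_add[of V f x "- y"] linear_on_minus[of V f y] by (simp add: subspace_neg)

lemma linear_on_sum:
  assumes "linear_on V f" "subspace V" "\<And>i. i \<in> I \<Longrightarrow> x i \<in> V"
  shows "f (\<Sum>i\<in>I. x i) = (\<Sum>i\<in>I. f (x i))"
  using assms(3)
proof (induction I rule: infinite_finite_induct)
  case (insert i I)
  then show ?case
    using linear_on_add[OF assms(1), of "x i" "sum x I"] assms(2)
    by (simp add: subspace_sum)
qed (use linear_on_zero[OF assms(1,2)] in auto)

lemma carrier_GL: "carrier (GL V) = {\<phi> \<in> Bij V. linear_on V \<phi>}"
  by (simp add: GL_def)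

lemma GL_mult: "\<lbrakk>\<phi> \<in> carrier (GL V); \<psi> \<in> carrier (GL V)\<rbrakk> \<Longrightarrow> \<phi> \<otimes>\<^bsub>GL V\<^esub> \<psi> = compose V \<phi> \<psi>"
  by (simp add: GL_def BijGroup_def)

lemma GL_one: "\<one>\<^bsub>GL V\<^esub> = (\<lambda>x\<in>V. x)"
  by (simp add: GL_def BijGroup_def)

lemma GL_closed: "\<lbrakk>\<phi> \<in> carrier (GL V); x \<in> V\<rbrakk> \<Longrightarrow> \<phi> x \<in> V"
  by (auto simp: carrier_GL dest: Bij_imp_funcset)

lemma GL_linear: "\<phi> \<in> carrier (GL V) \<Longrightarrow> linear_on V \<phi>"
  by (simp add: carrier_GL)

lemma GL_mult_apply:
  "\<lbrakk>\<phi> \<in> carrier (GL V); \<psi> \<in> carrier (GL V); x \<in> V\<rbrakk> \<Longrightarrow> (\<phi> \<otimes>\<^bsub>GL V\<^esub> \<psi>) x = \<phi> (\<psi> x)"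
  by (simp add: GL_mult compose_def)

lemma GL_eqI:
  assumes "\<phi> \<in> carrier (GL V)" "\<psi> \<in> carrier (GL V)" "\<And>x. x \<in> V \<Longrightarrow> \<phi> x = \<psi> x"
  shows "\<phi> = \<psi>"
  using assms by (intro extensionalityI[of _ V]) (auto simp: carrier_GL Bij_def)

lemma group_GL:
  assumes "subspace V"
  shows "group (GL V)"
proof -
  interpret group "BijGroup V" by (rule group_BijGroup)
  have "subgroup {\<phi> \<in> Bij V. linear_on V \<phi>} (BijGroup V)"
  proof (rule subgroupI)
    show "{\<phi> \<in> Bij V. linear_on V \<phi>} \<subseteq> carrier (BijGroup V)"
      by (auto simp: BijGroup_def)
    have "(\<lambda>x\<in>V. x) \<in> {\<phi> \<in> Bij V. linear_on V \<phi>}"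
      using assms by (auto simp: id_Bij linear_on_def subspace_add subspace_scale)
    then show "{\<phi> \<in> Bij V. linear_on V \<phi>} \<noteq> {}" by blast
  next
    fix \<phi> assume "\<phi> \<in> {\<phi> \<in> Bij V. linear_on V \<phi>}"
    then have \<phi>: "\<phi> \<in> Bij V" "linear_on V \<phi>" by auto
    let ?i = "inv_into V \<phi>"
    have im: "\<phi> ` V = V" and inj: "inj_on \<phi> V" using \<phi>(1) by (auto simp: Bij_def bij_betw_def)
    have i: "?i x \<in> V" "\<phi> (?i x) = x" if "x \<in> V" for x
      using that im by (auto intro: inv_into_into f_inv_into_f)
    have ii: "?i (\<phi> x) = x" if "x \<in> V" for x
      using inj that by (rule inv_into_f_f)
    have "?i (x + y) = ?i x + ?i y" if "x \<in> V" "y \<in> V" for x y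
      using ii[OF subspace_add[OF assms i(1)[OF that(1)] i(1)[OF that(2)]]]
        linear_on_add[OF \<phi>(2) i(1)[OF that(1)] i(1)[OF that(2)]] i(2)[OF that(1)] i(2)[OF that(2)]
      by simp
    moreover have "?i (c *\<^sub>R x) = c *\<^sub>R ?i x" if "x \<in> V" for x c
      using ii[OF subspace_scale[OF assms i(1)[OF that]]]
        linear_on_scale[OF \<phi>(2) i(1)[OF that]] i(2)[OF that]
      by simp
    ultimately have "linear_on V (\<lambda>x\<in>V. ?i x)"
      using assms by (auto simp: linear_on_def subspace_add subspace_scale)
    then show "inv\<^bsub>BijGroup V\<^esub> \<phi> \<in> {\<phi> \<in> Bij V. linear_on V \<phi>}"
      using \<phi>(1) by (simp add: inv_BijGroup restrict_inv_into_Bij)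
  next
    fix \<phi> \<psi> assume "\<phi> \<in> {\<phi> \<in> Bij V. linear_on V \<phi>}" "\<psi> \<in> {\<phi> \<in> Bij V. linear_on V \<phi>}"
    then have *: "\<phi> \<in> Bij V" "linear_on V \<phi>" "\<psi> \<in> Bij V" "linear_on V \<psi>" by auto
    have "\<psi> x \<in> V" if "x \<in> V" for x using *(3) that by (auto dest: Bij_imp_funcset)
    then have "linear_on V (compose V \<phi> \<psi>)"
      using *(2,4) assms by (auto simp: linear_on_def compose_def subspace_add subspace_scale)
    then show "\<phi> \<otimes>\<^bsub>BijGroup V\<^esub> \<psi> \<in> {\<phi> \<in> Bij V. linear_on V \<phi>}"
      using * by (simp add: BijGroup_def compose_Bij)
  qed
  from subgroup.subgroup_is_group[OF this is_group] show ?thesis by (simp add: GL_def)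
qed

locale form_space =
  fixes V :: "'v::real_vector set" and B :: "'v \<Rightarrow> 'v \<Rightarrow> real"
  assumes finite_dim: "finite_dim_space V" and form: "symmetric_bilinear_on V B"
begin

lemma subspace_V: "subspace V"
  using finite_dim by (auto simp: finite_dim_space_def)

lemmas V_add [simp] = subspace_add[OF subspace_V]
  and V_diff [simp] = subspace_diff[OF subspace_V]
  and V_scale [simp] = subspace_scale[OF subspace_V]
  and V_zero [simp] = subspace_0[OF subspace_V]
  and V_sum [simp] = subspace_sum[OF subspace_V]

lemma B_linear: "x \<in> V \<Longrightarrow> linear_on V (B x)"
  using form by (simp add: symmetric_bilinear_on_def)

lemma B_sym: "\<lbrakk>x \<in> V; y \<in> V\<rbrakk> \<Longrightarrow> B x y = B y x"
  using form by (simp add: symmetric_bilinear_on_def)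

lemma B_add_right: "\<lbrakk>x \<in> V; y \<in> V; z \<in> V\<rbrakk> \<Longrightarrow> B x (y + z) = B x y + B x z"
  by (rule linear_on_add[OF B_linear])

lemma B_diff_right: "\<lbrakk>x \<in> V; y \<in> V; z \<in> V\<rbrakk> \<Longrightarrow> B x (y - z) = B x y - B x z"
  by (rule linear_on_diff[OF B_linear subspace_V])

lemma B_scale_right: "\<lbrakk>x \<in> V; y \<in> V\<rbrakk> \<Longrightarrow> B x (c *\<^sub>R y) = c * B x y"
  using linear_on_scale[OF B_linear] by simp

lemma B_sum_right: "\<lbrakk>x \<in> V; \<And>i. i \<in> I \<Longrightarrow> y i \<in> V\<rbrakk> \<Longrightarrow> B x (\<Sum>i\<in>I. y i) = (\<Sum>i\<in>I. B x (y i))"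
  by (rule linear_on_sum[OF B_linear subspace_V])

lemma B_add_left: "\<lbrakk>x \<in> V; y \<in> V; z \<in> V\<rbrakk> \<Longrightarrow> B (y + z) x = B y x + B z x"
  using B_add_right[of x y z] by (simp add: B_sym[of _ x])

lemma B_diff_left: "\<lbrakk>x \<in> V; y \<in> V; z \<in> V\<rbrakk> \<Longrightarrow> B (y - z) x = B y x - B z x"
  using B_diff_right[of x y z] by (simp add: B_sym[of _ x])

lemma B_scale_left: "\<lbrakk>x \<in> V; y \<in> V\<rbrakk> \<Longrightarrow> B (c *\<^sub>R y) x = c * B y x"
  using B_scale_right[of x y c] by (simp add: B_sym[of _ x])

lemma B_sum_left: "\<lbrakk>x \<in> V; \<And>i. i \<in> I \<Longrightarrow> y i \<in> V\<rbrakk> \<Longrightarrow> B (\<Sum>i\<in>I. y i) x = (\<Sum>i\<in>I. B (y i) x)"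
  using B_sum_right[of x I y] by (simp add: B_sym[of _ x] cong: sum.cong)

lemmas B_simps = B_add_right B_add_left B_diff_right B_diff_left B_scale_right B_scale_left

abbreviation refl :: "'v \<Rightarrow> 'v \<Rightarrow> 'v" where
  "refl \<equiv> reflection_on V B"

lemma refl_apply: "x \<in> V \<Longrightarrow> refl e x = x - (2 * B x e) *\<^sub>R e"
  by (simp add: reflection_on_def)

lemma refl_in_V: "\<lbrakk>x \<in> V; e \<in> V\<rbrakk> \<Longrightarrow> refl e x \<in> V"
  by (simp add: refl_apply)

lemma refl_refl: "\<lbrakk>x \<in> V; e \<in> V; B e e = 1\<rbrakk> \<Longrightarrow> refl e (refl e x) = x"
  by (simp add: refl_apply B_simps)

lemma refl_GL:
  assumes "e \<in> V" "B e e = 1"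
  shows "refl e \<in> carrier (GL V)"
proof -
  have "bij_betw (refl e) V V"
    by (rule bij_betw_byWitness[where f' = "refl e"]) (auto simp: refl_refl refl_in_V assms)
  then have "refl e \<in> Bij V" by (auto simp: Bij_def reflection_on_def)
  moreover have "linear_on V (refl e)"
    using assms by (auto simp: linear_on_def refl_apply B_simps algebra_simps)
  ultimately show ?thesis by (simp add: carrier_GL)
qed

lemma refl_invariant:
  "\<lbrakk>e \<in> V; B e e = 1; x \<in> V; y \<in> V\<rbrakk> \<Longrightarrow> B (refl e x) (refl e y) = B x y"
  using B_sym[of e y] by (simp add: refl_apply B_simps)

lemma refl_square: "\<lbrakk>e \<in> V; B e e = 1\<rbrakk> \<Longrightarrow> refl e \<otimes>\<^bsub>GL V\<^esub> refl e = \<one>\<^bsub>GL V\<^esub>"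
proof -
  assume e: "e \<in> V" "B e e = 1"
  interpret GL: group "GL V" by (rule group_GL[OF subspace_V])
  show ?thesis
  proof (rule GL_eqI)
    show "(refl e \<otimes>\<^bsub>GL V\<^esub> refl e) x = \<one>\<^bsub>GL V\<^esub> x" if "x \<in> V" for x
      using that by (simp add: refl_GL GL_mult_apply refl_refl GL_one e)
  qed (simp_all add: refl_GL e)
qed

text \<open>A reflection in the coordinates of the plane of \<open>e\<close> and \<open>e'\<close>.
  The new coefficient \<open>2 * c * p - q\<close> is the recurrence of the sines of multiples of an
  angle, and also that of \<open>dihedral_coeff\<close>.\<close>

lemma refl_comb:
  assumes "e \<in> V" "e' \<in> V" "B e' e' = 1" "B e e' = - c"
  shows "refl e' (p *\<^sub>R e + q *\<^sub>R e') = p *\<^sub>R e + (2 * c * p - q) *\<^sub>R e'"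
proof -
  have "B (p *\<^sub>R e + q *\<^sub>R e') e' = q - c * p" using assms by (simp add: B_simps)
  moreover have "2 * c * p - q = q - 2 * (q - c * p)" by simp
  ultimately show ?thesis
    using assms by (simp only: refl_apply V_add V_scale scaleR_left_diff_distrib add_diff_eq)
qed

text \<open>The product of the reflections rotates the plane of \<open>e\<close> and
  \<open>e'\<close> by twice \<theta> and fixes its orthogonal complement. Since sin \<theta> is
  nonzero the form is nondegenerate on the plane, so plane and complement together span
  \<open>V\<close>.\<close>

lemma refl_relation:
  assumes e: "e \<in> V" "e' \<in> V" "B e e = 1" "B e' e' = 1"
    and b: "B e e' = - cos (pi / real n)" and n: "2 \<le> n"
  shows "(refl e \<otimes>\<^bsub>GL V\<^esub> refl e') [^]\<^bsub>GL V\<^esub> n = \<one>\<^bsub>GL V\<^esub>"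
proof -
  interpret GL: group "GL V" by (rule group_GL[OF subspace_V])
  define \<theta> where "\<theta> = pi / real n"
  define g where "g = refl e \<otimes>\<^bsub>GL V\<^esub> refl e'"
  have r: "refl e \<in> carrier (GL V)" "refl e' \<in> carrier (GL V)" using e by (auto simp: refl_GL)
  have g: "g \<in> carrier (GL V)" unfolding g_def using r by simp
  have g_apply: "g x = refl e (refl e' x)" if "x \<in> V" for x
    unfolding g_def using r that by (simp add: GL_mult_apply)
  have gp: "g [^]\<^bsub>GL V\<^esub> k \<in> carrier (GL V)" for k :: nat using g by simp
  have rec: "sin ((a + 2) * \<theta>) = 2 * cos \<theta> * sin ((a + 1) * \<theta>) - sin (a * \<theta>)" for a
  proof -
    have "sin ((a + 1) * \<theta> + \<theta>) + sin ((a + 1) * \<theta> - \<theta>) = 2 * cos \<theta> * sin ((a + 1) * \<theta>)"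
      by (simp add: sin_add sin_diff)
    moreover have "(a + 1) * \<theta> + \<theta> = (a + 2) * \<theta>" "(a + 1) * \<theta> - \<theta> = a * \<theta>"
      by (simp_all add: algebra_simps)
    ultimately show ?thesis by simp
  qed
  \<comment> \<open>Up to the factor sin \<theta>, \<open>P a\<close> is \<open>e\<close> turned
    through the angle \<open>a * \<theta>\<close>, written in the basis \<open>e\<close>,
    \<open>e'\<close>. Real \<open>a\<close> admits the value -1, which yields
    \<open>e'\<close>.\<close>
  define P where "P a = sin ((a + 1) * \<theta>) *\<^sub>R e + sin (a * \<theta>) *\<^sub>R e'" for a
  have PV: "P a \<in> V" for a using e by (simp add: P_def)
  have gP: "g (P a) = P (a + 2)" for a
  proof -
    have "refl e' (P a) = sin ((a + 1) * \<theta>) *\<^sub>R e + sin ((a + 2) * \<theta>) *\<^sub>R e'"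
      unfolding P_def rec using e b by (intro refl_comb) (auto simp: \<theta>_def)
    also have "refl e \<dots> = sin ((a + 2) * \<theta>) *\<^sub>R e' + sin ((a + 1 + 2) * \<theta>) *\<^sub>R e"
      using refl_comb[of e' e "cos \<theta>" "sin ((a + 2) * \<theta>)" "sin ((a + 1) * \<theta>)"] e b
      by (subst rec[of "a + 1"]) (simp add: add.commute \<theta>_def B_sym[of e' e] add.left_commute)
    finally show ?thesis unfolding g_apply[OF PV] by (simp add: P_def add_ac)
  qed
  have pow_P: "(g [^]\<^bsub>GL V\<^esub> k) (P a) = P (a + 2 * real k)" for k :: nat and a
  proof (induction k arbitrary: a)
    case (Suc k)
    have "(g [^]\<^bsub>GL V\<^esub> Suc k) (P a) = (g [^]\<^bsub>GL V\<^esub> k) (g (P a))"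
      using GL_mult_apply[OF gp g PV] by simp
    then show ?case using Suc by (simp add: gP algebra_simps)
  qed (simp add: GL_one PV)
  have pow_fix: "(g [^]\<^bsub>GL V\<^esub> k) x = x" if "x \<in> V" "B x e = 0" "B x e' = 0" for k :: nat and x
  proof (induction k)
    case (Suc k)
    have "g x = x" using that by (simp add: g_apply refl_apply)
    then show ?case using Suc GL_mult_apply[OF gp g that(1)] by simp
  qed (simp add: GL_one that)
  have \<theta>: "0 < \<theta>" "\<theta> < pi" using n by (auto simp: \<theta>_def field_simps)
  have s: "sin \<theta> \<noteq> 0" using sin_gt_zero[OF \<theta>] by simp
  have n\<theta>: "(a + 2 * real n) * \<theta> = a * \<theta> + 2 * pi" for a
    using n by (simp add: \<theta>_def algebra_simps)
  have period: "P (a + 2 * real n) = P a" for a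
    using n\<theta>[of a] n\<theta>[of "a + 1"] by (simp add: P_def add_ac)
  have pow_n: "(g [^]\<^bsub>GL V\<^esub> n) x = x" if x: "x \<in> V" for x
  proof -
    \<comment> \<open>\<alpha> and \<beta> solve the linear system that makes \<open>y\<close>
      orthogonal to \<open>e\<close> and \<open>e'\<close>; its Gram determinant is the square of
      sin \<theta>.\<close>
    define \<alpha> where "\<alpha> = (B x e + cos \<theta> * B x e') / (sin \<theta>)\<^sup>2"
    define \<beta> where "\<beta> = (B x e' + cos \<theta> * B x e) / (sin \<theta>)\<^sup>2"
    define y where "y = x - \<alpha> *\<^sub>R e - \<beta> *\<^sub>R e'"
    have bb: "B e e' = - cos \<theta>" "B e' e = - cos \<theta>" using b e B_sym[of e e'] by (auto simp: \<theta>_def)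
    have y: "y \<in> V" using x e by (simp add: y_def)
    have s2: "(sin \<theta>)\<^sup>2 = 1 - cos \<theta> * cos \<theta>"
      using sin_squared_eq[of \<theta>] by (simp add: power2_eq_square)
    have ab: "\<alpha> * (sin \<theta>)\<^sup>2 = B x e + cos \<theta> * B x e'" "\<beta> * (sin \<theta>)\<^sup>2 = B x e' + cos \<theta> * B x e"
      using s by (simp_all add: \<alpha>_def \<beta>_def)
    have "B y e = B x e - \<alpha> + \<beta> * cos \<theta>" using x e bb by (simp add: y_def B_simps)
    then have "B y e * (sin \<theta>)\<^sup>2
        = B x e * (sin \<theta>)\<^sup>2 - \<alpha> * (sin \<theta>)\<^sup>2 + \<beta> * (sin \<theta>)\<^sup>2 * cos \<theta>"
      by (simp only:) (simp add: algebra_simps)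
    also have "\<dots> = 0" unfolding ab unfolding s2 by (simp add: algebra_simps)
    finally have y1: "B y e = 0" using s by simp
    have "B y e' = B x e' + \<alpha> * cos \<theta> - \<beta>" using x e bb by (simp add: y_def B_simps)
    then have "B y e' * (sin \<theta>)\<^sup>2
        = B x e' * (sin \<theta>)\<^sup>2 + \<alpha> * (sin \<theta>)\<^sup>2 * cos \<theta> - \<beta> * (sin \<theta>)\<^sup>2"
      by (simp only:) (simp add: algebra_simps)
    also have "\<dots> = 0" unfolding ab unfolding s2 by (simp add: algebra_simps)
    finally have y2: "B y e' = 0" using s by simp
    \<comment> \<open>\<open>P 0\<close> is sin \<theta> times \<open>e\<close>, and
      \<open>P (- 1)\<close> is - sin \<theta> times \<open>e'\<close>, which explains the sign at
      \<beta>.\<close>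
    have x_eq: "x = y + ((\<alpha> / sin \<theta>) *\<^sub>R P 0 + (- \<beta> / sin \<theta>) *\<^sub>R P (- 1))"
      using s by (simp add: P_def y_def)
    have "(g [^]\<^bsub>GL V\<^esub> n) x = (g [^]\<^bsub>GL V\<^esub> n) y + ((\<alpha> / sin \<theta>) *\<^sub>R (g [^]\<^bsub>GL V\<^esub> n) (P 0)
        + (- \<beta> / sin \<theta>) *\<^sub>R (g [^]\<^bsub>GL V\<^esub> n) (P (- 1)))"
      unfolding x_eq using y PV
      by (simp add: linear_on_add[OF GL_linear[OF gp]] linear_on_scale[OF GL_linear[OF gp]]
          del: scaleR_minus_left divide_minus_left)
    also have "\<dots> = x"
      unfolding pow_P period pow_fix[OF y y1 y2] x_eq[symmetric] ..
    finally show ?thesis .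
  qed
  show ?thesis
    unfolding g_def[symmetric]
  proof (rule GL_eqI)
    show "(g [^]\<^bsub>GL V\<^esub> n) x = \<one>\<^bsub>GL V\<^esub> x" if "x \<in> V" for x
      using that by (simp add: pow_n GL_one)
  qed (simp_all add: g)
qed

end

lemma form_space_root_basis: "root_basis V B S m \<epsilon> \<Longrightarrow> form_space V B"
  by (simp add: root_basis_def form_space_def)

lemma (in coxeter_generators) hom_eqI:
  assumes "group H" "f \<in> hom W H" "h \<in> hom W H" "\<And>s. s \<in> S \<Longrightarrow> f (\<iota> s) = h (\<iota> s)" "u \<in> carrier W"
  shows "f u = h u"
proof -
  have f: "group_hom W H f" and h: "group_hom W H h"
    using assms by (auto intro: group_hom.intro group_hom_axioms.intro is_group)
  have "f (word_prod us) = h (word_prod us)" if "set us \<subseteq> S" for us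
    using that
    by (induction us)
      (auto simp: assms(4) group_hom.hom_one[OF f] group_hom.hom_one[OF h]
        hom_mult[OF assms(2)] hom_mult[OF assms(3)])
  then show ?thesis using word_prod_surj[OF assms(5)] by auto
qed

lemma reflections_relation:
  assumes m: "coxeter_matrix S m" and rb: "root_basis V B S m \<epsilon>"
    and st: "s \<in> S" "t \<in> S" "m s t = enat n"
  shows "(reflection_on V B (\<epsilon> s) \<otimes>\<^bsub>GL V\<^esub> reflection_on V B (\<epsilon> t)) [^]\<^bsub>GL V\<^esub> n = \<one>\<^bsub>GL V\<^esub>"
proof -
  interpret form_space V B by (rule form_space_root_basis[OF rb])
  interpret GL: group "GL V" by (rule group_GL[OF subspace_V])
  have e: "\<epsilon> s \<in> V" "\<epsilon> t \<in> V" "B (\<epsilon> s) (\<epsilon> s) = 1" "B (\<epsilon> t) (\<epsilon> t) = 1"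
    using rb st by (auto simp: root_basis_def)
  show ?thesis
  proof (cases "s = t")
    case True
    have "refl (\<epsilon> t) \<otimes>\<^bsub>GL V\<^esub> refl (\<epsilon> t) = \<one>\<^bsub>GL V\<^esub>" using e by (simp add: refl_square)
    then show ?thesis using True by simp
  next
    case False
    then have "2 \<le> m s t" using m st unfolding coxeter_matrix_def by blast
    then have "2 \<le> n" by (simp add: st(3) numeral_eq_enat)
    moreover have "B (\<epsilon> s) (\<epsilon> t) = - cos (pi / real n)"
      using rb st False by (fastforce simp: root_basis_def split: enat.splits)
    ultimately show ?thesis using e by (intro refl_relation) auto
  qed
qed

text \<open>\<open>rooted_rep\<close> is a definite description. Existence comes from the
  presentation of \<open>W\<close>, uniqueness from generation together with extensionality outside
  the carrier.\<close>

lemma is_rooted_rep_rooted_rep: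
  assumes W: "coxeter_system W S m \<iota>" and rb: "root_basis V B S m \<epsilon>"
  shows "is_rooted_rep W S \<iota> V B \<epsilon> (rooted_rep W S \<iota> V B \<epsilon>)"
proof -
  interpret form_space V B by (rule form_space_root_basis[OF rb])
  interpret coxeter_generators W S m \<iota> by (rule coxeter_system_generators[OF W])
  have GL: "group (GL V)" by (rule group_GL[OF subspace_V])
  obtain f where f: "f \<in> hom W (GL V)" "\<And>s. s \<in> S \<Longrightarrow> f (\<iota> s) = refl (\<epsilon> s)"
  proof -
    have "(\<lambda>s. refl (\<epsilon> s)) \<in> S \<rightarrow> carrier (GL V)"
      using rb by (auto simp: root_basis_def intro!: refl_GL)
    from coxeter_system_hom_exists[OF W GL this reflections_relation[OF coxeter_matrix rb]]
    show ?thesis using that by blast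
  qed
  define f' where "f' = restrict f (carrier W)"
  have ex: "f' \<in> extensional (carrier W) \<and> is_rooted_rep W S \<iota> V B \<epsilon> f'"
    using f by (auto simp: is_rooted_rep_def hom_def f'_def)
  have uniq: "h = f'" if "h \<in> extensional (carrier W) \<and> is_rooted_rep W S \<iota> V B \<epsilon> h" for h
  proof (rule extensionalityI[of _ "carrier W"])
    fix u assume "u \<in> carrier W"
    then show "h u = f' u"
      by (rule hom_eqI[OF GL, rotated -1]) (use that ex in \<open>auto simp: is_rooted_rep_def\<close>)
  qed (use that ex in auto)
  from theI2[of "\<lambda>f. f \<in> extensional (carrier W) \<and> is_rooted_rep W S \<iota> V B \<epsilon> f", OF ex uniq]
  show ?thesis unfolding rooted_rep_def by blast
qed

section \<open>Positive and negative roots\<close>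

text \<open>The coefficients are existentially quantified because the simple roots may be dependent
  and a vector then has no coordinates to speak of.\<close>

definition nonneg_span :: "('s \<Rightarrow> 'v::real_vector) \<Rightarrow> 's set \<Rightarrow> 'v set" where
  "nonneg_span \<epsilon> X = {\<Sum>s\<in>X. c s *\<^sub>R \<epsilon> s | c. \<forall>s\<in>X. 0 \<le> c s}"

lemma nonneg_span_zero: "0 \<in> nonneg_span \<epsilon> X"
  unfolding nonneg_span_def by (auto intro!: exI[of _ "\<lambda>_. 0"])

lemma nonneg_span_add:
  assumes "x \<in> nonneg_span \<epsilon> X" "y \<in> nonneg_span \<epsilon> X"
  shows "x + y \<in> nonneg_span \<epsilon> X"
proof -
  obtain c d where "x = (\<Sum>s\<in>X. c s *\<^sub>R \<epsilon> s)" "\<forall>s\<in>X. 0 \<le> c s"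
    "y = (\<Sum>s\<in>X. d s *\<^sub>R \<epsilon> s)" "\<forall>s\<in>X. 0 \<le> d s"
    using assms unfolding nonneg_span_def by auto
  then show ?thesis
    unfolding nonneg_span_def
    by (auto intro!: exI[of _ "\<lambda>s. c s + d s"] simp: scaleR_add_left sum.distrib)
qed

lemma nonneg_span_scale:
  assumes "x \<in> nonneg_span \<epsilon> X" "0 \<le> a"
  shows "a *\<^sub>R x \<in> nonneg_span \<epsilon> X"
proof -
  obtain c where "x = (\<Sum>s\<in>X. c s *\<^sub>R \<epsilon> s)" "\<forall>s\<in>X. 0 \<le> c s"
    using assms unfolding nonneg_span_def by auto
  then show ?thesis
    using assms(2) unfolding nonneg_span_def
    by (auto intro!: exI[of _ "\<lambda>s. a * c s"] simp: scaleR_sum_right)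
qed

lemma nonneg_span_sum:
  "(\<And>i. i \<in> I \<Longrightarrow> x i \<in> nonneg_span \<epsilon> X) \<Longrightarrow> (\<Sum>i\<in>I. x i) \<in> nonneg_span \<epsilon> X"
  by (induction I rule: infinite_finite_induct) (auto simp: nonneg_span_zero nonneg_span_add)

lemma linear_nonneg_span:
  assumes "linear_on V h" "subspace V" "\<And>s. s \<in> X \<Longrightarrow> \<epsilon> s \<in> V" "x \<in> nonneg_span \<epsilon> X"
    "\<And>s. s \<in> X \<Longrightarrow> h (\<epsilon> s) \<in> nonneg_span \<epsilon>' Y"
  shows "h x \<in> nonneg_span \<epsilon>' Y"
proof -
  obtain c where c: "x = (\<Sum>s\<in>X. c s *\<^sub>R \<epsilon> s)" "\<forall>s\<in>X. 0 \<le> c s"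
    using assms(4) unfolding nonneg_span_def by auto
  have "h x = (\<Sum>s\<in>X. c s *\<^sub>R h (\<epsilon> s))"
    unfolding c(1) using assms(2,3)
    by (simp add: linear_on_sum[OF assms(1,2)] linear_on_scale[OF assms(1)] subspace_scale)
  then show ?thesis using c(2) assms(5) by (simp add: nonneg_span_sum nonneg_span_scale)
qed

lemma nonneg_span_base: "\<lbrakk>finite X; s \<in> X\<rbrakk> \<Longrightarrow> \<epsilon> s \<in> nonneg_span \<epsilon> X"
  unfolding nonneg_span_def
  by (auto intro!: exI[of _ "\<lambda>t. if t = s then 1 else 0"]
      simp: if_distrib[of "\<lambda>c. c *\<^sub>R _"] cong: if_cong)

lemma nonneg_span_mono:
  "\<lbrakk>X \<subseteq> Y; finite Y; x \<in> nonneg_span \<epsilon> X\<rbrakk> \<Longrightarrow> x \<in> nonneg_span \<epsilon> Y"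
  by (rule linear_nonneg_span[of UNIV "\<lambda>x. x" X \<epsilon> x \<epsilon> Y]) (auto simp: linear_on_def nonneg_span_base)

text \<open>\<open>f\<close> is a parameter so that the results apply to \<open>W\<close> itself, to
  its parabolic subgroups, to the presented group acting through a homomorphism, and to the fixed
  subgroup acting on the fixed space.\<close>

locale reflection_rep = coxeter_generators W S m \<iota> + form_space V B
  for W :: "('w, 'b) monoid_scheme" (structure) and S :: "'s set" and m and \<iota>
    and V :: "'v::real_vector set" and B +
  fixes \<epsilon> :: "'s \<Rightarrow> 'v" and f :: "'w \<Rightarrow> 'v \<Rightarrow> 'v"
  assumes finite_S: "finite S"
    and root_basis: "root_basis V B S m \<epsilon>"
    and rep: "is_rooted_rep W S \<iota> V B \<epsilon> f"
begin

abbreviation cone :: "'v set" where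
  "cone \<equiv> nonneg_span \<epsilon> S"

lemma root_in_V [simp]: "s \<in> S \<Longrightarrow> \<epsilon> s \<in> V"
  using root_basis by (auto simp: root_basis_def)

lemma root_norm [simp]: "s \<in> S \<Longrightarrow> B (\<epsilon> s) (\<epsilon> s) = 1"
  using root_basis by (auto simp: root_basis_def)

lemma root_finite: "\<lbrakk>s \<in> S; t \<in> S; s \<noteq> t; m s t = enat n\<rbrakk> \<Longrightarrow> B (\<epsilon> s) (\<epsilon> t) = - cos (pi / real n)"
  using root_basis by (fastforce simp: root_basis_def split: enat.splits)

lemma root_infinite: "\<lbrakk>s \<in> S; t \<in> S; s \<noteq> t; m s t = \<infinity>\<rbrakk> \<Longrightarrow> B (\<epsilon> s) (\<epsilon> t) \<le> - 1"
  using root_basis by (fastforce simp: root_basis_def split: enat.splits)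

lemma m_ge_2: "\<lbrakk>s \<in> S; t \<in> S; s \<noteq> t\<rbrakk> \<Longrightarrow> 2 \<le> m s t"
  using coxeter_matrix by (auto simp: coxeter_matrix_def)

lemma f_hom: "f \<in> hom W (GL V)"
  using rep by (simp add: is_rooted_rep_def)

lemma f_GL: "u \<in> carrier W \<Longrightarrow> f u \<in> carrier (GL V)"
  using f_hom by (auto simp: hom_def)

lemma f_closed [simp]: "\<lbrakk>u \<in> carrier W; x \<in> V\<rbrakk> \<Longrightarrow> f u x \<in> V"
  by (rule GL_closed[OF f_GL])

lemma f_linear: "u \<in> carrier W \<Longrightarrow> linear_on V (f u)"
  by (rule GL_linear[OF f_GL])

lemma f_add: "\<lbrakk>u \<in> carrier W; x \<in> V; y \<in> V\<rbrakk> \<Longrightarrow> f u (x + y) = f u x + f u y"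
  by (rule linear_on_add[OF f_linear])

lemma f_diff: "\<lbrakk>u \<in> carrier W; x \<in> V; y \<in> V\<rbrakk> \<Longrightarrow> f u (x - y) = f u x - f u y"
  by (rule linear_on_diff[OF f_linear subspace_V])

lemma f_minus: "\<lbrakk>u \<in> carrier W; x \<in> V\<rbrakk> \<Longrightarrow> f u (- x) = - f u x"
  by (rule linear_on_minus[OF f_linear])

lemma f_scale: "\<lbrakk>u \<in> carrier W; x \<in> V\<rbrakk> \<Longrightarrow> f u (c *\<^sub>R x) = c *\<^sub>R f u x"
  by (rule linear_on_scale[OF f_linear])

lemma f_zero: "u \<in> carrier W \<Longrightarrow> f u 0 = 0"
  by (rule linear_on_zero[OF f_linear subspace_V])

lemma f_mult: "\<lbrakk>u \<in> carrier W; v \<in> carrier W; x \<in> V\<rbrakk> \<Longrightarrow> f (u \<otimes> v) x = f u (f v x)"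
  using hom_mult[OF f_hom] by (simp add: GL_mult_apply f_GL)

lemma f_one: "x \<in> V \<Longrightarrow> f \<one> x = x"
  using hom_one[OF f_hom is_group group_GL[OF subspace_V]] by (simp add: GL_one)

lemma f_gen: "\<lbrakk>s \<in> S; x \<in> V\<rbrakk> \<Longrightarrow> f (\<iota> s) x = x - (2 * B x (\<epsilon> s)) *\<^sub>R \<epsilon> s"
  using rep by (simp add: is_rooted_rep_def refl_apply)

lemma f_gen_refl: "s \<in> S \<Longrightarrow> f (\<iota> s) = refl (\<epsilon> s)"
  using rep by (simp add: is_rooted_rep_def)

lemma f_gen_root: "s \<in> S \<Longrightarrow> f (\<iota> s) (\<epsilon> s) = - \<epsilon> s"
  by (simp add: f_gen scaleR_2)

lemma f_inv: "\<lbrakk>u \<in> carrier W; x \<in> V\<rbrakk> \<Longrightarrow> f (inv u) (f u x) = x"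
  by (simp add: f_mult[symmetric] f_one)

lemma f_invariant:
  assumes "u \<in> carrier W" "x \<in> V" "y \<in> V"
  shows "B (f u x) (f u y) = B x y"
proof -
  have "B (f (word_prod us) x) (f (word_prod us) y) = B x y" if "set us \<subseteq> S" for us
    using that
    by (induction us) (auto simp: assms f_one f_mult f_gen_refl refl_invariant)
  then show ?thesis using word_prod_surj[OF assms(1)] by auto
qed

lemma cone_V: "x \<in> cone \<Longrightarrow> x \<in> V"
  by (auto simp: nonneg_span_def)

lemma f_cone:
  "\<lbrakk>u \<in> carrier W; x \<in> nonneg_span \<epsilon> X; X \<subseteq> S; \<And>s. s \<in> X \<Longrightarrow> f u (\<epsilon> s) \<in> nonneg_span \<epsilon> Y\<rbrakk> \<Longrightarrow>
    f u x \<in> nonneg_span \<epsilon> Y"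
  by (rule linear_nonneg_span[OF f_linear subspace_V]) auto

lemma f_neg_cone:
  assumes "u \<in> carrier W" "x \<in> nonneg_span \<epsilon> X" "X \<subseteq> S" "\<And>s. s \<in> X \<Longrightarrow> - f u (\<epsilon> s) \<in> nonneg_span \<epsilon> Y"
  shows "- f u x \<in> nonneg_span \<epsilon> Y"
proof (rule linear_nonneg_span[OF _ subspace_V _ assms(2)])
  show "linear_on V (\<lambda>x. - f u x)" using f_linear[OF assms(1)] by (simp add: linear_on_def)
qed (use assms(3,4) in auto)

text \<open>The functional \<chi> is positive on simple roots, hence nonnegative on \<open>x\<close>
  and on \<open>- x\<close>, which forces all coefficients of \<open>x\<close> to vanish. This
  stands in for linear independence of the simple roots.\<close>

lemma cone_proper:
  assumes "x \<in> cone" "- x \<in> cone"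
  shows "x = 0"
proof -
  obtain \<chi> :: "'v \<Rightarrow> real" where \<chi>: "linear_on V \<chi>" "\<And>s. s \<in> S \<Longrightarrow> 0 < \<chi> (\<epsilon> s)"
    using root_basis unfolding root_basis_def by blast
  have val: "\<chi> (\<Sum>s\<in>S. c s *\<^sub>R \<epsilon> s) = (\<Sum>s\<in>S. c s * \<chi> (\<epsilon> s))" for c
    using linear_on_sum[OF \<chi>(1) subspace_V, of S "\<lambda>s. c s *\<^sub>R \<epsilon> s"]
    by (simp add: linear_on_scale[OF \<chi>(1)])
  obtain c where c: "x = (\<Sum>s\<in>S. c s *\<^sub>R \<epsilon> s)" "\<forall>s\<in>S. 0 \<le> c s"
    using assms(1) unfolding nonneg_span_def by auto
  obtain d where d: "- x = (\<Sum>s\<in>S. d s *\<^sub>R \<epsilon> s)" "\<forall>s\<in>S. 0 \<le> d s"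
    using assms(2) unfolding nonneg_span_def by auto
  have "0 \<le> \<chi> (- x)" unfolding d(1) val using d(2) \<chi>(2)
    by (intro sum_nonneg) (simp add: less_imp_le)
  then have "\<chi> x \<le> 0" using linear_on_minus[OF \<chi>(1) cone_V[OF assms(1)]] by simp
  moreover have nn: "0 \<le> c s * \<chi> (\<epsilon> s)" if "s \<in> S" for s
    using c(2) \<chi>(2) that by (simp add: less_imp_le)
  ultimately have "(\<Sum>s\<in>S. c s * \<chi> (\<epsilon> s)) = 0"
    using sum_nonneg[of S "\<lambda>s. c s * \<chi> (\<epsilon> s)"] unfolding c(1) val by force
  then have "c s * \<chi> (\<epsilon> s) = 0" if "s \<in> S" for s
    using sum_nonneg_eq_0_iff[OF finite_S, of "\<lambda>s. c s * \<chi> (\<epsilon> s)"] nn that by auto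
  then have "c s = 0" if "s \<in> S" for s using that \<chi>(2)[OF that] by force
  then show ?thesis unfolding c(1) by simp
qed

lemma root_nonzero: "s \<in> S \<Longrightarrow> \<epsilon> s \<noteq> 0"
  using root_norm[of s] B_scale_right[of "\<epsilon> s" "\<epsilon> s" 0] by force

lemma f_root_not_both:
  assumes "u \<in> carrier W" "s \<in> S" "f u (\<epsilon> s) \<in> cone" "- f u (\<epsilon> s) \<in> cone"
  shows False
proof -
  have "f u (\<epsilon> s) = 0" using assms(3,4) by (rule cone_proper)
  then have "f (inv u) 0 = \<epsilon> s" using f_inv[OF assms(1), of "\<epsilon> s"] assms(2) by simp
  then show False using f_zero assms root_nonzero by simp
qed

end

text \<open>Chebyshev polynomials of the second kind with the index shifted by one: at c = cos
  \<theta> the value is sin(k \<theta>) / sin \<theta>.\<close>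

fun dihedral_coeff :: "real \<Rightarrow> nat \<Rightarrow> real" where
  "dihedral_coeff c 0 = 0"
| "dihedral_coeff c (Suc 0) = 1"
| "dihedral_coeff c (Suc (Suc k)) = 2 * c * dihedral_coeff c (Suc k) - dihedral_coeff c k"

lemma dihedral_coeff_cos: "dihedral_coeff (cos \<theta>) k * sin \<theta> = sin (real k * \<theta>)"
proof (induction "cos \<theta>" k rule: dihedral_coeff.induct)
  case (3 k)
  have "sin (real (Suc k) * \<theta> + \<theta>) + sin (real (Suc k) * \<theta> - \<theta>) = 2 * cos \<theta> * sin (real (Suc k) * \<theta>)"
    unfolding sin_add sin_diff by (simp add: algebra_simps)
  moreover have "real (Suc k) * \<theta> + \<theta> = real (Suc (Suc k)) * \<theta>" "real (Suc k) * \<theta> - \<theta> = real k * \<theta>"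
    by (simp_all add: algebra_simps)
  ultimately show ?case using 3 by (simp add: algebra_simps)
qed auto

lemma dihedral_coeff_cos_nonneg:
  assumes "2 \<le> n" "k \<le> n"
  shows "0 \<le> dihedral_coeff (cos (pi / real n)) k"
proof -
  have "0 < sin (pi / real n)" using assms(1) by (intro sin_gt_zero) (auto simp: field_simps)
  moreover have "0 \<le> sin (real k * (pi / real n))"
    using assms by (intro sin_ge_zero) (auto simp: field_simps)
  ultimately show ?thesis
    unfolding dihedral_coeff_cos[symmetric] by (simp add: zero_le_mult_iff)
qed

text \<open>The case of the label \<infinity>. The recurrence subtracts, so nonnegativity alone does
  not pass through the induction; monotonicity is carried along.\<close>

lemma dihedral_coeff_ge_one:
  assumes "1 \<le> c"
  shows "0 \<le> dihedral_coeff c k \<and> dihedral_coeff c k \<le> dihedral_coeff c (Suc k)"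
proof (induction k)
  case (Suc k)
  then have "dihedral_coeff c (Suc k) \<le> c * dihedral_coeff c (Suc k)"
    using assms by (intro mult_right_mono[of 1 c, simplified]) auto
  then show ?case using Suc by simp
qed simp

context reflection_rep
begin

text \<open>Each further letter changes one coordinate by \<open>refl_comb\<close> and advances it
  two places in the recurrence, so the parity of \<open>k\<close> decides which root carries the
  later coefficient.\<close>

lemma f_alternating:
  assumes st: "s \<in> S" "t \<in> S" and c: "c = - B (\<epsilon> s) (\<epsilon> t)"
  shows "f (word_prod (alternating s t k)) (\<epsilon> s) =
    (if even k then dihedral_coeff c (Suc k) *\<^sub>R \<epsilon> s + dihedral_coeff c k *\<^sub>R \<epsilon> t
     else dihedral_coeff c k *\<^sub>R \<epsilon> s + dihedral_coeff c (Suc k) *\<^sub>R \<epsilon> t)"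
proof (induction k)
  case 0
  then show ?case using st by (simp add: f_one)
next
  case (Suc k)
  let ?r = "if even k then t else s"
  have w: "word_prod (alternating s t k) \<in> carrier W"
    using st set_alternating[of s t k] by (intro word_prod_closed) auto
  have r: "?r \<in> S" using st by simp
  have "f (word_prod (alternating s t (Suc k))) (\<epsilon> s)
      = refl (\<epsilon> ?r) (f (word_prod (alternating s t k)) (\<epsilon> s))"
    using f_mult[OF gen_closed[OF r] w] st f_gen_refl[OF r] by simp
  then show ?case
    using st c refl_comb[of "\<epsilon> s" "\<epsilon> t" c "dihedral_coeff c (Suc k)" "dihedral_coeff c k"]
      refl_comb[of "\<epsilon> t" "\<epsilon> s" c "dihedral_coeff c (Suc k)" "dihedral_coeff c k"]
      B_sym[of "\<epsilon> s" "\<epsilon> t"]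
    unfolding Suc by (simp add: add.commute)
qed

text \<open>
  The induction strips from \<open>w\<close> a maximal reduced tail that alternates between \<open>s\<close> and a descent
  \<open>t\<close>. Maximality puts both roots of the dihedral pair on the positive side of the remaining prefix.
\<close>

theorem f_root_pos:
  assumes "w \<in> carrier W" "s \<in> S" "len w \<le> len (w \<otimes> \<iota> s)"
  shows "f w (\<epsilon> s) \<in> cone"
  using assms
proof (induction "len w" arbitrary: w s rule: less_induct)
  case less
  note w = less.prems(1) and s = less.prems(2)
  show ?case
  proof (cases "w = \<one>")
    case True
    then show ?thesis using s by (simp add: f_one nonneg_span_base finite_S)
  next
    case False
    obtain t where t: "t \<in> S" "len (w \<otimes> \<iota> t) + 1 = len w"
      using descent_exists[OF w False] by blast
    have ts: "s \<noteq> t" using t less.prems(3) by auto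
    let ?A = "\<lambda>k. word_prod (alternating s t k)"
    have alt: "set (alternating s t k) \<subseteq> S" "set (alternating t s k) \<subseteq> S" for k
      using set_alternating[of s t k] set_alternating[of t s k] s t by auto
    have A: "?A k \<in> carrier W" for k by (rule word_prod_closed[OF alt(1)])
    define Q where "Q k \<longleftrightarrow> (\<exists>v \<in> carrier W. w = v \<otimes> ?A k \<and> len w = len v + k)" for k
    have "Q 1" unfolding Q_def using w t by (intro bexI[of _ "w \<otimes> \<iota> t"]) auto
    moreover have bound: "\<forall>k. Q k \<longrightarrow> k \<le> len w" by (auto simp: Q_def)
    ultimately obtain k where k: "Q k" "\<And>j. Q j \<Longrightarrow> j \<le> k"
      using Greatest_le_nat[of Q] GreatestI_nat[of Q] by metis
    have "1 \<le> k" using k(2) \<open>Q 1\<close> .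
    then obtain k' where k': "k = Suc k'" by (cases k) auto
    obtain v where v: "v \<in> carrier W" "w = v \<otimes> ?A k" "len w = len v + k"
      using k(1) by (auto simp: Q_def)
    \<comment> \<open>If the length dropped, this letter could be moved from \<open>v\<close> into
      the tail, against the maximality of \<open>k\<close>.\<close>
    have next_letter: "len v \<le> len (v \<otimes> \<iota> (if even k then t else s))" (is "_ \<le> len (v \<otimes> \<iota> ?r)")
    proof (rule ccontr)
      assume *: "\<not> ?thesis"
      have r: "?r \<in> S" using s t by simp
      have "Q (Suc k)"
        unfolding Q_def
      proof (intro bexI conjI)
        show "v \<otimes> \<iota> ?r \<in> carrier W" using v r by simp
        show "w = v \<otimes> \<iota> ?r \<otimes> ?A (Suc k)" using v r A by (simp add: m_assoc)
        show "len w = len (v \<otimes> \<iota> ?r) + Suc k" using * le_len_gen[OF v(1) r] v(3) by simp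
      qed
      then show False using k(2) by force
    qed
    \<comment> \<open>\<open>?r\<close> is now the leftmost letter of the tail. Moving it into
      \<open>v\<close> leaves a tail of length \<open>k'\<close>, so a drop in length would give
      \<open>w\<close> too short a word.\<close>
    have last_letter: "len v \<le> len (v \<otimes> \<iota> (if even k' then t else s))" (is "_ \<le> len (v \<otimes> \<iota> ?r)")
    proof (rule ccontr)
      assume *: "\<not> ?thesis"
      have r: "?r \<in> S" using s t by simp
      have "w = (v \<otimes> \<iota> ?r) \<otimes> ?A k'" using v r A by (simp add: m_assoc k')
      then have "len w \<le> len (v \<otimes> \<iota> ?r) + k'"
        using len_mult_word[OF m_closed[OF v(1) gen_closed[OF r]] alt(1)[of k']] by simp
      then show False using * v(3) k' by simp
    qed
    \<comment> \<open>\<open>k\<close> and \<open>k'\<close> have opposite parity, so the two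
      letters just treated are \<open>s\<close> and \<open>t\<close> in some order.\<close>
    have vst: "len v \<le> len (v \<otimes> \<iota> s)" "len v \<le> len (v \<otimes> \<iota> t)"
      using next_letter last_letter k' by (auto split: if_splits)
    have vlt: "len v < len w" using v(3) k' by simp
    have pos: "f v (\<epsilon> s) \<in> cone" "f v (\<epsilon> t) \<in> cone"
      using less.hyps[OF vlt v(1) s vst(1)] less.hyps[OF vlt v(1) t(1) vst(2)] .
    \<comment> \<open>A tail of length at least \<open>n\<close> could be rewritten by the braid
      relation to end in \<open>s\<close>; then \<open>w \<otimes> \<iota> s\<close> would be
      shorter than \<open>w\<close>.\<close>
    have k_less: "k < n" if n: "m s t = enat n" for n
    proof (rule ccontr)
      assume "\<not> k < n"
      then obtain j where j: "k = j + n" by (metis add.commute le_Suc_ex not_less)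
      have "2 \<le> n" using m_ge_2[OF s t(1) ts] by (simp add: n numeral_eq_enat)
      then obtain n' where n': "n = Suc n'" by (cases n) auto
      obtain xs where xs: "alternating s t k = xs @ alternating s t n" "length xs = j"
        using alternating_split[of s t j n] j by auto
      have xsS: "set xs \<subseteq> S" using alt(1)[of k] xs(1) by auto
      have "?A n = word_prod (alternating t s n)" by (rule braid[OF s t(1) n])
      also have "\<dots> = ?A n' \<otimes> \<iota> s"
        unfolding n' alternating_Suc_right using alt s by (simp add: word_prod_append)
      finally have "w \<otimes> \<iota> s = v \<otimes> word_prod (xs @ alternating s t n')"
        using v xs xsS alt A s by (simp add: word_prod_append m_assoc)
      then have "len (w \<otimes> \<iota> s) \<le> len v + (j + n')"
        using len_mult_word[OF v(1), of "xs @ alternating s t n'"] xs xsS alt by simp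
      then show False using less.prems(3) v(3) j n' by simp
    qed
    define c where "c = - B (\<epsilon> s) (\<epsilon> t)"
    \<comment> \<open>\<open>f_alternating\<close> uses coefficients up to index
      \<open>Suc k\<close>. By \<open>k_less\<close> this is at most \<open>n\<close>, exactly the
      range where the sines stay nonnegative.\<close>
    have coeff: "0 \<le> dihedral_coeff c i" if "i \<le> Suc k" for i
    proof (cases "m s t")
      case (enat n)
      have "2 \<le> n" using m_ge_2[OF s t(1) ts] by (simp add: enat numeral_eq_enat)
      moreover have "c = cos (pi / real n)" using root_finite[OF s t(1) ts enat] by (simp add: c_def)
      ultimately show ?thesis using dihedral_coeff_cos_nonneg[of n i] k_less[OF enat] that by simp
    next
      case infinity
      have "1 \<le> c" using root_infinite[OF s t(1) ts infinity] by (simp add: c_def)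
      then show ?thesis using dihedral_coeff_ge_one by blast
    qed
    have "f (?A k) (\<epsilon> s) \<in> nonneg_span \<epsilon> {s, t}"
      unfolding f_alternating[OF s t(1) c_def]
      using coeff[of k] coeff[of "Suc k"]
      by (auto intro!: nonneg_span_add nonneg_span_scale nonneg_span_base)
    then have "f v (f (?A k) (\<epsilon> s)) \<in> cone"
      by (rule f_cone[OF v(1)]) (use s t pos in auto)
    then show ?thesis using f_mult[OF v(1) A] s unfolding v(2) by simp
  qed
qed

lemma f_root_neg:
  assumes "w \<in> carrier W" "s \<in> S" "len (w \<otimes> \<iota> s) \<le> len w"
  shows "- f w (\<epsilon> s) \<in> cone"
proof -
  have "f (w \<otimes> \<iota> s) (\<epsilon> s) \<in> cone"
    using assms by (intro f_root_pos) auto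
  then show ?thesis using assms by (simp add: f_mult f_gen_root f_minus)
qed

lemma f_root_dichotomy: "\<lbrakk>w \<in> carrier W; s \<in> S\<rbrakk> \<Longrightarrow> f w (\<epsilon> s) \<in> cone \<or> - f w (\<epsilon> s) \<in> cone"
  using f_root_pos f_root_neg nat_le_linear by blast

text \<open>The sign of the root decides the length: if the length did not grow,
  \<open>f_root_neg\<close> would put the same root in the negative cone as well.\<close>

lemma f_root_pos_len: "\<lbrakk>w \<in> carrier W; s \<in> S; f w (\<epsilon> s) \<in> cone\<rbrakk> \<Longrightarrow> len (w \<otimes> \<iota> s) = len w + 1"
  using f_root_neg f_root_not_both len_gen_le[of w s] by (metis le_antisym not_less_eq_eq Suc_eq_plus1)

lemma f_root_neg_len: "\<lbrakk>w \<in> carrier W; s \<in> S; - f w (\<epsilon> s) \<in> cone\<rbrakk> \<Longrightarrow> len w = len (w \<otimes> \<iota> s) + 1"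
  using f_root_pos f_root_not_both le_len_gen[of w s] by (metis le_antisym not_less_eq_eq Suc_eq_plus1)

lemma f_pos_imp_one:
  assumes "w \<in> carrier W" "\<And>s. s \<in> S \<Longrightarrow> f w (\<epsilon> s) \<in> cone"
  shows "w = \<one>"
proof (rule ccontr)
  assume "w \<noteq> \<one>"
  then obtain s where "s \<in> S" "len (w \<otimes> \<iota> s) + 1 = len w"
    using descent_exists[OF assms(1)] by blast
  then show False using f_root_pos_len[OF assms(1) _ assms(2), of s] by simp
qed

lemma f_faithful:
  assumes "w \<in> carrier W" "\<And>s. s \<in> S \<Longrightarrow> f w (\<epsilon> s) = \<epsilon> s"
  shows "w = \<one>"
  using assms by (intro f_pos_imp_one) (simp_all add: nonneg_span_base finite_S)

lemma f_inj: "inj_on f (carrier W)"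
proof (rule inj_onI)
  fix u v assume uv: "u \<in> carrier W" "v \<in> carrier W" "f u = f v"
  have "inv v \<otimes> u = \<one>"
  proof (rule f_faithful)
    show "f (inv v \<otimes> u) (\<epsilon> s) = \<epsilon> s" if "s \<in> S" for s
      using uv that by (simp add: f_mult f_inv)
  qed (use uv in simp)
  then show "u = v" using uv by (metis inv_equality inv_inv inv_closed)
qed

theorem coxeter_system: "coxeter_system W S m \<iota>"
proof (rule coxeter_systemI)
  fix \<phi> assume \<phi>: "\<phi> \<in> hom (coxeter_group S m) W" "\<And>s. s \<in> S \<Longrightarrow> \<phi> (coxeter_gen S m s) = \<iota> s"
  interpret P: coxeter_generators "coxeter_group S m" S m "coxeter_gen S m"
    by (rule coxeter_group_generators[OF coxeter_matrix])
  interpret P: reflection_rep "coxeter_group S m" S m "coxeter_gen S m" V B \<epsilon> "f \<circ> \<phi>"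
  proof (unfold_locales)
    show "is_rooted_rep (coxeter_group S m) S (coxeter_gen S m) V B \<epsilon> (f \<circ> \<phi>)"
      using Group.hom_compose[OF \<phi>(1) f_hom] \<phi>(2) by (simp add: is_rooted_rep_def f_gen_refl)
  qed (rule finite_S root_basis)+
  show "inj_on \<phi> (carrier (coxeter_group S m))"
    using P.f_inj by (rule inj_on_imageI2)
qed

end

section \<open>Longest elements of finite parabolic subgroups\<close>

context reflection_rep
begin

text \<open>Longest elements are studied for the whole group first; through this interpretation the
  results pass to every parabolic subgroup, with cones spanned by the roots of \<open>X\<close>
  alone.\<close>

lemma parabolic_rep:
  assumes "X \<subseteq> S"
  shows "reflection_rep (W\<lparr>carrier := parabolic W \<iota> X\<rparr>) X m \<iota> V B \<epsilon> f"
proof (intro reflection_rep.intro reflection_rep_axioms.intro parabolic_coxeter_generators assms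
    form_space_axioms)
  show "finite X" using finite_S assms by (rule finite_subset[rotated])
  show "root_basis V B X m \<epsilon>"
    using root_basis assms unfolding root_basis_def by (auto simp: subset_iff inj_on_def)
  have "parabolic W \<iota> X \<subseteq> carrier W" by (rule subgroup.subset[OF parabolic_subgroup[OF assms]])
  then show "is_rooted_rep (W\<lparr>carrier := parabolic W \<iota> X\<rparr>) X \<iota> V B \<epsilon> f"
    using rep assms by (auto simp: is_rooted_rep_def hom_def Pi_iff subset_iff)
qed

lemma parabolic_carrier: "X \<subseteq> S \<Longrightarrow> parabolic W \<iota> X \<subseteq> carrier W"
  by (rule subgroup.subset[OF parabolic_subgroup])

lemma parabolic_all: "parabolic W \<iota> S = carrier W"
  by (simp add: parabolic_def generate_gen)

text \<open>Along a reduced word of \<open>u\<close> each new letter is an ascent, so the prefix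
  sends its root into the cone. As \<open>v\<close> turns the cone negative, the same letter is a
  descent for \<open>v\<close> times the prefix.\<close>

lemma all_negative_len:
  assumes v: "v \<in> carrier W" "\<And>s. s \<in> S \<Longrightarrow> - f v (\<epsilon> s) \<in> cone" and u: "u \<in> carrier W"
  shows "len (v \<otimes> u) + len u = len v"
  using u
proof (induction "len u" arbitrary: u rule: less_induct)
  case less
  show ?case
  proof (cases "u = \<one>")
    case False
    obtain s where s: "s \<in> S" "len (u \<otimes> \<iota> s) + 1 = len u"
      using descent_exists[OF less.prems False] by blast
    define u' where "u' = u \<otimes> \<iota> s"
    have u': "u' \<in> carrier W" "u = u' \<otimes> \<iota> s" "len u' + 1 = len u"
      using less.prems s by (auto simp: u'_def)
    have "len u' \<le> len (u' \<otimes> \<iota> s)" using u' by simp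
    then have "f u' (\<epsilon> s) \<in> cone" by (rule f_root_pos[OF u'(1) s(1)])
    then have "- f v (f u' (\<epsilon> s)) \<in> cone" by (rule f_neg_cone[OF v(1)]) (auto simp: v(2))
    then have "- f (v \<otimes> u') (\<epsilon> s) \<in> cone" using u' v(1) s(1) by (simp add: f_mult)
    then have "len (v \<otimes> u') = len (v \<otimes> u' \<otimes> \<iota> s) + 1"
      using u' v(1) s(1) by (intro f_root_neg_len) auto
    moreover have "v \<otimes> u' \<otimes> \<iota> s = v \<otimes> u" using u' v(1) s(1) by (simp add: m_assoc)
    ultimately show ?thesis using less.hyps[of u'] u' by simp
  qed (use v in simp)
qed

text \<open>Lengths are bounded by that of \<open>v\<close>, which leaves finitely many words. Any
  element of the same length composes with \<open>v\<close> to length 0, so it is the inverse of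
  \<open>v\<close>; applied to \<open>v\<close> itself this makes \<open>v\<close> an involution and
  the longest element unique.\<close>

lemma all_negative_longest:
  assumes v: "v \<in> carrier W" "\<And>s. s \<in> S \<Longrightarrow> - f v (\<epsilon> s) \<in> cone"
  shows "finite (carrier W)" "longest_element W \<iota> S = v" "v \<otimes> v = \<one>"
proof -
  have le: "len u \<le> len v" if "u \<in> carrier W" for u
    using all_negative_len[OF v that] by simp
  have "carrier W \<subseteq> word_prod ` {us. set us \<subseteq> S \<and> length us \<le> len v}"
  proof
    fix u assume u: "u \<in> carrier W"
    obtain us where "set us \<subseteq> S" "word_prod us = u" "length us = len u"
      using reduced_word[OF u] by blast
    then show "u \<in> word_prod ` {us. set us \<subseteq> S \<and> length us \<le> len v}" using le[OF u] by auto
  qed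
  then show "finite (carrier W)"
    using finite_lists_length_le[OF finite_S] by (rule finite_subset[OF _ finite_imageI])
  have opp: "v \<otimes> w = \<one>" if "w \<in> carrier W" "len w = len v" for w
  proof -
    have "len (v \<otimes> w) = 0" using all_negative_len[OF v that(1)] that(2) by simp
    then show ?thesis using v(1) that(1) by (simp add: len_eq_0)
  qed
  show vv: "v \<otimes> v = \<one>" using opp v(1) by simp
  show "longest_element W \<iota> S = v"
    unfolding longest_element_def parabolic_all
  proof (rule the_equality)
    show "v \<in> carrier W \<and> (\<forall>u\<in>carrier W. len u \<le> len v)" using v(1) le by simp
    fix w assume w: "w \<in> carrier W \<and> (\<forall>u\<in>carrier W. len u \<le> len w)"
    then have "len w = len v" using le v(1) by (simp add: le_antisym)
    then have "v \<otimes> w = v \<otimes> v" using opp w vv by simp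
    then show "w = v" using w v(1) by simp
  qed
qed

lemma longest_element_exists:
  assumes "finite (carrier W)"
  shows "\<exists>v \<in> carrier W. \<forall>s\<in>S. - f v (\<epsilon> s) \<in> cone"
proof -
  obtain v where v: "v \<in> carrier W" "\<And>u. u \<in> carrier W \<Longrightarrow> len u \<le> len v"
  proof -
    have "Max (len ` carrier W) \<in> len ` carrier W"
      using assms one_closed by (intro Max_in) blast+
    then obtain v where "v \<in> carrier W" "len v = Max (len ` carrier W)" by auto
    then show ?thesis using that assms by simp
  qed
  have "- f v (\<epsilon> s) \<in> cone" if "s \<in> S" for s
    using v that by (intro f_root_neg) auto
  then show ?thesis using v(1) by blast
qed

lemma sum_roots_nonzero:
  assumes "X \<subseteq> S" "X \<noteq> {}"
  shows "(\<Sum>s\<in>X. \<epsilon> s) \<noteq> 0"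
proof
  assume 0: "(\<Sum>s\<in>X. \<epsilon> s) = 0"
  obtain s where s: "s \<in> X" using assms by blast
  have fin: "finite X" using finite_S assms(1) by (rule finite_subset[rotated])
  have "- \<epsilon> s = (\<Sum>t\<in>X - {s}. \<epsilon> t)"
    using sum.remove[OF fin s, of \<epsilon>] 0 by (simp add: add_eq_0_iff)
  also have "\<dots> \<in> cone"
    using assms(1) finite_S by (intro nonneg_span_sum nonneg_span_base) auto
  finally have "\<epsilon> s = 0"
    using assms(1) s finite_S by (intro cone_proper nonneg_span_base) auto
  then show False using root_nonzero assms(1) s by auto
qed

text \<open>
  If the sum \<open>a\<close> of the simple roots were antidominant, every group element could only move it
  in the positive direction, whereas the longest element makes it negative.
\<close>

lemma finite_sum_roots_pos:
  assumes "finite (carrier W)" "S \<noteq> {}"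
  shows "\<exists>s\<in>S. 0 < B (\<Sum>t\<in>S. \<epsilon> t) (\<epsilon> s)"
proof (rule ccontr)
  define a where "a = (\<Sum>t\<in>S. \<epsilon> t)"
  assume "\<not> ?thesis"
  then have neg: "B a (\<epsilon> s) \<le> 0" if "s \<in> S" for s using that by (auto simp: a_def not_less)
  have a: "a \<in> cone" unfolding a_def by (intro nonneg_span_sum nonneg_span_base finite_S)
  have aV: "a \<in> V" by (rule cone_V[OF a])
  have "f u a - a \<in> cone" if "u \<in> carrier W" for u
    using that
  proof (induction "len u" arbitrary: u rule: less_induct)
    case less
    show ?case
    proof (cases "u = \<one>")
      case True
      then show ?thesis using aV by (simp add: f_one nonneg_span_zero)
    next
      case False
      obtain s where s: "s \<in> S" "len (u \<otimes> \<iota> s) + 1 = len u"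
        using descent_exists[OF less.prems False] by blast
      define u' where "u' = u \<otimes> \<iota> s"
      have u': "u' \<in> carrier W" "u = u' \<otimes> \<iota> s" "len u' + 1 = len u"
        using less.prems s by (auto simp: u'_def)
      have "len u' \<le> len (u' \<otimes> \<iota> s)" using u' by simp
      then have pos: "f u' (\<epsilon> s) \<in> cone" by (rule f_root_pos[OF u'(1) s(1)])
      have "f u a = f u' (a - (2 * B a (\<epsilon> s)) *\<^sub>R \<epsilon> s)"
        unfolding u'(2) using u'(1) s(1) aV by (simp add: f_mult f_gen)
      then have "f u a - a = (f u' a - a) + (- 2 * B a (\<epsilon> s)) *\<^sub>R f u' (\<epsilon> s)"
        using u'(1) s(1) aV by (simp add: f_diff f_scale)
      also have "\<dots> \<in> cone"
        using less.hyps[of u'] u' pos neg[OF s(1)] by (intro nonneg_span_add nonneg_span_scale) auto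
      finally show ?thesis .
    qed
  qed
  moreover obtain v where v: "v \<in> carrier W" "\<And>s. s \<in> S \<Longrightarrow> - f v (\<epsilon> s) \<in> cone"
    using longest_element_exists[OF assms(1)] by blast
  ultimately have "f v a - a \<in> cone" by blast
  moreover have "- f v a \<in> cone" by (rule f_neg_cone[OF v(1) a]) (auto simp: v(2))
  ultimately have "(f v a - a) + (- f v a) \<in> cone" by (rule nonneg_span_add)
  then have "a = 0" by (intro cone_proper a) simp
  then show False using sum_roots_nonzero[OF subset_refl assms(2)] by (simp add: a_def)
qed

lemma longest_element_restrict:
  assumes "X \<subseteq> S"
  shows "longest_element (W\<lparr>carrier := parabolic W \<iota> X\<rparr>) \<iota> X = longest_element W \<iota> X"
proof -
  interpret X: reflection_rep "W\<lparr>carrier := parabolic W \<iota> X\<rparr>" X m \<iota> V B \<epsilon> f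
    by (rule parabolic_rep[OF assms])
  show ?thesis
    unfolding longest_element_def X.parabolic_all parabolic_len[OF assms] by simp
qed

text \<open>The test by which a candidate is recognized as the longest element: signs of roots
  replace the comparison of lengths.\<close>

lemma parabolic_longest:
  assumes "X \<subseteq> S" "v \<in> parabolic W \<iota> X" "\<And>s. s \<in> X \<Longrightarrow> - f v (\<epsilon> s) \<in> nonneg_span \<epsilon> X"
  shows "finite (parabolic W \<iota> X)" "longest_element W \<iota> X = v" "v \<otimes> v = \<one>"
proof -
  interpret X: reflection_rep "W\<lparr>carrier := parabolic W \<iota> X\<rparr>" X m \<iota> V B \<epsilon> f
    by (rule parabolic_rep[OF assms(1)])
  show "finite (parabolic W \<iota> X)" "longest_element W \<iota> X = v" "v \<otimes> v = \<one>"
    using X.all_negative_longest[of v] assms by (simp_all add: longest_element_restrict)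
qed

lemma longest_element_props:
  assumes "X \<subseteq> S" "finite (parabolic W \<iota> X)"
  shows "longest_element W \<iota> X \<in> parabolic W \<iota> X"
    "longest_element W \<iota> X \<otimes> longest_element W \<iota> X = \<one>"
    "s \<in> X \<Longrightarrow> - f (longest_element W \<iota> X) (\<epsilon> s) \<in> nonneg_span \<epsilon> X"
proof -
  interpret X: reflection_rep "W\<lparr>carrier := parabolic W \<iota> X\<rparr>" X m \<iota> V B \<epsilon> f
    by (rule parabolic_rep[OF assms(1)])
  obtain v where v: "v \<in> parabolic W \<iota> X" "\<And>s. s \<in> X \<Longrightarrow> - f v (\<epsilon> s) \<in> nonneg_span \<epsilon> X"
    using X.longest_element_exists assms(2) by auto
  have "longest_element W \<iota> X = v" "v \<otimes> v = \<one>"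
    using parabolic_longest[OF assms(1) v] by auto
  then show "longest_element W \<iota> X \<in> parabolic W \<iota> X"
    "longest_element W \<iota> X \<otimes> longest_element W \<iota> X = \<one>"
    "s \<in> X \<Longrightarrow> - f (longest_element W \<iota> X) (\<epsilon> s) \<in> nonneg_span \<epsilon> X"
    using v by auto
qed

lemma parabolic_sum_roots_pos:
  assumes "X \<subseteq> S" "X \<noteq> {}" "finite (parabolic W \<iota> X)"
  shows "\<exists>s\<in>X. 0 < B (\<Sum>t\<in>X. \<epsilon> t) (\<epsilon> s)"
proof -
  interpret X: reflection_rep "W\<lparr>carrier := parabolic W \<iota> X\<rparr>" X m \<iota> V B \<epsilon> f
    by (rule parabolic_rep[OF assms(1)])
  show ?thesis using X.finite_sum_roots_pos assms by simp
qed

lemma parabolic_f_diff: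
  assumes "X \<subseteq> S" "u \<in> parabolic W \<iota> X" "x \<in> V"
  shows "\<exists>c. f u x = x + (\<Sum>s\<in>X. c s *\<^sub>R \<epsilon> s)"
proof -
  have fin: "finite X" using finite_S assms(1) by (rule finite_subset[rotated])
  have "\<exists>c. f (word_prod us) x = x + (\<Sum>s\<in>X. c s *\<^sub>R \<epsilon> s)" if "set us \<subseteq> X" for us
    using that
  proof (induction us)
    case Nil
    then show ?case using assms(3) by (intro exI[of _ "\<lambda>_. 0"]) (simp add: f_one)
  next
    case (Cons s us)
    then obtain c where c: "f (word_prod us) x = x + (\<Sum>t\<in>X. c t *\<^sub>R \<epsilon> t)" by auto
    have s: "s \<in> X" "s \<in> S" and us: "word_prod us \<in> carrier W"
      using Cons.prems assms(1) by (auto intro!: word_prod_closed)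
    define b where "b = 2 * B (f (word_prod us) x) (\<epsilon> s)"
    have "f (word_prod (s # us)) x = f (word_prod us) x - b *\<^sub>R \<epsilon> s"
      using s us assms(3) by (simp add: f_mult f_gen b_def)
    also have "\<dots> = x + (\<Sum>t\<in>X. (c t - (if t = s then b else 0)) *\<^sub>R \<epsilon> t)"
      using s(1) fin
      by (simp add: c scaleR_left_diff_distrib sum_subtractf if_distrib[of "\<lambda>c. c *\<^sub>R _"] cong: if_cong)
    finally show ?case by (rule exI[where x = "\<lambda>t. c t - (if t = s then b else 0)"])
  qed
  moreover obtain us where "set us \<subseteq> X" "u = word_prod us"
    using assms(2) parabolic_word_prod[OF assms(1)] by auto
  ultimately show ?thesis by blast
qed

end

section \<open>Groups of symmetries\<close>

locale folding = reflection_rep W S m \<iota> V B \<epsilon> f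
  for W :: "('w, 'b) monoid_scheme" (structure) and S :: "'s set" and m and \<iota>
    and V :: "'v::real_vector set" and B and \<epsilon> and f +
  fixes G :: "('s \<Rightarrow> 's) set" and \<rho> :: "('s \<Rightarrow> 's) \<Rightarrow> 'v \<Rightarrow> 'v"
  assumes symmetry_group: "symmetry_group G S m"
    and equivariant_embedding: "equivariant_embedding G S V B \<epsilon> \<rho>"
begin

abbreviation orb :: "'s set set" where
  "orb \<equiv> orbits (BijGroup S\<lparr>carrier := G\<rparr>) S (\<lambda>g. g)"

abbreviation fin_orb :: "'s set set" where
  "fin_orb \<equiv> finite_orbits W S \<iota> G"

abbreviation WG :: "'w set" where
  "WG \<equiv> fixed_subgroup W S \<iota> G"

abbreviation VG :: "'v set" where
  "VG \<equiv> fixed_space G \<rho> V"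

abbreviation longest :: "'s set \<Rightarrow> 'w" where
  "longest \<equiv> longest_element W \<iota>"

abbreviation folded_form :: "'s set \<Rightarrow> 's set \<Rightarrow> real" where
  "folded_form X Y \<equiv> B (folded_root B \<epsilon> X) (folded_root B \<epsilon> Y)"

definition root_sum :: "'s set \<Rightarrow> 'v" where
  "root_sum X = (\<Sum>s\<in>X. \<epsilon> s)"

lemma G_subgroup: "subgroup G (BijGroup S)"
  using symmetry_group by (simp add: symmetry_group_def)

lemma G_Bij: "g \<in> G \<Longrightarrow> g \<in> Bij S"
  using subgroup.subset[OF G_subgroup] by (auto simp: BijGroup_def)

lemma G_bij_betw: "g \<in> G \<Longrightarrow> bij_betw g S S"
  using G_Bij by (simp add: Bij_def)

lemma G_closed [simp]: "\<lbrakk>g \<in> G; s \<in> S\<rbrakk> \<Longrightarrow> g s \<in> S"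
  using G_bij_betw bij_betwE by blast

lemma G_m: "\<lbrakk>g \<in> G; s \<in> S; t \<in> S\<rbrakk> \<Longrightarrow> m (g s) (g t) = m s t"
  using symmetry_group by (auto simp: symmetry_group_def symmetries_def)

lemma finite_G: "finite G"
proof (rule finite_subset)
  show "G \<subseteq> S \<rightarrow>\<^sub>E S"
    using G_Bij G_closed by (auto simp: PiE_def Bij_def)
qed (simp add: finite_PiE finite_S)

lemma G_one: "(\<lambda>s\<in>S. s) \<in> G"
  using subgroup.one_closed[OF G_subgroup] by (simp add: BijGroup_def)

lemma G_comp: "\<lbrakk>g \<in> G; h \<in> G\<rbrakk> \<Longrightarrow> compose S g h \<in> G"
  using subgroup.m_closed[OF G_subgroup, of g h] G_Bij by (simp add: BijGroup_def)

lemma G_inverse: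
  assumes "g \<in> G"
  obtains h where "h \<in> G" "compose S h g = (\<lambda>s\<in>S. s)" "compose S g h = (\<lambda>s\<in>S. s)"
proof -
  interpret BG: group "BijGroup S" by (rule group_BijGroup)
  let ?h = "inv\<^bsub>BijGroup S\<^esub> g"
  have g: "g \<in> carrier (BijGroup S)" using G_Bij[OF assms] by (simp add: BijGroup_def)
  have h: "?h \<in> G" by (rule subgroup.m_inv_closed[OF G_subgroup assms])
  have mult: "x \<otimes>\<^bsub>BijGroup S\<^esub> y = compose S x y" if "x \<in> G" "y \<in> G" for x y
    using G_Bij[OF that(1)] G_Bij[OF that(2)] by (simp add: BijGroup_def)
  have one: "\<one>\<^bsub>BijGroup S\<^esub> = (\<lambda>s\<in>S. s)" by (simp add: BijGroup_def)
  show ?thesis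
    using that[OF h] BG.l_inv[OF g] BG.r_inv[OF g]
    unfolding mult[OF h assms] mult[OF assms h] one by blast
qed

lemma G_inverse_apply:
  assumes "g \<in> G"
  obtains h where "h \<in> G" "\<And>s. s \<in> S \<Longrightarrow> h (g s) = s" "\<And>s. s \<in> S \<Longrightarrow> g (h s) = s"
proof -
  obtain h where h: "h \<in> G" "compose S h g = (\<lambda>s\<in>S. s)" "compose S g h = (\<lambda>s\<in>S. s)"
    using G_inverse[OF assms] .
  have "h (g s) = s" "g (h s) = s" if "s \<in> S" for s
    using fun_cong[OF h(2), of s] fun_cong[OF h(3), of s] that by (simp_all add: compose_def)
  then show ?thesis using that[OF h(1)] by blast
qed

lemma \<rho>_hom: "\<rho> \<in> hom (BijGroup S\<lparr>carrier := G\<rparr>) (GL V)"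
  using equivariant_embedding by (simp add: equivariant_embedding_def)

lemma \<rho>_GL: "g \<in> G \<Longrightarrow> \<rho> g \<in> carrier (GL V)"
  using \<rho>_hom by (auto simp: hom_def)

lemma \<rho>_closed [simp]: "\<lbrakk>g \<in> G; x \<in> V\<rbrakk> \<Longrightarrow> \<rho> g x \<in> V"
  by (rule GL_closed[OF \<rho>_GL])

lemma \<rho>_linear: "g \<in> G \<Longrightarrow> linear_on V (\<rho> g)"
  by (rule GL_linear[OF \<rho>_GL])

lemmas \<rho>_add = linear_on_add[OF \<rho>_linear]
  and \<rho>_scale = linear_on_scale[OF \<rho>_linear]
  and \<rho>_minus = linear_on_minus[OF \<rho>_linear]
  and \<rho>_diff = linear_on_diff[OF \<rho>_linear subspace_V]
  and \<rho>_sum = linear_on_sum[OF \<rho>_linear subspace_V]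
  and \<rho>_zero = linear_on_zero[OF \<rho>_linear subspace_V]

lemma \<rho>_comp:
  assumes "g \<in> G" "h \<in> G" "x \<in> V"
  shows "\<rho> (compose S g h) x = \<rho> g (\<rho> h x)"
proof -
  have "compose S g h = g \<otimes>\<^bsub>BijGroup S\<lparr>carrier := G\<rparr>\<^esub> h"
    using assms G_Bij by (simp add: BijGroup_def)
  then show ?thesis
    using hom_mult[OF \<rho>_hom, of g h] assms by (simp add: GL_mult_apply \<rho>_GL)
qed

lemma \<rho>_one: "x \<in> V \<Longrightarrow> \<rho> (\<lambda>s\<in>S. s) x = x"
  using hom_one[OF \<rho>_hom subgroup.subgroup_is_group[OF G_subgroup group_BijGroup] group_GL[OF subspace_V]]
  by (simp add: BijGroup_def GL_one)

lemma \<rho>_root: "\<lbrakk>g \<in> G; s \<in> S\<rbrakk> \<Longrightarrow> \<rho> g (\<epsilon> s) = \<epsilon> (g s)"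
  using equivariant_embedding by (simp add: equivariant_embedding_def)

lemma \<rho>_invariant: "\<lbrakk>g \<in> G; x \<in> V; y \<in> V\<rbrakk> \<Longrightarrow> B (\<rho> g x) (\<rho> g y) = B x y"
  using equivariant_embedding by (simp add: equivariant_embedding_def)

lemma \<rho>_inverse:
  assumes "g \<in> G"
  obtains h where "h \<in> G" "\<And>x. x \<in> V \<Longrightarrow> \<rho> g (\<rho> h x) = x" "\<And>x. x \<in> V \<Longrightarrow> \<rho> h (\<rho> g x) = x"
proof -
  obtain h where h: "h \<in> G" "compose S h g = (\<lambda>s\<in>S. s)" "compose S g h = (\<lambda>s\<in>S. s)"
    using G_inverse[OF assms] .
  have "\<rho> g (\<rho> h x) = x" "\<rho> h (\<rho> g x) = x" if "x \<in> V" for x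
    using \<rho>_comp[OF assms h(1) that] \<rho>_comp[OF h(1) assms that] that \<rho>_one h(2,3) by simp_all
  then show ?thesis using that[OF h(1)] by blast
qed

lemma orb_eq: "orb = {{g s | g. g \<in> G} | s. s \<in> S}"
  by (simp add: orbits_def orbit_def)

lemma orb_subset: "X \<in> orb \<Longrightarrow> X \<subseteq> S"
  by (auto simp: orb_eq)

lemma orb_nonempty: "X \<in> orb \<Longrightarrow> X \<noteq> {}"
  using G_one by (auto simp: orb_eq)

lemma orb_finite: "X \<in> orb \<Longrightarrow> finite X"
  using finite_subset[OF orb_subset finite_S] .

lemma orb_closed: "\<lbrakk>X \<in> orb; g \<in> G; s \<in> X\<rbrakk> \<Longrightarrow> g s \<in> X"
proof -
  assume X: "X \<in> orb" and g: "g \<in> G" and s: "s \<in> X"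
  then obtain x h where "x \<in> S" "X = {g x | g. g \<in> G}" "h \<in> G" "s = h x"
    by (auto simp: orb_eq)
  then show ?thesis using G_comp[OF g, of h] by (force simp: compose_def)
qed

lemma orb_transitive:
  assumes "X \<in> orb" "s \<in> X" "t \<in> X"
  obtains g where "g \<in> G" "t = g s"
proof -
  obtain x h k where x: "x \<in> S" "h \<in> G" "s = h x" "k \<in> G" "t = k x"
    using assms by (auto simp: orb_eq)
  obtain h' where h': "h' \<in> G" "\<And>s. s \<in> S \<Longrightarrow> h' (h s) = s"
    using G_inverse_apply[OF x(2)] by metis
  have "compose S k h' \<in> G" using x(4) h'(1) by (rule G_comp)
  moreover have "t = compose S k h' s"
    using x h' by (simp add: compose_def)
  ultimately show ?thesis using that by blast
qed

lemma orb_of_element: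
  assumes "s \<in> S"
  obtains X where "X \<in> orb" "s \<in> X"
proof
  show "{g s | g. g \<in> G} \<in> orb" using assms by (auto simp: orb_eq)
  show "s \<in> {g s | g. g \<in> G}"
    using G_one assms by (auto intro!: exI[of _ "\<lambda>s\<in>S. s"])
qed

lemma orb_disjoint: "\<lbrakk>X \<in> orb; Y \<in> orb; X \<noteq> Y\<rbrakk> \<Longrightarrow> X \<inter> Y = {}"
proof (rule ccontr)
  assume X: "X \<in> orb" and Y: "Y \<in> orb" and ne: "X \<noteq> Y" and "X \<inter> Y \<noteq> {}"
  then obtain s where s: "s \<in> X" "s \<in> Y" by auto
  have "t \<in> Y" if "t \<in> X" for t
    using orb_transitive[OF X s(1) that] orb_closed[OF Y _ s(2)] by metis
  moreover have "t \<in> X" if "t \<in> Y" for t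
    using orb_transitive[OF Y s(2) that] orb_closed[OF X _ s(1)] by metis
  ultimately show False using ne by blast
qed

lemma orb_bij_betw:
  assumes "X \<in> orb" "g \<in> G"
  shows "bij_betw g X X"
proof -
  have "inj_on g X" using G_bij_betw[OF assms(2)] orb_subset[OF assms(1)]
    by (meson bij_betw_def inj_on_subset)
  moreover have "g ` X \<subseteq> X" using orb_closed[OF assms] by auto
  ultimately show ?thesis
    using endo_inj_surj[OF orb_finite[OF assms(1)]] by (simp add: bij_betw_def)
qed

lemma fin_orb_orb: "X \<in> fin_orb \<Longrightarrow> X \<in> orb"
  by (simp add: finite_orbits_def)

lemma fin_orb_finite: "X \<in> fin_orb \<Longrightarrow> finite (parabolic W \<iota> X)"
  by (simp add: finite_orbits_def)

lemma fin_orbI: "\<lbrakk>X \<in> orb; finite (parabolic W \<iota> X)\<rbrakk> \<Longrightarrow> X \<in> fin_orb"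
  by (simp add: finite_orbits_def)

lemma VG_V: "x \<in> VG \<Longrightarrow> x \<in> V"
  by (simp add: fixed_space_def)

lemma VG_fixed: "\<lbrakk>x \<in> VG; g \<in> G\<rbrakk> \<Longrightarrow> \<rho> g x = x"
  by (simp add: fixed_space_def)

lemma subspace_VG: "subspace VG"
  by (rule subspaceI) (auto simp: fixed_space_def \<rho>_add \<rho>_scale \<rho>_zero)

lemma root_sum_V: "X \<subseteq> S \<Longrightarrow> root_sum X \<in> V"
  unfolding root_sum_def by (intro V_sum) auto

lemma root_sum_cone: "X \<subseteq> S \<Longrightarrow> root_sum X \<in> nonneg_span \<epsilon> X"
  unfolding root_sum_def using finite_subset[OF _ finite_S]
  by (intro nonneg_span_sum nonneg_span_base)

lemma \<rho>_root_sum: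
  assumes "X \<in> orb" "g \<in> G"
  shows "\<rho> g (root_sum X) = root_sum X"
proof -
  have "\<rho> g (root_sum X) = (\<Sum>s\<in>X. \<rho> g (\<epsilon> s))"
    unfolding root_sum_def using orb_subset[OF assms(1)] by (intro \<rho>_sum assms) auto
  also have "\<dots> = (\<Sum>s\<in>X. \<epsilon> (g s))"
    using orb_subset[OF assms(1)] assms(2) by (intro sum.cong) (auto simp: \<rho>_root)
  also have "\<dots> = root_sum X"
    unfolding root_sum_def by (rule sum.reindex_bij_betw[OF orb_bij_betw[OF assms]])
  finally show ?thesis .
qed

lemma root_sum_VG: "X \<in> orb \<Longrightarrow> root_sum X \<in> VG"
  using root_sum_V[OF orb_subset] by (simp add: fixed_space_def \<rho>_root_sum)

lemma B_orbit_const: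
  assumes "x \<in> VG" "X \<in> orb" "s \<in> X" "t \<in> X"
  shows "B x (\<epsilon> s) = B x (\<epsilon> t)"
proof -
  obtain g where g: "g \<in> G" "t = g s" using orb_transitive[OF assms(2-4)] .
  have s: "s \<in> S" using assms orb_subset by blast
  show ?thesis
    using \<rho>_invariant[OF g(1) VG_V[OF assms(1)] root_in_V[OF s]] g s
    by (simp add: \<rho>_root VG_fixed[OF assms(1)])
qed

lemma \<rho>_cone:
  assumes "x \<in> nonneg_span \<epsilon> X" "X \<subseteq> S" "g \<in> G" "\<And>s. s \<in> X \<Longrightarrow> g s \<in> X"
  shows "\<rho> g x \<in> nonneg_span \<epsilon> X"
proof (rule linear_nonneg_span[OF \<rho>_linear[OF assms(3)] subspace_V _ assms(1)])
  show "\<rho> g (\<epsilon> s) \<in> nonneg_span \<epsilon> X" if "s \<in> X" for s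
    using that assms(2-4) finite_subset[OF assms(2) finite_S]
    by (simp add: \<rho>_root nonneg_span_base subset_iff)
qed (use assms(2) in auto)

text \<open>Averaging over \<open>G\<close>: all orbit sums of the roots of one orbit are the same multiple of its root sum.\<close>

lemma fixed_in_span:
  assumes X: "X \<in> orb" and y: "y \<in> VG" "y = (\<Sum>s\<in>X. c s *\<^sub>R \<epsilon> s)"
  shows "\<exists>k. y = k *\<^sub>R root_sum X"
proof -
  define A where "A s = (\<Sum>g\<in>G. \<epsilon> (g s))" for s
  have XS: "X \<subseteq> S" by (rule orb_subset[OF X])
  obtain r where r: "r \<in> X" using orb_nonempty[OF X] by blast
  have A_const: "A s = A r" if sX: "s \<in> X" for s
  proof -
    obtain h where h: "h \<in> G" "s = h r" using orb_transitive[OF X r sX] .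
    obtain h' where h': "h' \<in> G" "compose S h' h = (\<lambda>s\<in>S. s)" "compose S h h' = (\<lambda>s\<in>S. s)"
      using G_inverse[OF h(1)] .
    \<comment> \<open>Right translation by \<open>h\<close> permutes the group and turns the orbit
      sum at \<open>r\<close> into the one at \<open>s = h r\<close>.\<close>
    have bij: "bij_betw (\<lambda>g. compose S g h) G G"
    proof (rule bij_betw_byWitness[where f' = "\<lambda>g. compose S g h'"])
      have "compose S (compose S g a) b = g"
        if "g \<in> G" "a \<in> G" "b \<in> G" "compose S a b = (\<lambda>s\<in>S. s)" for g a b
      proof (rule extensionalityI)
        show "g \<in> extensional S" using G_Bij[OF that(1)] by (rule Bij_imp_extensional)
        fix x assume x: "x \<in> S"
        then have "a (b x) = x" using fun_cong[OF that(4), of x] by (simp add: compose_def)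
        then show "compose S (compose S g a) b x = g x"
          using x that(3) by (simp add: compose_def)
      qed simp
      then show "\<forall>g\<in>G. compose S (compose S g h) h' = g" "\<forall>g\<in>G. compose S (compose S g h') h = g"
        using h h' by auto
    qed (use h h' G_comp in auto)
    have "A s = (\<Sum>g\<in>G. \<epsilon> (compose S g h r))"
      unfolding A_def h(2) using r XS by (intro sum.cong) (auto simp: compose_def)
    also have "\<dots> = A r"
      unfolding A_def by (rule sum.reindex_bij_betw[OF bij])
    finally show ?thesis .
  qed
  \<comment> \<open>Summation over \<open>X\<close> and the group in both orders: each
    \<open>g\<close> permutes \<open>X\<close>, so every inner sum is
    \<open>root_sum X\<close>.\<close>
  have "real (card X) *\<^sub>R A r = (\<Sum>s\<in>X. A s)" using A_const by (simp add: sum_constant_scaleR)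
  also have "\<dots> = (\<Sum>g\<in>G. \<Sum>s\<in>X. \<epsilon> (g s))" unfolding A_def by (rule sum.swap)
  also have "\<dots> = (\<Sum>g\<in>G. root_sum X)"
    unfolding root_sum_def by (rule sum.cong[OF HOL.refl], rule sum.reindex_bij_betw[OF orb_bij_betw[OF X]])
  finally have Ar: "real (card X) *\<^sub>R A r = real (card G) *\<^sub>R root_sum X" by (simp add: sum_constant_scaleR)
  have cX: "real (card X) \<noteq> 0" using orb_finite[OF X] orb_nonempty[OF X] by simp
  have cG: "real (card G) \<noteq> 0" using finite_G G_one by auto
  \<comment> \<open>A fixed vector is its own average, and averaging turns each root of
    \<open>X\<close> into the same vector.\<close>
  have "real (card G) *\<^sub>R y = (\<Sum>g\<in>G. \<rho> g y)" using y(1) by (simp add: VG_fixed sum_constant_scaleR)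
  also have "\<dots> = (\<Sum>g\<in>G. \<Sum>s\<in>X. c s *\<^sub>R \<epsilon> (g s))"
  proof (rule sum.cong[OF HOL.refl])
    fix g assume g: "g \<in> G"
    have "\<rho> g y = (\<Sum>s\<in>X. \<rho> g (c s *\<^sub>R \<epsilon> s))"
      unfolding y(2) using XS by (intro \<rho>_sum g) auto
    also have "\<dots> = (\<Sum>s\<in>X. c s *\<^sub>R \<epsilon> (g s))"
      using XS g by (intro sum.cong) (auto simp: \<rho>_root \<rho>_scale)
    finally show "\<rho> g y = (\<Sum>s\<in>X. c s *\<^sub>R \<epsilon> (g s))" .
  qed
  also have "\<dots> = (\<Sum>s\<in>X. c s *\<^sub>R A s)"
    unfolding A_def scaleR_sum_right by (rule sum.swap)
  also have "\<dots> = (\<Sum>s\<in>X. c s) *\<^sub>R A r" by (simp add: A_const scaleR_sum_left)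
  finally have "(real (card X) * real (card G)) *\<^sub>R y = ((\<Sum>s\<in>X. c s) * real (card G)) *\<^sub>R root_sum X"
    using Ar by (metis mult.commute scaleR_scaleR)
  then have "(1 / (real (card X) * real (card G))) *\<^sub>R (real (card X) * real (card G)) *\<^sub>R y
      = (1 / (real (card X) * real (card G))) *\<^sub>R ((\<Sum>s\<in>X. c s) * real (card G)) *\<^sub>R root_sum X"
    by simp
  then have "y = (1 / (real (card X) * real (card G)) * ((\<Sum>s\<in>X. c s) * real (card G))) *\<^sub>R root_sum X"
    using cX cG by (simp only: scaleR_scaleR) simp
  then show ?thesis by blast
qed

end

section \<open>The fixed subgroup\<close>

context folding
begin

abbreviation act :: "('s \<Rightarrow> 's) \<Rightarrow> 'w \<Rightarrow> 'w" where
  "act \<equiv> induced_auto W S \<iota>"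

lemma gen_hom_unique:
  "\<lbrakk>\<alpha> \<in> hom W W; \<beta> \<in> hom W W; \<And>s. s \<in> S \<Longrightarrow> \<alpha> (\<iota> s) = \<beta> (\<iota> s); u \<in> carrier W\<rbrakk> \<Longrightarrow> \<alpha> u = \<beta> u"
  by (rule hom_eqI[OF is_group])

text \<open>\<open>induced_auto\<close> is a definite description. A symmetry respects the
  relations, so it extends to an endomorphism of \<open>W\<close>; the extension of the inverse
  symmetry inverts it. The presentation used is the one that \<open>coxeter_system\<close> derives
  in the locale.\<close>

lemma act_props:
  assumes g: "g \<in> G"
  shows "act g \<in> auto W" "\<And>s. s \<in> S \<Longrightarrow> act g (\<iota> s) = \<iota> (g s)"
proof -
  have ex: "\<exists>\<alpha> \<in> hom W W. \<forall>s\<in>S. \<alpha> (\<iota> s) = \<iota> (h s)" if "h \<in> G" for h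
    using that gen_rel
    by (intro coxeter_system_hom_exists[OF coxeter_system is_group]) (auto simp: G_m)
  obtain h where h: "h \<in> G" "\<And>s. s \<in> S \<Longrightarrow> h (g s) = s" "\<And>s. s \<in> S \<Longrightarrow> g (h s) = s"
    using G_inverse_apply[OF g] by blast
  obtain \<alpha> where \<alpha>: "\<alpha> \<in> hom W W" "\<And>s. s \<in> S \<Longrightarrow> \<alpha> (\<iota> s) = \<iota> (g s)"
    using ex[OF g] by blast
  obtain \<beta> where \<beta>: "\<beta> \<in> hom W W" "\<And>s. s \<in> S \<Longrightarrow> \<beta> (\<iota> s) = \<iota> (h s)"
    using ex[OF h(1)] by blast
  have idh: "(\<lambda>x. x) \<in> hom W W" by (simp add: hom_def)
  have "\<beta> (\<alpha> u) = u" if "u \<in> carrier W" for u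
    using gen_hom_unique[OF Group.hom_compose[OF \<alpha>(1) \<beta>(1)] idh _ that] \<alpha>(2) \<beta>(2) h g by simp
  moreover have "\<alpha> (\<beta> u) = u" if "u \<in> carrier W" for u
    using gen_hom_unique[OF Group.hom_compose[OF \<beta>(1) \<alpha>(1)] idh _ that] \<alpha>(2) \<beta>(2) h g by simp
  ultimately have bij: "bij_betw \<alpha> (carrier W) (carrier W)"
    using \<alpha>(1) \<beta>(1) by (intro bij_betw_byWitness[where f' = \<beta>]) (auto simp: hom_def)
  define \<alpha>' where "\<alpha>' = restrict \<alpha> (carrier W)"
  have "\<alpha>' \<in> Bij (carrier W)"
    using bij by (simp add: Bij_def \<alpha>'_def cong: bij_betw_cong)
  moreover have "\<alpha>' \<in> hom W W" using \<alpha>(1) by (auto simp: hom_def \<alpha>'_def)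
  ultimately have \<alpha>': "\<alpha>' \<in> auto W \<and> (\<forall>s\<in>S. \<alpha>' (\<iota> s) = \<iota> (g s))"
    using \<alpha>(2) by (simp add: auto_def \<alpha>'_def)
  have uniq: "\<gamma> = \<alpha>'" if \<gamma>: "\<gamma> \<in> auto W \<and> (\<forall>s\<in>S. \<gamma> (\<iota> s) = \<iota> (g s))" for \<gamma>
  proof (rule extensionalityI)
    show "\<gamma> \<in> extensional (carrier W)" "\<alpha>' \<in> extensional (carrier W)"
      using \<gamma> \<alpha>' by (auto simp: auto_def Bij_def)
    show "\<gamma> u = \<alpha>' u" if "u \<in> carrier W" for u
      by (rule gen_hom_unique[OF _ _ _ that]) (use \<gamma> \<alpha>' in \<open>simp_all add: auto_def\<close>)
  qed
  have "act g = \<alpha>'"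
    unfolding induced_auto_def by (rule the_equality, rule \<alpha>', rule uniq)
  then show "act g \<in> auto W" "\<And>s. s \<in> S \<Longrightarrow> act g (\<iota> s) = \<iota> (g s)"
    using \<alpha>' by auto
qed

lemma act_hom: "g \<in> G \<Longrightarrow> act g \<in> hom W W"
  using act_props(1) by (simp add: auto_def)

lemma act_closed: "\<lbrakk>g \<in> G; u \<in> carrier W\<rbrakk> \<Longrightarrow> act g u \<in> carrier W"
  using act_hom by (auto simp: hom_def)

lemma act_word_prod:
  assumes "g \<in> G" "set us \<subseteq> S"
  shows "act g (word_prod us) = word_prod (map g us)"
  using assms(2)
proof (induction us)
  case Nil
  then show ?case using hom_one[OF act_hom[OF assms(1)] is_group is_group] by simp
next
  case (Cons s us)
  then show ?case
    using hom_mult[OF act_hom[OF assms(1)], of "\<iota> s" "word_prod us"] assms(1)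
    by (simp add: act_props(2))
qed

lemma f_act:
  assumes g: "g \<in> G" and u: "u \<in> carrier W" and x: "x \<in> V"
  shows "f (act g u) (\<rho> g x) = \<rho> g (f u x)"
proof -
  have "f (word_prod (map g us)) (\<rho> g x) = \<rho> g (f (word_prod us) x)" if "set us \<subseteq> S" for us
    using that
  proof (induction us)
    case Nil
    then show ?case using g x by (simp add: f_one)
  next
    case (Cons s us)
    have s: "s \<in> S" "g s \<in> S" and us: "set us \<subseteq> S" "set (map g us) \<subseteq> S" using Cons.prems g by auto
    define y where "y = f (word_prod us) x"
    have y: "y \<in> V" using us x by (simp add: y_def)
    have "f (word_prod (map g (s # us))) (\<rho> g x) = f (\<iota> (g s)) (\<rho> g y)"
      using Cons.IH[OF us(1)] f_mult[OF gen_closed[OF s(2)] word_prod_closed[OF us(2)]] g x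
      by (simp add: y_def)
    also have "\<dots> = \<rho> g y - (2 * B (\<rho> g y) (\<rho> g (\<epsilon> s))) *\<^sub>R \<rho> g (\<epsilon> s)"
      using g y s by (simp add: f_gen \<rho>_root)
    also have "\<dots> = \<rho> g (f (\<iota> s) y)"
      using g y s(1) by (simp add: f_gen \<rho>_invariant \<rho>_diff \<rho>_scale)
    also have "f (\<iota> s) y = f (word_prod (s # us)) x"
      using s us x by (simp add: f_mult y_def)
    finally show ?case .
  qed
  then show ?thesis using word_prod_surj[OF u] act_word_prod[OF g] by metis
qed

lemma WG_carrier: "w \<in> WG \<Longrightarrow> w \<in> carrier W"
  by (simp add: fixed_subgroup_def)

lemma WG_commute: "\<lbrakk>w \<in> WG; g \<in> G; x \<in> V\<rbrakk> \<Longrightarrow> f w (\<rho> g x) = \<rho> g (f w x)"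
  using f_act[of g w x] by (simp add: fixed_subgroup_def)

text \<open>As \<open>f\<close> is injective and equivariant, being fixed by the group amounts to
  commuting with its action on \<open>V\<close>. Membership, and with it the subgroup axioms, can
  then be checked on vectors.\<close>

lemma WGI:
  assumes w: "w \<in> carrier W" and comm: "\<And>g x. \<lbrakk>g \<in> G; x \<in> V\<rbrakk> \<Longrightarrow> f w (\<rho> g x) = \<rho> g (f w x)"
  shows "w \<in> WG"
proof -
  have "act g w = w" if g: "g \<in> G" for g
  proof -
    obtain h where h: "h \<in> G" "\<And>x. x \<in> V \<Longrightarrow> \<rho> g (\<rho> h x) = x"
      using \<rho>_inverse[OF g] by blast
    have "f (act g w) = f w"
    proof (rule GL_eqI)
      show "f (act g w) \<in> carrier (GL V)" "f w \<in> carrier (GL V)"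
        using f_GL act_closed[OF g w] w by auto
      show "f (act g w) x = f w x" if "x \<in> V" for x
        using f_act[OF g w, of "\<rho> h x"] comm[OF g, of "\<rho> h x"] h that by simp
    qed
    then show ?thesis using f_inj act_closed[OF g w] w by (auto dest: inj_onD)
  qed
  then show ?thesis using w by (simp add: fixed_subgroup_def)
qed

lemma WG_subgroup: "subgroup WG W"
proof (rule subgroupI)
  show "WG \<subseteq> carrier W" using WG_carrier by blast
  have "\<one> \<in> WG" by (rule WGI) (simp_all add: f_one)
  then show "WG \<noteq> {}" by blast
next
  fix w assume w: "w \<in> WG"
  note wc = WG_carrier[OF w]
  show "inv w \<in> WG"
  proof (rule WGI)
    fix g x assume g: "g \<in> G" and x: "x \<in> V"
    define y where "y = f (inv w) x"
    have y: "y \<in> V" "f w y = x" using wc x by (simp_all add: y_def f_mult[symmetric] f_one)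
    have "f (inv w) (\<rho> g x) = f (inv w) (f w (\<rho> g y))"
      using WG_commute[OF w g y(1)] y by simp
    then show "f (inv w) (\<rho> g x) = \<rho> g (f (inv w) x)"
      using f_inv[OF wc, of "\<rho> g y"] g y(1) by (simp add: y_def)
  qed (use wc in simp)
next
  fix u w assume u: "u \<in> WG" and w: "w \<in> WG"
  show "u \<otimes> w \<in> WG"
    using WG_carrier[OF u] WG_carrier[OF w]
    by (intro WGI) (simp_all add: f_mult WG_commute[OF u] WG_commute[OF w])
qed

lemma WG_VG: "\<lbrakk>w \<in> WG; x \<in> VG\<rbrakk> \<Longrightarrow> f w x \<in> VG"
  using WG_commute[of w _ x] WG_carrier[of w] by (auto simp: fixed_space_def)

text \<open>A symmetry maps the orbit and its cone to themselves, so the image of the longest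
  element passes the same sign test and is the longest element again.\<close>

lemma longest_WG:
  assumes X: "X \<in> fin_orb"
  shows "longest X \<in> WG"
proof -
  note XS = orb_subset[OF fin_orb_orb[OF X]]
  note v = longest_element_props[OF XS fin_orb_finite[OF X]]
  have vc: "longest X \<in> carrier W" using parabolic_carrier[OF XS] v(1) by blast
  have "act g (longest X) = longest X" if g: "g \<in> G" for g
  proof -
    note gX = orb_closed[OF fin_orb_orb[OF X] g]
    obtain us where us: "set us \<subseteq> X" "longest X = word_prod us"
      using v(1) parabolic_word_prod[OF XS] by auto
    then have "act g (longest X) = word_prod (map g us)" using g XS by (simp add: act_word_prod)
    moreover have "set (map g us) \<subseteq> X" using us(1) gX by auto
    ultimately have 1: "act g (longest X) \<in> parabolic W \<iota> X" using parabolic_word_prod[OF XS] by blast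
    have 2: "- f (act g (longest X)) (\<epsilon> t) \<in> nonneg_span \<epsilon> X" if t: "t \<in> X" for t
    proof -
      obtain s where s: "s \<in> X" "t = g s"
        using orb_bij_betw[OF fin_orb_orb[OF X] g] t by (auto simp: bij_betw_def)
      then have sS: "s \<in> S" using XS by blast
      have "- f (act g (longest X)) (\<epsilon> t) = \<rho> g (- f (longest X) (\<epsilon> s))"
        using f_act[OF g vc root_in_V[OF sS]] g s(2) sS vc by (simp add: \<rho>_root \<rho>_minus)
      then show ?thesis using \<rho>_cone[OF v(3)[OF s(1)] XS g gX] by simp
    qed
    from parabolic_longest(2)[OF XS 1 2] show ?thesis by simp
  qed
  then show ?thesis using vc by (simp add: fixed_subgroup_def)
qed

lemma orbit_negative:
  assumes w: "w \<in> WG" and X: "X \<in> orb" and s: "s \<in> X" "- f w (\<epsilon> s) \<in> cone" and t: "t \<in> X"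
  shows "- f w (\<epsilon> t) \<in> cone"
proof -
  obtain g where g: "g \<in> G" "t = g s" using orb_transitive[OF X s(1) t] .
  have sS: "s \<in> S" using orb_subset[OF X] s(1) by blast
  note wc = WG_carrier[OF w]
  have "- f w (\<epsilon> t) = \<rho> g (- f w (\<epsilon> s))"
    using WG_commute[OF w g(1) root_in_V[OF sS]] g sS wc by (simp add: \<rho>_root \<rho>_minus)
  then show ?thesis using \<rho>_cone[OF s(2) subset_refl g(1)] g(1) by simp
qed

lemma orbit_descents:
  assumes w: "w \<in> WG" "w \<noteq> \<one>"
  obtains X where "X \<in> orb" "\<And>t. t \<in> X \<Longrightarrow> - f w (\<epsilon> t) \<in> cone"
proof -
  note wc = WG_carrier[OF w(1)]
  obtain s where s: "s \<in> S" "len (w \<otimes> \<iota> s) + 1 = len w"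
    using descent_exists[OF wc w(2)] .
  then have neg: "- f w (\<epsilon> s) \<in> cone" by (intro f_root_neg wc) auto
  obtain X where X: "X \<in> orb" "s \<in> X" using orb_of_element[OF s(1)] .
  show ?thesis by (rule that[OF X(1) orbit_negative[OF w(1) X neg]])
qed

text \<open>A nontrivial fixed element has a whole orbit of descents, so it sends the root sum of
  this orbit into the negative cone. That root sum lies in the fixed space and is visibly
  moved.\<close>

lemma WG_faithful:
  assumes w: "w \<in> WG" and id: "\<And>x. x \<in> VG \<Longrightarrow> f w x = x"
  shows "w = \<one>"
proof (rule ccontr)
  assume "w \<noteq> \<one>"
  then obtain X where X: "X \<in> orb" "\<And>t. t \<in> X \<Longrightarrow> - f w (\<epsilon> t) \<in> cone"
    using orbit_descents[OF w] by blast
  note XS = orb_subset[OF X(1)]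
  have "- f w (root_sum X) \<in> cone"
    by (rule f_neg_cone[OF WG_carrier[OF w] root_sum_cone[OF XS] XS X(2)])
  then have "- root_sum X \<in> cone" using id[OF root_sum_VG[OF X(1)]] by simp
  moreover have "root_sum X \<in> cone" by (rule nonneg_span_mono[OF XS finite_S root_sum_cone[OF XS]])
  ultimately have "root_sum X = 0" by (intro cone_proper)
  then show False using sum_roots_nonzero[OF XS orb_nonempty[OF X(1)]] by (simp add: root_sum_def)
qed

text \<open>
  If every element of \<open>X\<close> is a descent of \<open>w\<close>, the part of \<open>w\<close> in \<open>W_X\<close> sends all simple roots of
  \<open>X\<close> to negative ones, so \<open>W_X\<close> is finite and this part is its longest element.
\<close>

lemma descents_factor:
  assumes w: "w \<in> carrier W" and X: "X \<subseteq> S" "X \<noteq> {}" "\<And>t. t \<in> X \<Longrightarrow> - f w (\<epsilon> t) \<in> cone"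
  shows "finite (parabolic W \<iota> X) \<and> len (w \<otimes> longest X) < len w"
proof -
  define Q where "Q k \<longleftrightarrow> (\<exists>u us. u \<in> carrier W \<and> set us \<subseteq> X \<and> w = u \<otimes> word_prod us \<and>
    len u + length us = len w \<and> length us = k)" for k
  have "Q 0" unfolding Q_def using w by (intro exI[of _ w] exI[of _ "[]"]) simp
  moreover have "\<forall>k. Q k \<longrightarrow> k \<le> len w" by (auto simp: Q_def)
  ultimately obtain k where k: "Q k" "\<And>j. Q j \<Longrightarrow> j \<le> k"
    using Greatest_le_nat[of Q] GreatestI_nat[of Q] by metis
  obtain u us where u: "u \<in> carrier W" "set us \<subseteq> X" "w = u \<otimes> word_prod us"
    "len u + length us = len w" "length us = k"
    using k(1) by (auto simp: Q_def)
  have usS: "set us \<subseteq> S" using u(2) X(1) by blast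
  define v where "v = word_prod us"
  have vX: "v \<in> parabolic W \<iota> X" unfolding v_def using u(2) parabolic_word_prod[OF X(1)] by blast
  have vc: "v \<in> carrier W" using usS by (simp add: v_def)
  \<comment> \<open>A descent of \<open>u\<close> in \<open>X\<close> could be moved into the
    right-hand factor, against the maximality of \<open>k\<close>.\<close>
  have upos: "f u (\<epsilon> t) \<in> cone" if t: "t \<in> X" for t
  proof (rule f_root_pos[OF u(1)])
    show tS: "t \<in> S" using t X(1) by blast
    show "len u \<le> len (u \<otimes> \<iota> t)"
    proof (rule ccontr)
      assume *: "\<not> len u \<le> len (u \<otimes> \<iota> t)"
      have "Q (Suc k)"
        unfolding Q_def
      proof (intro exI conjI)
        show "u \<otimes> \<iota> t \<in> carrier W" using u(1) tS by simp
        show "set (t # us) \<subseteq> X" using t u(2) by simp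
        show "w = u \<otimes> \<iota> t \<otimes> word_prod (t # us)"
          using u(1,3) usS tS by (simp add: m_assoc)
        show "len (u \<otimes> \<iota> t) + length (t # us) = len w"
          using u(4) * le_len_gen[OF u(1) tS] by simp
        show "length (t # us) = Suc k" using u(5) by simp
      qed
      then show False using k(2) by force
    qed
  qed
  interpret X: reflection_rep "W\<lparr>carrier := parabolic W \<iota> X\<rparr>" X m \<iota> V B \<epsilon> f
    by (rule parabolic_rep[OF X(1)])
  \<comment> \<open>Inside the parabolic subgroup a root is positive or negative over
    \<open>X\<close>. A positive image under \<open>v\<close> would stay positive under
    \<open>u\<close>, although \<open>w = u \<otimes> v\<close> makes the root negative.\<close>
  have vneg: "- f v (\<epsilon> t) \<in> nonneg_span \<epsilon> X" if t: "t \<in> X" for t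
  proof (rule ccontr)
    have tS: "t \<in> S" using t X(1) by blast
    assume "\<not> ?thesis"
    then have "f v (\<epsilon> t) \<in> nonneg_span \<epsilon> X" using X.f_root_dichotomy[of v t] vX t by auto
    then have "f u (f v (\<epsilon> t)) \<in> cone" by (rule f_cone[OF u(1) _ X(1) upos])
    then have "f w (\<epsilon> t) \<in> cone" using u(1,3) vc tS by (simp add: f_mult v_def)
    then show False using f_root_not_both[OF w tS _ X(3)[OF t]] by simp
  qed
  note L = parabolic_longest[OF X(1) vX vneg]
  have "w \<otimes> v = u" using L(3) u(1,3) vc by (simp add: m_assoc v_def)
  \<comment> \<open>The length drops by exactly \<open>k\<close> when \<open>longest X\<close> is
    split off, so \<open>k\<close> must be positive for a strict decrease.\<close>
  moreover have "k \<noteq> 0"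
  proof
    assume "k = 0"
    then have "v = \<one>" using u(5) by (simp add: v_def)
    moreover obtain t where t: "t \<in> X" using X(2) by blast
    ultimately have "- \<epsilon> t \<in> nonneg_span \<epsilon> X" using vneg[of t] X(1) by (simp add: f_one subset_iff)
    moreover have "\<epsilon> t \<in> nonneg_span \<epsilon> X" by (rule nonneg_span_base[OF X.finite_S t])
    ultimately have "\<epsilon> t = 0" by (intro X.cone_proper)
    then show False using X.root_nonzero[OF t] by simp
  qed
  ultimately show ?thesis using L u(4,5) by simp
qed

lemma WG_generated:
  assumes "w \<in> WG"
  shows "w \<in> generate W (longest ` fin_orb)"
  using assms
proof (induction "len w" arbitrary: w rule: less_induct)
  case less
  show ?case
  proof (cases "w = \<one>")
    case True
    then show ?thesis by (simp add: generate.one)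
  next
    case False
    obtain X where X: "X \<in> orb" "\<And>t. t \<in> X \<Longrightarrow> - f w (\<epsilon> t) \<in> cone"
      using orbit_descents[OF less.prems False] by blast
    note XS = orb_subset[OF X(1)]
    note wc = WG_carrier[OF less.prems]
    have fin: "finite (parabolic W \<iota> X)" and lt: "len (w \<otimes> longest X) < len w"
      using descents_factor[OF wc XS orb_nonempty[OF X(1)] X(2)] by auto
    have XF: "X \<in> fin_orb" by (rule fin_orbI[OF X(1) fin])
    have v: "longest X \<in> WG" by (rule longest_WG[OF XF])
    have "w \<otimes> longest X \<in> generate W (longest ` fin_orb)"
      using less.hyps[OF lt] subgroup.m_closed[OF WG_subgroup less.prems v] by simp
    then have "w \<otimes> longest X \<otimes> longest X \<in> generate W (longest ` fin_orb)"
      by (rule generate.eng) (use XF in \<open>auto intro: generate.incl\<close>)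
    moreover have "w \<otimes> longest X \<otimes> longest X = w"
      using longest_element_props(2)[OF XS fin] wc WG_carrier[OF v] by (simp add: m_assoc)
    ultimately show ?thesis by simp
  qed
qed

lemma generate_longest: "generate W (longest ` fin_orb) = WG"
  using WG_generated generate_subgroup_incl[OF _ WG_subgroup, of "longest ` fin_orb"] longest_WG
  by blast

text \<open>Finiteness of the parabolic subgroup gives one root with a positive value, and
  invariance spreads it over the orbit. This makes root sums of finite orbits normalizable and the
  denominators below positive.\<close>

lemma B_root_sum_pos:
  assumes X: "X \<in> fin_orb" and s: "s \<in> X"
  shows "0 < B (root_sum X) (\<epsilon> s)"
proof -
  note Xo = fin_orb_orb[OF X]
  obtain t where t: "t \<in> X" "0 < B (root_sum X) (\<epsilon> t)"
    using parabolic_sum_roots_pos[OF orb_subset[OF Xo] orb_nonempty[OF Xo] fin_orb_finite[OF X]]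
    by (auto simp: root_sum_def)
  then show ?thesis using B_orbit_const[OF root_sum_VG[OF Xo] Xo s t(1)] by simp
qed

lemma B_VG_root_sum:
  assumes "x \<in> VG" "X \<in> orb" "s \<in> X"
  shows "B x (root_sum X) = real (card X) * B x (\<epsilon> s)"
proof -
  have "B x (root_sum X) = (\<Sum>t\<in>X. B x (\<epsilon> t))"
    unfolding root_sum_def using orb_subset[OF assms(2)] by (intro B_sum_right VG_V[OF assms(1)]) auto
  also have "\<dots> = (\<Sum>t\<in>X. B x (\<epsilon> s))"
    by (rule sum.cong[OF HOL.refl B_orbit_const[OF assms(1,2)]]) (use assms in auto)
  finally show ?thesis by simp
qed

lemma root_sum_norm_pos:
  assumes X: "X \<in> fin_orb"
  shows "0 < B (root_sum X) (root_sum X)"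
proof -
  note Xo = fin_orb_orb[OF X]
  obtain s where s: "s \<in> X" using orb_nonempty[OF Xo] by blast
  have "0 < card X" using orb_finite[OF Xo] orb_nonempty[OF Xo] by (simp add: card_gt_0_iff)
  then show ?thesis
    using B_VG_root_sum[OF root_sum_VG[OF Xo] Xo s] B_root_sum_pos[OF X s] by simp
qed

lemma folded_root_eq:
  "folded_root B \<epsilon> X = (1 / sqrt (B (root_sum X) (root_sum X))) *\<^sub>R root_sum X"
  by (simp add: folded_root_def Let_def root_sum_def)

lemma folded_root_VG: "X \<in> orb \<Longrightarrow> folded_root B \<epsilon> X \<in> VG"
  unfolding folded_root_eq by (intro subspace_scale[OF subspace_VG] root_sum_VG)

lemma folded_root_norm:
  assumes "X \<in> fin_orb"
  shows "folded_form X X = 1"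
  unfolding folded_root_eq using root_sum_norm_pos[OF assms] root_sum_V[OF orb_subset[OF fin_orb_orb[OF assms]]]
  by (simp add: B_scale_left B_scale_right)

lemma longest_reflection:
  assumes X: "X \<in> fin_orb" and x: "x \<in> VG"
  shows "f (longest X) x = x - (2 * B x (folded_root B \<epsilon> X)) *\<^sub>R folded_root B \<epsilon> X"
proof -
  note Xo = fin_orb_orb[OF X]
  note XS = orb_subset[OF Xo]
  define a where "a = root_sum X"
  define v where "v = longest X"
  have aG: "a \<in> VG" and aV: "a \<in> V" and acone: "a \<in> nonneg_span \<epsilon> X"
    using root_sum_VG[OF Xo] VG_V root_sum_cone[OF XS] by (auto simp: a_def)
  have apos: "0 < B a a" using root_sum_norm_pos[OF X] by (simp add: a_def)
  note props = longest_element_props[OF XS fin_orb_finite[OF X], folded v_def]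
  have vG: "v \<in> WG" using longest_WG[OF X] by (simp add: v_def)
  note vc = WG_carrier[OF vG]
  have diff: "\<exists>k. f v y = y + k *\<^sub>R a" if y: "y \<in> VG" for y
  proof -
    obtain c where c: "f v y = y + (\<Sum>s\<in>X. c s *\<^sub>R \<epsilon> s)"
      using parabolic_f_diff[OF XS props(1) VG_V[OF y]] by blast
    then have "f v y - y = (\<Sum>s\<in>X. c s *\<^sub>R \<epsilon> s)" by simp
    moreover have "f v y - y \<in> VG" using WG_VG[OF vG y] y by (rule subspace_diff[OF subspace_VG])
    ultimately obtain k where "f v y - y = k *\<^sub>R a"
      unfolding a_def using fixed_in_span[OF Xo] by blast
    then show ?thesis by (metis add.commute diff_add_cancel)
  qed
  obtain k where "f v a = a + k *\<^sub>R a" using diff[OF aG] by blast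
  then have k: "f v a = (1 + k) *\<^sub>R a" by (simp add: scaleR_left_distrib)
  have "(1 + k)\<^sup>2 * B a a = B (f v a) (f v a)"
    unfolding k using aV by (simp add: B_scale_left B_scale_right power2_eq_square)
  also have "\<dots> = B a a" by (rule f_invariant[OF vc aV aV])
  finally have "(1 + k)\<^sup>2 = 1" using apos by simp
  \<comment> \<open>Invariance of the form leaves 1 and -1 as eigenvalues on \<open>a\<close>. The
    value 1 would keep \<open>a\<close> in the cone, although \<open>v\<close> makes all roots of
    \<open>X\<close> negative.\<close>
  moreover have "1 + k \<noteq> 1"
  proof
    assume "1 + k = 1"
    then have fa: "f v a = a" using k by simp
    have "- f v a \<in> nonneg_span \<epsilon> X" by (rule f_neg_cone[OF vc acone XS props(3)])
    then have "- a \<in> nonneg_span \<epsilon> X" using fa by simp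
    then have "a = 0" using nonneg_span_mono[OF XS finite_S] acone by (intro cone_proper) auto
    then show False using sum_roots_nonzero[OF XS orb_nonempty[OF Xo]] by (simp add: a_def root_sum_def)
  qed
  ultimately have "1 + k = - 1" unfolding power2_eq_1_iff by blast
  then have "f v a = - a" unfolding k by (simp only: scaleR_minus_left scaleR_one)
  obtain l where l: "f v x = x + l *\<^sub>R a" using diff[OF x] by blast
  \<comment> \<open>Pairing with \<open>a\<close> and using invariance once more determines the
    coefficient \<open>l\<close>.\<close>
  have "B x a = B (f v x) (f v a)" using f_invariant[OF vc VG_V[OF x] aV] by simp
  also have "\<dots> = - B x a - l * B a a"
    unfolding l \<open>f v a = - a\<close>
    using VG_V[OF x] aV B_scale_right[of "x + l *\<^sub>R a" a "-1"] by (simp add: B_simps)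
  finally have "l = - (2 * B x a / B a a)" using apos by (simp add: field_simps)
  then have "f v x = x - (2 * B x a / B a a) *\<^sub>R a" using l by simp
  moreover have "(2 * B x (folded_root B \<epsilon> X)) *\<^sub>R folded_root B \<epsilon> X = (2 * B x a / B a a) *\<^sub>R a"
    unfolding folded_root_eq a_def[symmetric] using apos VG_V[OF x] aV
    by (simp add: B_scale_right)
  ultimately show ?thesis by (simp add: v_def)
qed

end

section \<open>Bi-orbits\<close>

lemma cos_pi_8_squared: "(cos (pi / 8))\<^sup>2 = (2 + sqrt 2) / 4"
proof -
  have "cos (pi / 4) = 2 * (cos (pi / 8))\<^sup>2 - 1"
    using cos_double_cos[of "pi / 8"] by simp
  then show ?thesis by (simp add: cos_45 field_simps)
qed

text \<open>The bound that later excludes labels of 5 and more inside an orbit. Comparing cos(3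
  pi/5) with - cos(2 pi/5) gives a cubic for c = cos(pi/5) with factor c + 1; the other factor 4 c^2
  - 2 c - 1 is incompatible with 0 < c \<le> 3/4.\<close>

lemma cos_pi_5_gt: "3 / 4 < cos (pi / 5)"
proof (rule ccontr)
  define c where "c = cos (pi / 5)"
  assume "\<not> ?thesis"
  then have c: "c \<le> 3 / 4" by (simp add: c_def)
  have pos: "0 < c" unfolding c_def by (intro cos_gt_zero) auto
  have "cos (3 * (pi / 5)) = - cos (2 * (pi / 5))"
    using cos_pi_minus[of "2 * (pi / 5)"] by (simp add: field_simps)
  then have "4 * c ^ 3 - 3 * c = 1 - 2 * c\<^sup>2"
    using cos_treble_cos[of "pi / 5"] cos_double_cos[of "pi / 5"] by (simp add: c_def)
  then have "(c + 1) * (4 * c\<^sup>2 - 2 * c - 1) = 0"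
    by (simp add: algebra_simps power2_eq_square power3_eq_cube)
  then have "4 * c\<^sup>2 = 2 * c + 1" using pos by auto
  moreover have "c * c \<le> 3 / 4 * c" using c pos by (intro mult_right_mono) auto
  ultimately show False using c pos by (simp add: power2_eq_square)
qed

text \<open>Stated through sets closed under adjacency, the form in which connectedness is used.\<close>

definition bigraph_connected :: "bigraph \<Rightarrow> bool" where
  "bigraph_connected E \<longleftrightarrow> (\<forall>A. A \<subseteq> bigraph_vertices E \<longrightarrow> A \<noteq> {} \<longrightarrow>
    (\<forall>a\<in>A. \<forall>b\<in>bigraph_vertices E. bigraph_matrix E a b \<noteq> 2 \<longrightarrow> b \<in> A) \<longrightarrow>
    A = bigraph_vertices E)"

context folding
begin

lemma m_sym: "\<lbrakk>s \<in> S; t \<in> S\<rbrakk> \<Longrightarrow> m s t = m t s"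
  using coxeter_matrix by (cases "s = t") (auto simp: coxeter_matrix_def)

lemma m_same: "s \<in> S \<Longrightarrow> m s s = 1"
  using coxeter_matrix by (auto simp: coxeter_matrix_def)

lemma B_m_finite:
  assumes "s \<in> S" "t \<in> S" "m s t = enat n" "2 \<le> n"
  shows "B (\<epsilon> s) (\<epsilon> t) = - cos (pi / real n)"
proof -
  have "s \<noteq> t" using assms m_same[of s] by (auto simp: one_enat_def)
  then show ?thesis using root_finite assms by simp
qed

lemma B_m2: "\<lbrakk>s \<in> S; t \<in> S; m s t = 2\<rbrakk> \<Longrightarrow> B (\<epsilon> s) (\<epsilon> t) = 0"
  using B_m_finite[of s t 2] by (simp add: numeral_eq_enat)

lemma B_m3: "\<lbrakk>s \<in> S; t \<in> S; m s t = 3\<rbrakk> \<Longrightarrow> B (\<epsilon> s) (\<epsilon> t) = - 1 / 2"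
  using B_m_finite[of s t 3] by (simp add: numeral_eq_enat cos_60)

lemma B_m4: "\<lbrakk>s \<in> S; t \<in> S; m s t = 4\<rbrakk> \<Longrightarrow> B (\<epsilon> s) (\<epsilon> t) = - sqrt 2 / 2"
  using B_m_finite[of s t 4] by (simp add: numeral_eq_enat cos_45)

text \<open>Larger labels only push the form further down, and at \<infinity> it is at most -1. One
  inequality thus excludes all labels from some point on.\<close>

lemma B_m_ge:
  assumes st: "s \<in> S" "t \<in> S" "enat n \<le> m s t" and n: "2 \<le> n"
  shows "B (\<epsilon> s) (\<epsilon> t) \<le> - cos (pi / real n)"
proof (cases "m s t")
  case (enat k)
  then have k: "n \<le> k" using st(3) by simp
  have "B (\<epsilon> s) (\<epsilon> t) = - cos (pi / real k)"
    using B_m_finite[OF st(1,2) enat] k n by simp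
  moreover have "cos (pi / real n) \<le> cos (pi / real k)"
    using k n by (intro cos_monotone_0_pi_le) (auto simp: field_simps)
  ultimately show ?thesis by simp
next
  case infinity
  then have "s \<noteq> t" using m_same[OF st(1)] by auto
  then show ?thesis using root_infinite[OF st(1,2) _ infinity]
    by (smt (verit) cos_le_one)
qed

lemma B_offdiag:
  assumes "s \<in> S" "t \<in> S" "s \<noteq> t"
  shows "B (\<epsilon> s) (\<epsilon> t) \<le> 0"
  using B_m_ge[OF assms(1,2), of 2] m_ge_2[OF assms] by (simp add: numeral_eq_enat)

lemma B_root_sum_other:
  assumes "X \<in> orb" "Y \<in> orb" "X \<noteq> Y" "s \<in> X"
  shows "B (root_sum Y) (\<epsilon> s) \<le> 0"
proof -
  have s: "s \<in> S" "s \<notin> Y" using orb_subset[OF assms(1)] orb_disjoint[OF assms(1-3)] assms(4) by auto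
  have "B (root_sum Y) (\<epsilon> s) = (\<Sum>t\<in>Y. B (\<epsilon> t) (\<epsilon> s))"
    unfolding root_sum_def using s orb_subset[OF assms(2)] by (intro B_sum_left) auto
  also have "\<dots> \<le> 0" using s orb_subset[OF assms(2)] by (intro sum_nonpos B_offdiag) auto
  finally show ?thesis .
qed

text \<open>Pairing a fixed vector with a root sum gives the orbit size times the value at any
  single root. So the norms and the mixed product reduce to values at \<open>s\<close> and
  \<open>t\<close>, and the minus sign comes from the nonpositive mixed value.\<close>

lemma B_folded_roots:
  assumes X: "X \<in> fin_orb" and Y: "Y \<in> fin_orb" and ne: "X \<noteq> Y" and s: "s \<in> X" and t: "t \<in> Y"
  shows "folded_form X Y =
    - sqrt (B (root_sum Y) (\<epsilon> s) * B (root_sum X) (\<epsilon> t)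
      / (B (root_sum X) (\<epsilon> s) * B (root_sum Y) (\<epsilon> t)))"
proof -
  note Xo = fin_orb_orb[OF X] and Yo = fin_orb_orb[OF Y]
  have neg: "B (root_sum Y) (\<epsilon> s) \<le> 0" by (rule B_root_sum_other[OF Xo Yo ne s])
  define x y where "x = real (card X)" and "y = real (card Y)"
  have xy: "0 < x" "0 < y"
    using orb_finite[OF Xo] orb_nonempty[OF Xo] orb_finite[OF Yo] orb_nonempty[OF Yo]
    by (auto simp: x_def y_def card_gt_0_iff)
  define p q where "p = B (root_sum Y) (\<epsilon> s)" and "q = B (root_sum X) (\<epsilon> t)"
  define k l where "k = B (root_sum X) (\<epsilon> s)" and "l = B (root_sum Y) (\<epsilon> t)"
  have kl: "0 < k" "0 < l" using B_root_sum_pos[OF X s] B_root_sum_pos[OF Y t] by (auto simp: k_def l_def)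
  have V: "root_sum X \<in> V" "root_sum Y \<in> V" using root_sum_V orb_subset Xo Yo by auto
  have XX: "B (root_sum X) (root_sum X) = x * k" and YY: "B (root_sum Y) (root_sum Y) = y * l"
    using B_VG_root_sum[OF root_sum_VG[OF Xo] Xo s] B_VG_root_sum[OF root_sum_VG[OF Yo] Yo t]
    by (simp_all add: x_def y_def k_def l_def)
  have XY: "B (root_sum X) (root_sum Y) = x * p" "B (root_sum X) (root_sum Y) = y * q"
    using B_VG_root_sum[OF root_sum_VG[OF Yo] Xo s] B_VG_root_sum[OF root_sum_VG[OF Xo] Yo t]
      B_sym[OF V] by (simp_all add: x_def y_def p_def q_def)
  have "folded_form X Y = x * p / sqrt ((x * k) * (y * l))"
    unfolding folded_root_eq XX YY using V
    by (simp add: B_scale_left B_scale_right XY(1) real_sqrt_mult)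
  moreover have "x * p / sqrt ((x * k) * (y * l)) = - sqrt (p * q / (k * l))"
  proof -
    \<comment> \<open>The mixed product is \<open>x * p\<close> and also \<open>y * q\<close>;
      taking one factor of each kind makes the orbit sizes cancel against those in the
      norms.\<close>
    have "(x * p)\<^sup>2 = (x * y) * (p * q)" using XY by (simp add: power2_eq_square)
    then have "(x * p)\<^sup>2 / ((x * k) * (y * l)) = p * q / (k * l)"
      using xy kl by (simp add: field_simps)
    moreover have "sqrt ((x * p)\<^sup>2) = - (x * p)"
      using xy neg by (simp add: p_def mult_le_0_iff)
    ultimately show ?thesis by (metis minus_divide_left minus_minus real_sqrt_divide)
  qed
  ultimately show ?thesis by (simp add: p_def q_def k_def l_def)
qed

text \<open>One embedded copy closed under adjacency suffices. Its translates cover both orbits by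
  transitivity, and connectedness makes two translates equal or disjoint, so they form the required
  partition.\<close>

lemma bi_orbitI:
  assumes X: "X \<in> orb" and Y: "Y \<in> orb" and conn: "bigraph_connected E"
    and verts: "XV 1 \<in> bigraph_vertices E" "YV 1 \<in> bigraph_vertices E"
    and inj: "inj_on \<phi> (bigraph_vertices E)"
    and mat: "\<And>a b. \<lbrakk>a \<in> bigraph_vertices E; b \<in> bigraph_vertices E\<rbrakk> \<Longrightarrow>
      m (\<phi> a) (\<phi> b) = bigraph_matrix E a b"
    and XV: "\<And>i. XV i \<in> bigraph_vertices E \<Longrightarrow> \<phi> (XV i) \<in> X"
    and YV: "\<And>i. YV i \<in> bigraph_vertices E \<Longrightarrow> \<phi> (YV i) \<in> Y"
    and closed: "\<And>a t. \<lbrakk>a \<in> bigraph_vertices E; t \<in> X \<union> Y; m (\<phi> a) t \<noteq> 2\<rbrakk> \<Longrightarrow>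
      t \<in> \<phi> ` bigraph_vertices E"
  shows "bi_orbit m E X Y"
proof -
  let ?U = "bigraph_vertices E"
  define C :: "('s \<Rightarrow> 's) \<Rightarrow> 's set" where "C g = (\<lambda>a. g (\<phi> a)) ` ?U" for g
  have \<phi>: "\<phi> a \<in> X \<union> Y" if "a \<in> ?U" for a
    using that XV YV by (cases a) auto
  have XYS: "X \<union> Y \<subseteq> S" using orb_subset X Y by auto
  have \<phi>S: "\<phi> a \<in> S" if "a \<in> ?U" for a using \<phi>[OF that] XYS by blast
  have gXY: "g t \<in> X \<union> Y" if "g \<in> G" "t \<in> X \<union> Y" for g t
    using that orb_closed X Y by auto
  have C_sub: "C g \<subseteq> X \<union> Y" if "g \<in> G" for g
    unfolding C_def using gXY[OF that] \<phi> by blast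
  have C_closed: "t \<in> C g" if g: "g \<in> G" and s: "s \<in> C g" and t: "t \<in> X \<union> Y" "m s t \<noteq> 2" for g s t
  proof -
    obtain a where a: "a \<in> ?U" "s = g (\<phi> a)" using s by (auto simp: C_def)
    obtain h where h: "h \<in> G" "\<And>s. s \<in> S \<Longrightarrow> h (g s) = s" "\<And>s. s \<in> S \<Longrightarrow> g (h s) = s"
      using G_inverse_apply[OF g] by blast
    have tS: "t \<in> S" and aS: "\<phi> a \<in> S" using t(1) XYS \<phi>[OF a(1)] by auto
    have "m (\<phi> a) (h t) = m s t"
      using G_m[OF h(1), of s t] a(2) aS tS g h(2) by simp
    then have "h t \<in> \<phi> ` ?U" using closed[OF a(1) gXY[OF h(1) t(1)]] t(2) by simp
    then obtain b where "b \<in> ?U" "h t = \<phi> b" by auto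
    then show ?thesis using h(3)[OF tS] by (auto simp: C_def image_iff intro!: bexI[of _ b])
  qed
  have C_mono: "C g \<subseteq> C h" if g: "g \<in> G" and h: "h \<in> G" and ne: "C g \<inter> C h \<noteq> {}" for g h
  proof -
    \<comment> \<open>The vertices whose translate under \<open>g\<close> lands in
      \<open>C h\<close>; this set is closed under adjacency because \<open>C h\<close> is, so one
      common point makes it everything.\<close>
    define A where "A = {a \<in> ?U. g (\<phi> a) \<in> C h}"
    have "A = ?U"
      using conn unfolding bigraph_connected_def
    proof (elim allE impE)
      show "A \<subseteq> ?U" by (auto simp: A_def)
      show "A \<noteq> {}" using ne by (auto simp: A_def C_def)
      show "\<forall>a\<in>A. \<forall>b\<in>?U. bigraph_matrix E a b \<noteq> 2 \<longrightarrow> b \<in> A"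
      proof (intro ballI impI)
        fix a b assume a: "a \<in> A" and b: "b \<in> ?U" and ab: "bigraph_matrix E a b \<noteq> 2"
        have aU: "a \<in> ?U" and aC: "g (\<phi> a) \<in> C h" using a by (auto simp: A_def)
        have "m (g (\<phi> a)) (g (\<phi> b)) = bigraph_matrix E a b"
          using G_m[OF g \<phi>S[OF aU] \<phi>S[OF b]] mat[OF aU b] by simp
        then have "g (\<phi> b) \<in> C h" using C_closed[OF h aC gXY[OF g \<phi>[OF b]]] ab by simp
        then show "b \<in> A" using b by (simp add: A_def)
      qed
    qed
    then show ?thesis by (auto simp: A_def C_def)
  qed
  have C_eq: "C g = C h" if "g \<in> G" "h \<in> G" "C g \<inter> C h \<noteq> {}" for g h
  proof (rule subset_antisym)
    show "C g \<subseteq> C h" by (rule C_mono[OF that])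
    show "C h \<subseteq> C g" by (rule C_mono[OF that(2,1)]) (use that(3) in blast)
  qed
  have "partition_on (X \<union> Y) (C ` G)"
  proof (rule partition_onI)
    show "\<Union> (C ` G) = X \<union> Y"
    proof
      show "\<Union> (C ` G) \<subseteq> X \<union> Y" using C_sub by auto
      have "\<exists>g\<in>G. s \<in> C g" if s: "s \<in> X" for s
      proof -
        obtain g where "g \<in> G" "s = g (\<phi> (XV 1))" using orb_transitive[OF X XV[OF verts(1)] s] .
        then show ?thesis using verts(1) by (auto simp: C_def)
      qed
      moreover have "\<exists>g\<in>G. s \<in> C g" if s: "s \<in> Y" for s
      proof -
        obtain g where "g \<in> G" "s = g (\<phi> (YV 1))" using orb_transitive[OF Y YV[OF verts(2)] s] .
        then show ?thesis using verts(2) by (auto simp: C_def)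
      qed
      ultimately show "X \<union> Y \<subseteq> \<Union> (C ` G)" by auto
    qed
    show "disjnt p q" if "p \<in> C ` G" "q \<in> C ` G" "p \<noteq> q" for p q
      using that C_eq unfolding disjnt_def by blast
    show "{} \<notin> C ` G" using verts by (auto simp: C_def)
  qed
  moreover have "m s t = 2" if cd: "c \<in> C ` G" "d \<in> C ` G" "c \<noteq> d" "s \<in> c" "t \<in> d" for c d s t
  proof (rule ccontr)
    assume "m s t \<noteq> 2"
    obtain g h where gh: "g \<in> G" "h \<in> G" "c = C g" "d = C h" using cd by auto
    have "t \<in> X \<union> Y" using C_sub[OF gh(2)] cd(5) gh(4) by blast
    then have "t \<in> C g" using C_closed[OF gh(1)] cd(4) gh(3) \<open>m s t \<noteq> 2\<close> by blast
    then show False using C_eq[OF gh(1,2)] cd(3,5) gh by blast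
  qed
  moreover have "bigraph_copy m X Y E c" if cd: "c \<in> C ` G" for c
  proof -
    obtain g where g: "g \<in> G" "c = C g" using cd by auto
    have "inj_on g (\<phi> ` ?U)"
      using G_bij_betw[OF g(1)] \<phi>S by (meson bij_betw_def image_subsetI inj_on_subset)
    then have "bij_betw (\<lambda>a. g (\<phi> a)) ?U c"
      unfolding g(2) C_def using comp_inj_on[OF inj] by (simp add: bij_betw_def comp_def)
    moreover have "m (g (\<phi> a)) (g (\<phi> b)) = bigraph_matrix E a b" if "a \<in> ?U" "b \<in> ?U" for a b
      using G_m[OF g(1) \<phi>S[OF that(1)] \<phi>S[OF that(2)]] mat[OF that] by simp
    ultimately show ?thesis
      unfolding bigraph_copy_def
      using XV YV orb_closed[OF X g(1)] orb_closed[OF Y g(1)]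
      by (intro exI[of _ "\<lambda>a. g (\<phi> a)"]) auto
  qed
  ultimately show ?thesis unfolding bi_orbit_def by (intro exI[of _ "C ` G"]) blast
qed

text \<open>Roots in different blocks are orthogonal, so the value of a root sum at a root is
  computed inside a single copy of the graph.\<close>

lemma bi_orbitE:
  assumes bi: "bi_orbit m E X Y" and X: "X \<in> orb" and Y: "Y \<in> orb" and ne: "X \<noteq> Y"
  obtains \<phi> where
    "\<And>a b. \<lbrakk>a \<in> bigraph_vertices E; b \<in> bigraph_vertices E\<rbrakk> \<Longrightarrow>
      m (\<phi> a) (\<phi> b) = bigraph_matrix E a b"
    "\<And>i. XV i \<in> bigraph_vertices E \<Longrightarrow> \<phi> (XV i) \<in> X"
    "\<And>i. YV i \<in> bigraph_vertices E \<Longrightarrow> \<phi> (YV i) \<in> Y"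
    "\<And>a. a \<in> bigraph_vertices E \<Longrightarrow>
      B (root_sum X) (\<epsilon> (\<phi> a)) = (\<Sum>b\<in>bigraph_vertices E \<inter> range XV. B (\<epsilon> (\<phi> a)) (\<epsilon> (\<phi> b)))"
    "\<And>a. a \<in> bigraph_vertices E \<Longrightarrow>
      B (root_sum Y) (\<epsilon> (\<phi> a)) = (\<Sum>b\<in>bigraph_vertices E \<inter> range YV. B (\<epsilon> (\<phi> a)) (\<epsilon> (\<phi> b)))"
    "\<And>a t. \<lbrakk>a \<in> bigraph_vertices E; t \<in> X \<union> Y; m (\<phi> a) t \<noteq> 2\<rbrakk> \<Longrightarrow> t \<in> \<phi> ` bigraph_vertices E"
proof -
  let ?U = "bigraph_vertices E"
  obtain P where P: "partition_on (X \<union> Y) P"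
    "\<forall>C\<in>P. \<forall>D\<in>P. C \<noteq> D \<longrightarrow> (\<forall>s\<in>C. \<forall>t\<in>D. m s t = 2)"
    "\<forall>C\<in>P. bigraph_copy m X Y E C"
    using bi unfolding bi_orbit_def by (elim exE conjE)
  have "X \<union> Y \<noteq> {}" using orb_nonempty[OF X] by blast
  then obtain C where C: "C \<in> P" using partition_onD1[OF P(1)] by auto
  obtain \<phi> where \<phi>: "bij_betw \<phi> ?U C"
    "\<And>a b. \<lbrakk>a \<in> ?U; b \<in> ?U\<rbrakk> \<Longrightarrow> m (\<phi> a) (\<phi> b) = bigraph_matrix E a b"
    "\<And>i. XV i \<in> ?U \<Longrightarrow> \<phi> (XV i) \<in> X" "\<And>i. YV i \<in> ?U \<Longrightarrow> \<phi> (YV i) \<in> Y"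
    using P(3) C unfolding bigraph_copy_def by blast
  have im: "\<phi> ` ?U = C" and inj: "inj_on \<phi> ?U" using \<phi>(1) by (auto simp: bij_betw_def)
  have XY: "X \<inter> Y = {}" by (rule orb_disjoint[OF X Y ne])
  have XYS: "X \<subseteq> S" "Y \<subseteq> S" using orb_subset X Y by auto
  have CS: "C \<subseteq> S" using C partition_onD1[OF P(1)] XYS by auto
  have closed: "t \<in> C" if at: "a \<in> ?U" "t \<in> X \<union> Y" "m (\<phi> a) t \<noteq> 2" for a t
  proof -
    obtain D where D: "D \<in> P" "t \<in> D" using at(2) partition_onD1[OF P(1)] by auto
    have "\<phi> a \<in> C" using at(1) im by auto
    then have "C = D" using P(2) C D at(3) by blast
    then show ?thesis using D(2) by simp
  qed
  have sum: "B (root_sum Z) (\<epsilon> (\<phi> a)) = (\<Sum>b\<in>I. B (\<epsilon> (\<phi> a)) (\<epsilon> (\<phi> b)))"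
    if Z: "Z \<in> orb" "Z \<subseteq> X \<union> Y" and a: "a \<in> ?U" and I: "I \<subseteq> ?U" "\<phi> ` I = Z \<inter> C" for Z a I
  proof -
    have aS: "\<phi> a \<in> S" using a im CS by auto
    have ZS: "Z \<subseteq> S" using Z(2) XYS by auto
    have "B (root_sum Z) (\<epsilon> (\<phi> a)) = (\<Sum>t\<in>Z. B (\<epsilon> (\<phi> a)) (\<epsilon> t))"
      unfolding root_sum_def B_sym[OF root_sum_V[OF ZS, unfolded root_sum_def] root_in_V[OF aS]]
      using ZS aS by (intro B_sum_right) auto
    also have "\<dots> = (\<Sum>t\<in>Z \<inter> C. B (\<epsilon> (\<phi> a)) (\<epsilon> t))"
    proof (rule sum.mono_neutral_right)
      show "finite Z" by (rule orb_finite[OF Z(1)])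
      show "\<forall>t\<in>Z - Z \<inter> C. B (\<epsilon> (\<phi> a)) (\<epsilon> t) = 0"
        using closed[OF a] Z(2) ZS B_m2[OF aS] by blast
    qed simp
    also have "\<dots> = (\<Sum>b\<in>I. B (\<epsilon> (\<phi> a)) (\<epsilon> (\<phi> b)))"
      unfolding I(2)[symmetric] using inj_on_subset[OF inj I(1)] by (simp add: sum.reindex)
    finally show ?thesis .
  qed
  have split: "a \<in> ?U \<Longrightarrow> a \<in> range XV \<or> a \<in> range YV" for a by (cases a) auto
  have IX: "\<phi> ` (?U \<inter> range XV) = X \<inter> C"
  proof
    show "\<phi> ` (?U \<inter> range XV) \<subseteq> X \<inter> C" using \<phi>(3) im by auto
    show "X \<inter> C \<subseteq> \<phi> ` (?U \<inter> range XV)"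
      unfolding im[symmetric] using split \<phi>(4) XY by fast
  qed
  have IY: "\<phi> ` (?U \<inter> range YV) = Y \<inter> C"
  proof
    show "\<phi> ` (?U \<inter> range YV) \<subseteq> Y \<inter> C" using \<phi>(4) im by auto
    show "Y \<inter> C \<subseteq> \<phi> ` (?U \<inter> range YV)"
      unfolding im[symmetric] using split \<phi>(3) XY by fast
  qed
  show ?thesis
  proof (rule that[OF \<phi>(2,3,4)])
    show "B (root_sum X) (\<epsilon> (\<phi> a)) = (\<Sum>b\<in>?U \<inter> range XV. B (\<epsilon> (\<phi> a)) (\<epsilon> (\<phi> b)))" if "a \<in> ?U" for a
      using that IX by (intro sum X) auto
    show "B (root_sum Y) (\<epsilon> (\<phi> a)) = (\<Sum>b\<in>?U \<inter> range YV. B (\<epsilon> (\<phi> a)) (\<epsilon> (\<phi> b)))" if "a \<in> ?U" for a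
      using that IY by (intro sum Y) auto
    show "t \<in> \<phi> ` ?U" if "a \<in> ?U" "t \<in> X \<union> Y" "m (\<phi> a) t \<noteq> 2" for a t
      unfolding im by (rule closed[OF that])
  qed
qed

end

text \<open>Otherwise the simplifier turns the vertex \<open>XV 1\<close> into \<open>XV (Suc 0)\<close>, which no rule below matches.\<close>

declare One_nat_def [simp del]

section \<open>Vertices, labels and connectedness of the five graphs\<close>

lemma bigraph_vertices_graphs:
  "bigraph_vertices (graph1 l) = {XV 1, YV 1}"
  "bigraph_vertices graph2 = {XV 1, YV 1, YV 2}"
  "bigraph_vertices graph3 = {XV 1, XV 2, YV 1, YV 2}"
  "bigraph_vertices graph4 = {XV 1, XV 2, YV 1, YV 2}"
  "bigraph_vertices graph5 = {XV 1, YV 1, YV 2, YV 3}"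
  by (auto simp: bigraph_vertices_def graph1_def graph2_def graph3_def graph4_def graph5_def)

lemma bigraph_matrix_same [simp]: "bigraph_matrix E a a = 1"
  by (simp add: bigraph_matrix_def)

lemma bigraph_matrix_graph1:
  "bigraph_matrix (graph1 l) (XV 1) (YV 1) = l" "bigraph_matrix (graph1 l) (YV 1) (XV 1) = l"
  by (simp_all add: bigraph_matrix_def graph1_def)

lemma bigraph_matrix_graph2:
  "bigraph_matrix graph2 (XV 1) (YV 1) = 3" "bigraph_matrix graph2 (YV 1) (XV 1) = 3"
  "bigraph_matrix graph2 (XV 1) (YV 2) = 3" "bigraph_matrix graph2 (YV 2) (XV 1) = 3"
  "bigraph_matrix graph2 (YV 1) (YV 2) = 2" "bigraph_matrix graph2 (YV 2) (YV 1) = 2"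
  by (simp_all add: bigraph_matrix_def graph2_def)

lemma bigraph_matrix_graph3:
  "bigraph_matrix graph3 (XV 1) (YV 1) = 3" "bigraph_matrix graph3 (YV 1) (XV 1) = 3"
  "bigraph_matrix graph3 (XV 2) (YV 2) = 3" "bigraph_matrix graph3 (YV 2) (XV 2) = 3"
  "bigraph_matrix graph3 (YV 1) (YV 2) = 3" "bigraph_matrix graph3 (YV 2) (YV 1) = 3"
  "bigraph_matrix graph3 (XV 1) (XV 2) = 2" "bigraph_matrix graph3 (XV 2) (XV 1) = 2"
  "bigraph_matrix graph3 (XV 1) (YV 2) = 2" "bigraph_matrix graph3 (YV 2) (XV 1) = 2"
  "bigraph_matrix graph3 (XV 2) (YV 1) = 2" "bigraph_matrix graph3 (YV 1) (XV 2) = 2"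
  by (simp_all add: bigraph_matrix_def graph3_def)

lemma bigraph_matrix_graph4:
  "bigraph_matrix graph4 (XV 1) (YV 1) = 3" "bigraph_matrix graph4 (YV 1) (XV 1) = 3"
  "bigraph_matrix graph4 (XV 2) (YV 2) = 3" "bigraph_matrix graph4 (YV 2) (XV 2) = 3"
  "bigraph_matrix graph4 (YV 1) (YV 2) = 4" "bigraph_matrix graph4 (YV 2) (YV 1) = 4"
  "bigraph_matrix graph4 (XV 1) (XV 2) = 2" "bigraph_matrix graph4 (XV 2) (XV 1) = 2"
  "bigraph_matrix graph4 (XV 1) (YV 2) = 2" "bigraph_matrix graph4 (YV 2) (XV 1) = 2"
  "bigraph_matrix graph4 (XV 2) (YV 1) = 2" "bigraph_matrix graph4 (YV 1) (XV 2) = 2"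
  by (simp_all add: bigraph_matrix_def graph4_def)

lemma bigraph_matrix_graph5:
  "bigraph_matrix graph5 (XV 1) (YV 1) = 3" "bigraph_matrix graph5 (YV 1) (XV 1) = 3"
  "bigraph_matrix graph5 (XV 1) (YV 2) = 3" "bigraph_matrix graph5 (YV 2) (XV 1) = 3"
  "bigraph_matrix graph5 (XV 1) (YV 3) = 3" "bigraph_matrix graph5 (YV 3) (XV 1) = 3"
  "bigraph_matrix graph5 (YV 1) (YV 2) = 2" "bigraph_matrix graph5 (YV 2) (YV 1) = 2"
  "bigraph_matrix graph5 (YV 1) (YV 3) = 2" "bigraph_matrix graph5 (YV 3) (YV 1) = 2"
  "bigraph_matrix graph5 (YV 2) (YV 3) = 2" "bigraph_matrix graph5 (YV 3) (YV 2) = 2"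
  by (simp_all add: bigraph_matrix_def graph5_def)

text \<open>Membership in an adjacency-closed set passes along an edge in both directions, so
  connectedness is read off the list of edges.\<close>

lemma closed_set_edge:
  assumes "\<forall>a\<in>A. \<forall>b\<in>bigraph_vertices E. bigraph_matrix E a b \<noteq> 2 \<longrightarrow> b \<in> A"
    "a \<in> bigraph_vertices E" "b \<in> bigraph_vertices E" "bigraph_matrix E a b \<noteq> 2" "bigraph_matrix E b a \<noteq> 2"
  shows "a \<in> A \<longleftrightarrow> b \<in> A"
  using assms by blast

lemma bigraph_connected_graph1: "l \<noteq> 2 \<Longrightarrow> bigraph_connected (graph1 l)"
  unfolding bigraph_connected_def
proof (intro allI impI)
  assume l: "l \<noteq> 2"
  fix A :: "bivertex set"
  assume A: "A \<subseteq> bigraph_vertices (graph1 l)" "A \<noteq> {}"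
    and closed: "\<forall>a\<in>A. \<forall>b\<in>bigraph_vertices (graph1 l). bigraph_matrix (graph1 l) a b \<noteq> 2 \<longrightarrow> b \<in> A"
  note edge = closed_set_edge[OF closed]
  have "XV 1 \<in> A \<longleftrightarrow> YV 1 \<in> A"
    by (intro edge; simp add: bigraph_vertices_graphs bigraph_matrix_graph1 l)+
  then show "A = bigraph_vertices (graph1 l)" using A unfolding bigraph_vertices_graphs by blast
qed

lemma bigraph_connected_graph2: "bigraph_connected graph2"
  unfolding bigraph_connected_def
proof (intro allI impI)
  fix A :: "bivertex set"
  assume A: "A \<subseteq> bigraph_vertices graph2" "A \<noteq> {}"
    and closed: "\<forall>a\<in>A. \<forall>b\<in>bigraph_vertices graph2. bigraph_matrix graph2 a b \<noteq> 2 \<longrightarrow> b \<in> A"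
  note edge = closed_set_edge[OF closed]
  have "XV 1 \<in> A \<longleftrightarrow> YV 1 \<in> A" "XV 1 \<in> A \<longleftrightarrow> YV 2 \<in> A"
    by (intro edge; simp add: bigraph_vertices_graphs bigraph_matrix_graph2)+
  then show "A = bigraph_vertices graph2" using A unfolding bigraph_vertices_graphs by blast
qed

lemma bigraph_connected_graph3: "bigraph_connected graph3"
  unfolding bigraph_connected_def
proof (intro allI impI)
  fix A :: "bivertex set"
  assume A: "A \<subseteq> bigraph_vertices graph3" "A \<noteq> {}"
    and closed: "\<forall>a\<in>A. \<forall>b\<in>bigraph_vertices graph3. bigraph_matrix graph3 a b \<noteq> 2 \<longrightarrow> b \<in> A"
  note edge = closed_set_edge[OF closed]
  have "XV 1 \<in> A \<longleftrightarrow> YV 1 \<in> A" "YV 1 \<in> A \<longleftrightarrow> YV 2 \<in> A" "YV 2 \<in> A \<longleftrightarrow> XV 2 \<in> A"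
    by (intro edge; simp add: bigraph_vertices_graphs bigraph_matrix_graph3)+
  then show "A = bigraph_vertices graph3" using A unfolding bigraph_vertices_graphs by blast
qed

lemma bigraph_connected_graph4: "bigraph_connected graph4"
  unfolding bigraph_connected_def
proof (intro allI impI)
  fix A :: "bivertex set"
  assume A: "A \<subseteq> bigraph_vertices graph4" "A \<noteq> {}"
    and closed: "\<forall>a\<in>A. \<forall>b\<in>bigraph_vertices graph4. bigraph_matrix graph4 a b \<noteq> 2 \<longrightarrow> b \<in> A"
  note edge = closed_set_edge[OF closed]
  have "XV 1 \<in> A \<longleftrightarrow> YV 1 \<in> A" "YV 1 \<in> A \<longleftrightarrow> YV 2 \<in> A" "YV 2 \<in> A \<longleftrightarrow> XV 2 \<in> A"
    by (intro edge; simp add: bigraph_vertices_graphs bigraph_matrix_graph4)+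
  then show "A = bigraph_vertices graph4" using A unfolding bigraph_vertices_graphs by blast
qed

lemma bigraph_connected_graph5: "bigraph_connected graph5"
  unfolding bigraph_connected_def
proof (intro allI impI)
  fix A :: "bivertex set"
  assume A: "A \<subseteq> bigraph_vertices graph5" "A \<noteq> {}"
    and closed: "\<forall>a\<in>A. \<forall>b\<in>bigraph_vertices graph5. bigraph_matrix graph5 a b \<noteq> 2 \<longrightarrow> b \<in> A"
  note edge = closed_set_edge[OF closed]
  have "XV 1 \<in> A \<longleftrightarrow> YV 1 \<in> A" "XV 1 \<in> A \<longleftrightarrow> YV 2 \<in> A" "XV 1 \<in> A \<longleftrightarrow> YV 3 \<in> A"
    by (intro edge; simp add: bigraph_vertices_graphs bigraph_matrix_graph5)+
  then show "A = bigraph_vertices graph5" using A unfolding bigraph_vertices_graphs by blast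
qed

section \<open>Values of the folded form on the five types of bi-orbits\<close>

context folding
begin

text \<open>The numbers \<open>- cos (pi / k)\<close> for the labels that occur in graphs 2 to 5,
  with 1 on the diagonal. The last branch stands for k = 4; other labels are kept out by
  \<open>B_label_form\<close>.\<close>

definition label_form :: "enat \<Rightarrow> real" where
  "label_form k = (if k = 1 then 1 else if k = 2 then 0 else if k = 3 then - 1 / 2 else - sqrt 2 / 2)"

lemma B_label_form:
  assumes "s \<in> S" "t \<in> S" "m s t \<in> {1, 2, 3, 4}"
  shows "B (\<epsilon> s) (\<epsilon> t) = label_form (m s t)"
proof (cases "s = t")
  case True
  then show ?thesis using assms m_same by (simp add: label_form_def)
next
  case False
  then have "2 \<le> m s t" using m_ge_2 assms by simp
  then have "m s t \<noteq> 1" by auto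
  then show ?thesis
    using assms B_m2[OF assms(1,2)] B_m3[OF assms(1,2)] B_m4[OF assms(1,2)]
    by (auto simp: label_form_def)
qed

text \<open>With labels up to 4 the form is determined by the matrix of the graph, so the value
  becomes a finite computation at the vertices \<open>XV 1\<close> and \<open>YV 1\<close>.\<close>

lemma bi_orbit_value:
  assumes X: "X \<in> fin_orb" and Y: "Y \<in> fin_orb" and ne: "X \<noteq> Y" and bi: "bi_orbit m E X Y"
    and verts: "XV 1 \<in> bigraph_vertices E" "YV 1 \<in> bigraph_vertices E"
    and mat: "\<And>a b. \<lbrakk>a \<in> bigraph_vertices E; b \<in> bigraph_vertices E\<rbrakk> \<Longrightarrow> bigraph_matrix E a b \<in> {1, 2, 3, 4}"
  shows "folded_form X Y =
    - sqrt ((\<Sum>b\<in>bigraph_vertices E \<inter> range YV. label_form (bigraph_matrix E (XV 1) b))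
      * (\<Sum>b\<in>bigraph_vertices E \<inter> range XV. label_form (bigraph_matrix E (YV 1) b))
      / ((\<Sum>b\<in>bigraph_vertices E \<inter> range XV. label_form (bigraph_matrix E (XV 1) b))
        * (\<Sum>b\<in>bigraph_vertices E \<inter> range YV. label_form (bigraph_matrix E (YV 1) b))))"
proof -
  note Xo = fin_orb_orb[OF X] and Yo = fin_orb_orb[OF Y]
  from bi Xo Yo ne obtain \<phi> where \<phi>:
    "\<And>a b. \<lbrakk>a \<in> bigraph_vertices E; b \<in> bigraph_vertices E\<rbrakk> \<Longrightarrow> m (\<phi> a) (\<phi> b) = bigraph_matrix E a b"
    "\<And>i. XV i \<in> bigraph_vertices E \<Longrightarrow> \<phi> (XV i) \<in> X"
    "\<And>i. YV i \<in> bigraph_vertices E \<Longrightarrow> \<phi> (YV i) \<in> Y"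
    "\<And>a. a \<in> bigraph_vertices E \<Longrightarrow>
      B (root_sum X) (\<epsilon> (\<phi> a)) = (\<Sum>b\<in>bigraph_vertices E \<inter> range XV. B (\<epsilon> (\<phi> a)) (\<epsilon> (\<phi> b)))"
    "\<And>a. a \<in> bigraph_vertices E \<Longrightarrow>
      B (root_sum Y) (\<epsilon> (\<phi> a)) = (\<Sum>b\<in>bigraph_vertices E \<inter> range YV. B (\<epsilon> (\<phi> a)) (\<epsilon> (\<phi> b)))"
    "\<And>a t. \<lbrakk>a \<in> bigraph_vertices E; t \<in> X \<union> Y; m (\<phi> a) t \<noteq> 2\<rbrakk> \<Longrightarrow> t \<in> \<phi> ` bigraph_vertices E"
    by (rule bi_orbitE) (rule that)
  have S: "\<phi> a \<in> S" if "a \<in> bigraph_vertices E" for a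
    using that \<phi>(2,3) orb_subset[OF Xo] orb_subset[OF Yo] by (cases a) auto
  have val: "B (\<epsilon> (\<phi> a)) (\<epsilon> (\<phi> b)) = label_form (bigraph_matrix E a b)"
    if "a \<in> bigraph_vertices E" "b \<in> bigraph_vertices E" for a b
    using B_label_form[OF S[OF that(1)] S[OF that(2)]] mat[OF that] \<phi>(1)[OF that] by simp
  have sumX: "B (root_sum X) (\<epsilon> (\<phi> a)) = (\<Sum>b\<in>bigraph_vertices E \<inter> range XV. label_form (bigraph_matrix E a b))"
    and sumY: "B (root_sum Y) (\<epsilon> (\<phi> a)) = (\<Sum>b\<in>bigraph_vertices E \<inter> range YV. label_form (bigraph_matrix E a b))"
    if "a \<in> bigraph_vertices E" for a
    unfolding \<phi>(4)[OF that] \<phi>(5)[OF that] using val[OF that] by (auto intro!: sum.cong)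
  show ?thesis
    unfolding B_folded_roots[OF X Y ne \<phi>(2)[OF verts(1)] \<phi>(3)[OF verts(2)]]
      sumX[OF verts(1)] sumX[OF verts(2)] sumY[OF verts(1)] sumY[OF verts(2)] ..
qed

lemma XV_YV_Int:
  "insert (XV i) A \<inter> range XV = insert (XV i) (A \<inter> range XV)"
  "insert (YV i) A \<inter> range XV = A \<inter> range XV"
  "insert (XV i) A \<inter> range YV = A \<inter> range YV"
  "insert (YV i) A \<inter> range YV = insert (YV i) (A \<inter> range YV)"
  by auto

context
  fixes X Y
  assumes X: "X \<in> fin_orb" and Y: "Y \<in> fin_orb" and ne: "X \<noteq> Y"
begin

lemma bi_orbit_value_graph2:
  assumes "bi_orbit m graph2 X Y"
  shows "folded_form X Y = - cos (pi / 4)"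
proof -
  have "folded_form X Y = - sqrt (1 / 2)"
    by (subst bi_orbit_value[OF X Y ne assms])
      (auto simp: bigraph_vertices_graphs bigraph_matrix_graph2 XV_YV_Int label_form_def)
  then show ?thesis by (simp add: cos_45 real_sqrt_divide real_div_sqrt)
qed

lemma bi_orbit_value_graph3:
  assumes "bi_orbit m graph3 X Y"
  shows "folded_form X Y = - cos (pi / 4)"
proof -
  \<comment> \<open>Both mixed values are - 1/2; the edge between the two \<open>YV\<close> vertices
    lowers the own value on the Y side to 1/2.\<close>
  have "folded_form X Y = - sqrt (1 / 2)"
    by (subst bi_orbit_value[OF X Y ne assms])
      (auto simp: bigraph_vertices_graphs bigraph_matrix_graph3 XV_YV_Int label_form_def)
  then show ?thesis by (simp add: cos_45 real_sqrt_divide real_div_sqrt)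
qed

lemma bi_orbit_value_graph4:
  assumes "bi_orbit m graph4 X Y"
  shows "folded_form X Y = - cos (pi / 8)"
proof -
  have "folded_form X Y = - sqrt ((- 1 / 2) * (- 1 / 2) / (1 * (1 - sqrt 2 / 2)))"
    by (subst bi_orbit_value[OF X Y ne assms])
      (auto simp: bigraph_vertices_graphs bigraph_matrix_graph4 XV_YV_Int label_form_def)
  moreover have "sqrt ((- 1 / 2) * (- 1 / 2) / (1 * (1 - sqrt 2 / 2))) = cos (pi / 8)"
  proof (rule real_sqrt_unique)
    have "sqrt 2 < 2" by (rule sqrt2_less_2)
    then show "(cos (pi / 8))\<^sup>2 = (- 1 / 2) * (- 1 / 2) / (1 * (1 - sqrt 2 / 2))"
      unfolding cos_pi_8_squared by (simp add: field_simps)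
    show "0 \<le> cos (pi / 8)" by (rule cos_ge_zero) auto
  qed
  ultimately show ?thesis by simp
qed

lemma bi_orbit_value_graph5:
  assumes "bi_orbit m graph5 X Y"
  shows "folded_form X Y = - cos (pi / 6)"
proof -
  \<comment> \<open>The centre sees three leaves, value - 3/2, while a leaf sees only the centre,
    value - 1/2; both own values are 1.\<close>
  have "folded_form X Y = - sqrt (3 / 4)"
    by (subst bi_orbit_value[OF X Y ne assms])
      (auto simp: bigraph_vertices_graphs bigraph_matrix_graph5 XV_YV_Int label_form_def)
  then show ?thesis by (simp add: cos_30 real_sqrt_divide)
qed

text \<open>Treated apart because its label may be infinite, where the form is bounded but not
  determined by the label. The value is therefore given by the pair of roots, and the uniqueness of
  \<open>t\<close> later identifies the label.\<close>

lemma bi_orbit_graph1: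
  assumes "bi_orbit m (graph1 l) X Y"
  obtains s t where "s \<in> X" "t \<in> Y" "m s t = l" "folded_form X Y = B (\<epsilon> s) (\<epsilon> t)"
    "\<And>u. \<lbrakk>u \<in> Y; m s u \<noteq> 2\<rbrakk> \<Longrightarrow> u = t"
proof -
  note Xo = fin_orb_orb[OF X] and Yo = fin_orb_orb[OF Y]
  let ?U = "bigraph_vertices (graph1 l)"
  from assms Xo Yo ne obtain \<phi> where \<phi>:
    "\<And>a b. \<lbrakk>a \<in> ?U; b \<in> ?U\<rbrakk> \<Longrightarrow> m (\<phi> a) (\<phi> b) = bigraph_matrix (graph1 l) a b"
    "\<And>i. XV i \<in> ?U \<Longrightarrow> \<phi> (XV i) \<in> X" "\<And>i. YV i \<in> ?U \<Longrightarrow> \<phi> (YV i) \<in> Y"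
    "\<And>a. a \<in> ?U \<Longrightarrow> B (root_sum X) (\<epsilon> (\<phi> a)) = (\<Sum>b\<in>?U \<inter> range XV. B (\<epsilon> (\<phi> a)) (\<epsilon> (\<phi> b)))"
    "\<And>a. a \<in> ?U \<Longrightarrow> B (root_sum Y) (\<epsilon> (\<phi> a)) = (\<Sum>b\<in>?U \<inter> range YV. B (\<epsilon> (\<phi> a)) (\<epsilon> (\<phi> b)))"
    "\<And>a t. \<lbrakk>a \<in> ?U; t \<in> X \<union> Y; m (\<phi> a) t \<noteq> 2\<rbrakk> \<Longrightarrow> t \<in> \<phi> ` ?U"
    by (rule bi_orbitE) (rule that)
  define s t where "s = \<phi> (XV 1)" and "t = \<phi> (YV 1)"
  have s: "s \<in> X" "s \<in> S" and t: "t \<in> Y" "t \<in> S"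
    using \<phi>(2,3) orb_subset[OF Xo] orb_subset[OF Yo] by (auto simp: s_def t_def bigraph_vertices_graphs)
  have XY: "X \<inter> Y = {}" by (rule orb_disjoint[OF Xo Yo ne])
  have st: "s \<noteq> t" using s t XY by auto
  have vals: "B (root_sum X) (\<epsilon> s) = 1" "B (root_sum Y) (\<epsilon> t) = 1"
    "B (root_sum X) (\<epsilon> t) = B (\<epsilon> s) (\<epsilon> t)" "B (root_sum Y) (\<epsilon> s) = B (\<epsilon> s) (\<epsilon> t)"
    using \<phi>(4,5)[of "XV 1"] \<phi>(4,5)[of "YV 1"] s t B_sym[of "\<epsilon> s" "\<epsilon> t"]
    by (simp_all add: bigraph_vertices_graphs XV_YV_Int s_def t_def)
  have "folded_form X Y = - sqrt ((B (\<epsilon> s) (\<epsilon> t))\<^sup>2)"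
    using B_folded_roots[OF X Y ne s(1) t(1)] vals by (simp add: power2_eq_square)
  also have "\<dots> = B (\<epsilon> s) (\<epsilon> t)" using B_offdiag[OF s(2) t(2) st] by simp
  finally have B: "folded_form X Y = B (\<epsilon> s) (\<epsilon> t)" .
  have m: "m s t = l"
    using \<phi>(1)[of "XV 1" "YV 1"] by (simp add: bigraph_vertices_graphs bigraph_matrix_graph1 s_def t_def)
  have "u = t" if "u \<in> Y" "m s u \<noteq> 2" for u
    using \<phi>(6)[of "XV 1" u] that s XY by (auto simp: bigraph_vertices_graphs s_def t_def)
  with that[OF s(1) t(1) m B] show ?thesis by blast
qed

end

end

section \<open>Classification of pairs of orbits\<close>

lemma card_eq_1_imp: "\<lbrakk>card A = 1; x \<in> A\<rbrakk> \<Longrightarrow> A = {x}"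
  by (auto elim!: card_1_singletonE)

context folding
begin

text \<open>The vertex itself has to be excluded by hand, as its diagonal entry 1 also differs from
  2.\<close>

definition nbr :: "'s set \<Rightarrow> 's \<Rightarrow> 's set" where
  "nbr Z s = {t \<in> Z. t \<noteq> s \<and> m s t \<noteq> 2}"

lemma nbr_cases: "\<lbrakk>u \<in> X \<union> Y; m v u \<noteq> 2\<rbrakk> \<Longrightarrow> u = v \<or> u \<in> nbr X v \<or> u \<in> nbr Y v"
  by (auto simp: nbr_def)

lemma nbr_finite: "Z \<in> orb \<Longrightarrow> finite (nbr Z s)"
  using orb_finite[of Z] by (simp add: nbr_def)

lemma nbr_ge_3:
  assumes "s \<in> S" "t \<in> S" "t \<noteq> s" "m s t \<noteq> 2"
  shows "3 \<le> m s t"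
proof (cases "m s t")
  case (enat n)
  then show ?thesis using m_ge_2[OF assms(1,2)] assms(3,4) by (simp add: numeral_eq_enat)
qed simp

lemma B_nbr: "\<lbrakk>s \<in> S; t \<in> S; t \<noteq> s; m s t \<noteq> 2\<rbrakk> \<Longrightarrow> B (\<epsilon> s) (\<epsilon> t) \<le> - 1 / 2"
  using B_m_ge[of s t 3] nbr_ge_3[of s t] by (simp add: numeral_eq_enat cos_60)

lemma B_root_sum_nbr:
  assumes Z: "Z \<in> orb" and s: "s \<in> S"
  shows "B (root_sum Z) (\<epsilon> s) = (if s \<in> Z then 1 else 0) + (\<Sum>t\<in>nbr Z s. B (\<epsilon> s) (\<epsilon> t))"
proof -
  note ZS = orb_subset[OF Z] and fin = orb_finite[OF Z]
  have "B (root_sum Z) (\<epsilon> s) = (\<Sum>t\<in>Z. B (\<epsilon> s) (\<epsilon> t))"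
    unfolding root_sum_def B_sym[OF root_sum_V[OF ZS, unfolded root_sum_def] root_in_V[OF s]]
    using ZS s by (intro B_sum_right) auto
  also have "\<dots> = (\<Sum>t\<in>Z \<inter> {s} \<union> nbr Z s. B (\<epsilon> s) (\<epsilon> t))"
    using ZS B_m2[OF s] fin by (intro sum.mono_neutral_right) (auto simp: nbr_def)
  also have "\<dots> = (\<Sum>t\<in>Z \<inter> {s}. B (\<epsilon> s) (\<epsilon> t)) + (\<Sum>t\<in>nbr Z s. B (\<epsilon> s) (\<epsilon> t))"
    using fin by (intro sum.union_disjoint) (auto simp: nbr_def)
  also have "(\<Sum>t\<in>Z \<inter> {s}. B (\<epsilon> s) (\<epsilon> t)) = (if s \<in> Z then 1 else 0)"
    using s by simp
  finally show ?thesis .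
qed

lemma B_root_sum_le:
  assumes Z: "Z \<in> orb" and s: "s \<in> S"
  shows "B (root_sum Z) (\<epsilon> s) \<le> (if s \<in> Z then 1 else 0) - real (card (nbr Z s)) / 2"
proof -
  have "(\<Sum>t\<in>nbr Z s. B (\<epsilon> s) (\<epsilon> t)) \<le> (\<Sum>t\<in>nbr Z s. - 1 / 2)"
    using orb_subset[OF Z] B_nbr[OF s] by (intro sum_mono) (auto simp: nbr_def)
  then show ?thesis unfolding B_root_sum_nbr[OF assms] by simp
qed

lemma nbr_image:
  assumes Z: "Z \<in> orb" and s: "s \<in> S" and g: "g \<in> G"
  shows "nbr Z (g s) = g ` nbr Z s"
proof -
  note ZS = orb_subset[OF Z]
  have inj: "g t = g u \<longleftrightarrow> t = u" if "t \<in> S" "u \<in> S" for t u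
    using G_bij_betw[OF g] that by (auto simp: bij_betw_def inj_on_def)
  have im: "Z = g ` Z" using orb_bij_betw[OF Z g] by (simp add: bij_betw_def)
  have "nbr Z (g s) = {t \<in> g ` Z. t \<noteq> g s \<and> m (g s) t \<noteq> 2}"
    unfolding nbr_def by (subst im) (rule HOL.refl)
  also have "\<dots> = g ` nbr Z s"
  proof -
    have "g t \<noteq> g s \<and> m (g s) (g t) \<noteq> 2 \<longleftrightarrow> t \<noteq> s \<and> m s t \<noteq> 2" if "t \<in> Z" for t
      using that ZS s inj[of t s] G_m[OF g s, of t] by auto
    then show ?thesis by (auto simp: nbr_def)
  qed
  finally show ?thesis .
qed

lemma B_image: "\<lbrakk>g \<in> G; s \<in> S; t \<in> S\<rbrakk> \<Longrightarrow> B (\<epsilon> (g s)) (\<epsilon> (g t)) = B (\<epsilon> s) (\<epsilon> t)"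
  using \<rho>_invariant[of g "\<epsilon> s" "\<epsilon> t"] by (simp add: \<rho>_root)

text \<open>Each neighbour costs at least 1/2 of the positive value of the root sum, which starts
  from 1. Hence a finite orbit consists of isolated vertices or of separate edges.\<close>

lemma nbr_own_le_1:
  assumes X: "X \<in> fin_orb" and s: "s \<in> X"
  shows "card (nbr X s) \<le> 1"
  using B_root_sum_le[OF fin_orb_orb[OF X], of s] B_root_sum_pos[OF X s]
    orb_subset[OF fin_orb_orb[OF X]] s by auto

lemma small_form:
  assumes X: "X \<in> fin_orb" and Y: "Y \<in> fin_orb" and ne: "X \<noteq> Y" and s: "s \<in> X" and t: "t \<in> Y"
    and small: "- 1 < folded_form X Y"
  shows "B (root_sum Y) (\<epsilon> s) * B (root_sum X) (\<epsilon> t) < B (root_sum X) (\<epsilon> s) * B (root_sum Y) (\<epsilon> t)"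
  using small B_root_sum_pos[OF X s] B_root_sum_pos[OF Y t]
  unfolding B_folded_roots[OF X Y ne s t] by simp

text \<open>The component of \<open>t\<close> is a star whose \<open>d\<close> leaves lie in
  \<open>X\<close>. With c the form on an edge, smallness reads d c^2 < 1, and c \<le> - 1/2 then
  gives d < 4; for d at least 2 a label of 4 or more would already give d c^2 \<ge> 1. The centre is
  in \<open>Y\<close>, hence the swapped order for \<open>graph2\<close> and
  \<open>graph5\<close>.\<close>

lemma bi_orbit_star:
  assumes X: "X \<in> fin_orb" and Y: "Y \<in> fin_orb" and ne: "X \<noteq> Y" and s: "s \<in> X" and t: "t \<in> Y"
    and st: "m s t \<noteq> 2" and nX: "nbr X s = {}" and nY: "nbr Y t = {}" and c1: "card (nbr Y s) = 1"
    and small: "- 1 < folded_form X Y"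
  shows "bi_orbit m (graph1 (m s t)) X Y \<or> bi_orbit m graph2 Y X \<or> bi_orbit m graph5 Y X"
proof -
  note Xo = fin_orb_orb[OF X] and Yo = fin_orb_orb[OF Y]
  have XY: "X \<inter> Y = {}" by (rule orb_disjoint[OF Xo Yo ne])
  have sS: "s \<in> S" and tS: "t \<in> S" using s t orb_subset Xo Yo by auto
  have tn: "nbr Y s = {t}"
    using c1 st t s XY by (intro card_eq_1_imp) (auto simp: nbr_def)
  define c where "c = B (\<epsilon> s) (\<epsilon> t)"
  have leaf: "u \<in> X" "u \<in> S" "u \<noteq> t" "nbr X u = {}" "nbr Y u = {t}" "m u t = m s t" "m t u = m s t"
    "B (\<epsilon> t) (\<epsilon> u) = c" if u: "u \<in> nbr X t" for u
  proof -
    show uX: "u \<in> X" and uS: "u \<in> S" and ut: "u \<noteq> t" using u orb_subset[OF Xo] by (auto simp: nbr_def)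
    obtain g where g: "g \<in> G" "u = g s" using orb_transitive[OF Xo s uX] .
    show "nbr X u = {}" unfolding g(2) nbr_image[OF Xo sS g(1)] nX by simp
    have "nbr Y u = {g t}" unfolding g(2) nbr_image[OF Yo sS g(1)] tn by simp
    \<comment> \<open>\<open>t\<close> is a neighbour of \<open>u\<close>, and \<open>g t\<close> is
      its only neighbour in \<open>Y\<close>, so \<open>g\<close> fixes \<open>t\<close> and all
      edges at \<open>t\<close> carry the same label.\<close>
    moreover have "t \<in> nbr Y u" using u t uX XY m_sym[OF tS uS] by (auto simp: nbr_def)
    ultimately have gt: "g t = t" by simp
    then show "nbr Y u = {t}" using \<open>nbr Y u = {g t}\<close> by simp
    show "m u t = m s t" using G_m[OF g(1) sS tS] g(2) gt by simp
    then show "m t u = m s t" using m_sym[OF tS uS] by simp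
    show "B (\<epsilon> t) (\<epsilon> u) = c"
      using B_image[OF g(1) sS tS] g(2) gt B_sym[of "\<epsilon> t" "\<epsilon> u"] tS uS by (simp add: c_def)
  qed
  have s_leaf: "s \<in> nbr X t" using s t st XY m_sym[OF sS tS] by (auto simp: nbr_def)
  define d where "d = card (nbr X t)"
  have d_pos: "0 < d" using s_leaf nbr_finite[OF Xo] by (auto simp: d_def card_gt_0_iff)
  have form: "real d * c\<^sup>2 < 1"
  proof -
    have "s \<notin> Y" "t \<notin> X" using s t XY by auto
    then have "B (root_sum Y) (\<epsilon> s) = c" "B (root_sum X) (\<epsilon> t) = real d * c"
      "B (root_sum X) (\<epsilon> s) = 1" "B (root_sum Y) (\<epsilon> t) = 1"
      using s t sS tS leaf(8) by (simp_all add: B_root_sum_nbr Xo Yo nX nY tn c_def d_def)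
    then show ?thesis using small_form[OF X Y ne s t small] by (simp add: power2_eq_square mult_ac)
  qed
  have st_ne: "t \<noteq> s" using s t XY by auto
  have c: "c \<le> - 1 / 2" unfolding c_def by (rule B_nbr[OF sS tS st_ne st])
  have "1 / 4 \<le> c\<^sup>2" using power_mono[of "1 / 2" "- c" 2] c by (simp add: power2_eq_square)
  then have "real d * (1 / 4) \<le> real d * c\<^sup>2" by (intro mult_left_mono) auto
  then have d_less: "d < 4" using form by simp
  have m3: "m s t = 3" if "2 \<le> d"
  proof (rule ccontr)
    assume m: "m s t \<noteq> 3"
    have "enat 4 \<le> m s t"
      using nbr_ge_3[OF sS tS st_ne st] m by (cases "m s t") (auto simp: numeral_eq_enat)
    then have "c \<le> - sqrt 2 / 2" using B_m_ge[OF sS tS, of 4] by (simp add: c_def cos_45)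
    then have "1 / 2 \<le> c\<^sup>2" using power_mono[of "sqrt 2 / 2" "- c" 2] by (simp add: power2_eq_square)
    then have "2 * (1 / 2) \<le> real d * c\<^sup>2" using that by (intro mult_mono) auto
    then show False using form by simp
  qed
  have star_closed: "u \<in> insert t (nbr X t)"
    if v: "v \<in> insert t (nbr X t)" and u: "u \<in> X \<union> Y" "m v u \<noteq> 2" for u v
  proof (cases "v = t")
    case True
    then show ?thesis using nbr_cases[OF u] nY by auto
  next
    case False
    then have "v \<in> nbr X t" using v by simp
    then show ?thesis using nbr_cases[OF u] leaf(4,5)[of v] by auto
  qed
  have leaf_m2: "m u v = 2" if "u \<in> nbr X t" "v \<in> nbr X t" "u \<noteq> v" for u v
  proof (rule ccontr)
    assume "m u v \<noteq> 2"
    then have "v \<in> nbr X u" using leaf(1)[OF that(2)] that(3) by (simp add: nbr_def)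
    then show False using leaf(4)[OF that(1)] by simp
  qed
  \<comment> \<open>Numbering the leaves by \<open>{1..d}\<close> treats \<open>graph2\<close> and
    \<open>graph5\<close> in one argument.\<close>
  have star_copy: "bi_orbit m E Y X"
    if E: "bigraph_connected E" "bigraph_vertices E = insert (XV 1) (YV ` {1..d})"
      "\<And>i. i \<in> {1..d} \<Longrightarrow> bigraph_matrix E (XV 1) (YV i) = 3"
      "\<And>i. i \<in> {1..d} \<Longrightarrow> bigraph_matrix E (YV i) (XV 1) = 3"
      "\<And>i j. \<lbrakk>i \<in> {1..d}; j \<in> {1..d}; i \<noteq> j\<rbrakk> \<Longrightarrow> bigraph_matrix E (YV i) (YV j) = 2"
      and d2: "2 \<le> d" for E
  proof -
    obtain h where h: "bij_betw h {1..d} (nbr X t)"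
      using ex_bij_betw_nat_finite_1[OF nbr_finite[OF Xo]] by (auto simp: d_def)
    have hn: "h i \<in> nbr X t" if "i \<in> {1..d}" for i using h that by (rule bij_betwE[THEN bspec])
    have hne: "h i = h j \<longleftrightarrow> i = j" if "i \<in> {1..d}" "j \<in> {1..d}" for i j
      using inj_on_eq_iff[OF bij_betw_imp_inj_on[OF h] that] .
    define \<phi> where "\<phi> v = (case v of XV _ \<Rightarrow> t | YV i \<Rightarrow> h i)" for v
    have \<phi>_simps: "\<phi> (XV i) = t" "\<phi> (YV i) = h i" for i by (simp_all add: \<phi>_def)
    have im: "\<phi> ` bigraph_vertices E = insert t (nbr X t)"
      unfolding E(2) using h by (simp add: \<phi>_simps image_image bij_betw_def)
    show ?thesis
    proof (rule bi_orbitI[OF Yo Xo E(1), of \<phi>])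
      show "u \<in> \<phi> ` bigraph_vertices E"
        if "a \<in> bigraph_vertices E" "u \<in> Y \<union> X" "m (\<phi> a) u \<noteq> 2" for a u
        using star_closed[of "\<phi> a" u] that im by blast
      have YY: "m (h i) (h j) = bigraph_matrix E (YV i) (YV j)" if "i \<in> {1..d}" "j \<in> {1..d}" for i j
        using leaf_m2[OF hn[OF that(1)] hn[OF that(2)]] hne[OF that] E(5)[OF that]
          m_same[OF leaf(2)[OF hn[OF that(1)]]] by (cases "i = j") auto
      show "m (\<phi> a) (\<phi> b) = bigraph_matrix E a b"
        if "a \<in> bigraph_vertices E" "b \<in> bigraph_vertices E" for a b
        using that E(3,4) YY m3[OF d2] leaf(6,7)[OF hn] m_same[OF tS]
        unfolding E(2) by (elim insertE imageE) (simp_all add: \<phi>_simps)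
      show "inj_on \<phi> (bigraph_vertices E)"
        unfolding E(2) using hne leaf(3)[OF hn] by (force simp: \<phi>_simps inj_on_def)
    qed (use t leaf(1)[OF hn] d2 E(2) in \<open>auto simp: \<phi>_simps\<close>)
  qed
  consider "d = 1" | "d = 2" | "d = 3" using d_pos d_less by linarith
  then show ?thesis
  proof cases
    case 1
    then have n: "nbr X t = {s}"
      using s_leaf by (intro card_eq_1_imp) (auto simp: d_def)
    define \<phi> where "\<phi> v = (case v of XV _ \<Rightarrow> s | YV _ \<Rightarrow> t)" for v
    have im: "\<phi> ` bigraph_vertices (graph1 (m s t)) = insert t (nbr X t)"
      unfolding n bigraph_vertices_graphs by (auto simp: \<phi>_def)
    have ms: "m t s = m s t" "m s s = 1" "m t t = 1" using m_sym[OF tS sS] m_same sS tS by auto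
    have "bi_orbit m (graph1 (m s t)) X Y"
    proof (rule bi_orbitI[OF Xo Yo, of _ \<phi>])
      show "bigraph_connected (graph1 (m s t))" using st by (rule bigraph_connected_graph1)
      show "u \<in> \<phi> ` bigraph_vertices (graph1 (m s t))"
        if "a \<in> bigraph_vertices (graph1 (m s t))" "u \<in> X \<union> Y" "m (\<phi> a) u \<noteq> 2" for a u
        using star_closed[of "\<phi> a" u] that im by blast
    qed (use st_ne s t ms in
        \<open>auto simp: bigraph_vertices_graphs \<phi>_def bigraph_matrix_graph1\<close>)
    then show ?thesis by blast
  next
    case 2
    then have "{1..d} = {1, 2}" by auto
    then have "bi_orbit m graph2 Y X"
      by (intro star_copy bigraph_connected_graph2)
        (auto simp: bigraph_vertices_graphs bigraph_matrix_graph2 2)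
    then show ?thesis by blast
  next
    case 3
    then have "{1..d} = {1, 2, 3}" by auto
    then have "bi_orbit m graph5 Y X"
      by (intro star_copy bigraph_connected_graph5)
        (auto simp: bigraph_vertices_graphs bigraph_matrix_graph5 3)
    then show ?thesis by blast
  qed
qed

text \<open>An edge inside \<open>X\<close> gives k \<le> 1/2, while p and q are at least 1/2
  because \<open>s\<close> and \<open>t\<close> are joined. Then p q < k l leaves no room for an
  edge inside \<open>Y\<close> at \<open>t\<close>, for a second neighbour of \<open>s\<close> in
  \<open>Y\<close> or of \<open>t\<close> in \<open>X\<close>, for a label above 3 between them, or
  for a label above 4 inside \<open>X\<close>. What remains is a path with its two middle vertices
  in \<open>X\<close>.\<close>

lemma bi_orbit_path:
  assumes X: "X \<in> fin_orb" and Y: "Y \<in> fin_orb" and ne: "X \<noteq> Y" and s: "s \<in> X" and t: "t \<in> Y"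
    and st: "m s t \<noteq> 2" and nX: "nbr X s \<noteq> {}"
    and small: "- 1 < folded_form X Y"
  shows "bi_orbit m graph3 Y X \<or> bi_orbit m graph4 Y X"
proof -
  note Xo = fin_orb_orb[OF X] and Yo = fin_orb_orb[OF Y]
  have XY: "X \<inter> Y = {}" by (rule orb_disjoint[OF Xo Yo ne])
  have sS: "s \<in> S" and tS: "t \<in> S" using s t orb_subset Xo Yo by auto
  have sY: "s \<notin> Y" and tX: "t \<notin> X" and st_ne: "t \<noteq> s" using s t XY by auto
  have c1: "card (nbr X s) = 1"
    using nbr_own_le_1[OF X s] nX nbr_finite[OF Xo] by (simp add: le_Suc_eq One_nat_def)
  then obtain s' where ns: "nbr X s = {s'}" by (rule card_1_singletonE)
  then have s': "s' \<in> X" "s' \<noteq> s" "m s s' \<noteq> 2" by (auto simp: nbr_def)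
  have s'S: "s' \<in> S" using s'(1) orb_subset[OF Xo] by blast
  have tn: "t \<in> nbr Y s" using t st st_ne by (simp add: nbr_def)
  have sn: "s \<in> nbr X t" using s st st_ne m_sym[OF sS tS] by (simp add: nbr_def)
  define p q where "p = - B (root_sum Y) (\<epsilon> s)" and "q = - B (root_sum X) (\<epsilon> t)"
  define k l where "k = B (root_sum X) (\<epsilon> s)" and "l = B (root_sum Y) (\<epsilon> t)"
  have less: "p * q < k * l"
    using small_form[OF X Y ne s t small] by (simp add: p_def q_def k_def l_def)
  have k_eq: "k = 1 + B (\<epsilon> s) (\<epsilon> s')"
    using B_root_sum_nbr[OF Xo sS] s by (simp add: k_def ns)
  have k: "0 < k" "k \<le> 1 / 2"
    using B_root_sum_pos[OF X s] B_nbr[OF sS s'S s'(2,3)] k_eq by (auto simp: k_def)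
  have l: "0 < l" "l \<le> 1 - real (card (nbr Y t)) / 2"
    using B_root_sum_pos[OF Y t] B_root_sum_le[OF Yo tS] t by (auto simp: l_def)
  have p: "real (card (nbr Y s)) / 2 \<le> p" and q: "real (card (nbr X t)) / 2 \<le> q"
    using B_root_sum_le[OF Yo sS] B_root_sum_le[OF Xo tS] sY tX by (auto simp: p_def q_def)
  have cards: "1 \<le> card (nbr Y s)" "1 \<le> card (nbr X t)"
    using tn sn nbr_finite[OF Yo, of s] nbr_finite[OF Xo, of t] by (auto simp: Suc_le_eq card_gt_0_iff One_nat_def)
  have p2: "1 / 2 \<le> p" and q2: "1 / 2 \<le> q" using p q cards by auto
  have kl: "k * l \<le> 1 / 2 * 1" using k l by (intro mult_mono) auto
  have "nbr Y t = {}"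
  proof (rule ccontr)
    assume "nbr Y t \<noteq> {}"
    then have "1 \<le> card (nbr Y t)" using nbr_finite[OF Yo, of t] by (simp add: Suc_le_eq card_gt_0_iff One_nat_def)
    then have "l \<le> 1 / 2" using l by simp
    then have "k * l \<le> 1 / 2 * (1 / 2)" using k l by (intro mult_mono) auto
    moreover have "1 / 2 * (1 / 2) \<le> p * q" using p2 q2 by (intro mult_mono) auto
    ultimately show False using less by simp
  qed
  then have l1: "l = 1" and nt: "nbr Y t = {}" using B_root_sum_nbr[OF Yo tS] t by (simp_all add: l_def)
  have cY: "card (nbr Y s) = 1"
  proof (rule ccontr)
    assume "card (nbr Y s) \<noteq> 1"
    then have "1 \<le> p" using p cards by simp
    then have "1 * (1 / 2) \<le> p * q" using q2 by (intro mult_mono) auto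
    then show False using less kl by simp
  qed
  have cX: "card (nbr X t) = 1"
  proof (rule ccontr)
    assume "card (nbr X t) \<noteq> 1"
    then have "1 \<le> q" using q cards by simp
    then have "1 / 2 * 1 \<le> p * q" using p2 by (intro mult_mono) auto
    then show False using less kl by simp
  qed
  have nYs: "nbr Y s = {t}" and nXt: "nbr X t = {s}"
    using cY cX tn sn by (simp_all add: card_eq_1_imp)
  define c where "c = B (\<epsilon> s) (\<epsilon> t)"
  have pq: "p = - c" "q = - c"
    using B_root_sum_nbr[OF Yo sS] B_root_sum_nbr[OF Xo tS] sY tX B_sym[of "\<epsilon> s" "\<epsilon> t"] sS tS
    by (simp_all add: p_def q_def nYs nXt c_def)
  have m_st: "m s t = 3"
  proof (rule ccontr)
    assume m: "m s t \<noteq> 3"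
    have "enat 4 \<le> m s t"
      using nbr_ge_3[OF sS tS st_ne st] m by (cases "m s t") (auto simp: numeral_eq_enat)
    then have "sqrt 2 / 2 \<le> - c" using B_m_ge[OF sS tS, of 4] by (simp add: c_def cos_45)
    then have "1 / 2 \<le> p * q"
      using power_mono[of "sqrt 2 / 2" "- c" 2] by (simp add: pq power2_eq_square)
    then show False using less kl by simp
  qed
  have m_ss: "m s s' = 3 \<or> m s s' = 4"
  proof (rule ccontr)
    assume m: "\<not> ?thesis"
    have "enat 5 \<le> m s s'"
      using nbr_ge_3[OF sS s'S s'(2,3)] m by (cases "m s s'") (auto simp: numeral_eq_enat)
    then have "k \<le> 1 - cos (pi / 5)" using B_m_ge[OF sS s'S, of 5] by (simp add: k_eq)
    then have "k < 1 / 4" using cos_pi_5_gt by simp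
    moreover have "1 / 2 * (1 / 2) \<le> p * q" using p2 q2 by (intro mult_mono) auto
    ultimately show False using less l1 by simp
  qed
  \<comment> \<open>A symmetry that carries \<open>s\<close> to its neighbour \<open>s'\<close>
    carries \<open>t\<close> to the other end of the path, so the second half inherits its edges
    from the first.\<close>
  obtain g where g: "g \<in> G" "s' = g s" using orb_transitive[OF Xo s s'(1)] .
  define t' where "t' = g t"
  have t': "t' \<in> Y" "t' \<in> S" using orb_closed[OF Yo g(1) t] g tS by (auto simp: t'_def)
  have nYs': "nbr Y s' = {t'}" and nXt': "nbr X t' = {s'}" and nt': "nbr Y t' = {}"
    using nbr_image[OF Yo sS g(1)] nbr_image[OF Xo tS g(1)] nbr_image[OF Yo tS g(1)]
    by (simp_all add: g(2) t'_def nYs nXt nt)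
  have nXs': "nbr X s' = {s}"
  proof -
    have "s \<in> nbr X s'" using s s'(2,3) m_sym[OF sS s'S] by (simp add: nbr_def)
    moreover have "card (nbr X s') \<le> 1" by (rule nbr_own_le_1[OF X s'(1)])
    ultimately show ?thesis using nbr_finite[OF Xo, of s'] by (auto simp: card_le_Suc0_iff_eq One_nat_def)
  qed
  have m_st': "m s' t' = 3" using G_m[OF g(1) sS tS] g(2) m_st by (simp add: t'_def)
  have t'_ne: "t' \<noteq> t" using nXt nXt' s'(2) by auto
  have m_tt': "m t t' = 2" using nt t'(1) t'_ne by (auto simp: nbr_def)
  have m_st2: "m s t' = 2" using nYs t'(1) t'_ne sY by (auto simp: nbr_def)
  have m_s't: "m s' t = 2" using nYs' t t'_ne s'(1) XY by (auto simp: nbr_def)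
  note ms = m_st m_st' m_tt' m_st2 m_s't
    m_sym[OF tS sS] m_sym[OF t'(2) s'S] m_sym[OF t'(2) tS] m_sym[OF t'(2) sS] m_sym[OF tS s'S]
    m_sym[OF s'S sS] m_same[OF sS] m_same[OF s'S] m_same[OF tS] m_same[OF t'(2)]
  \<comment> \<open>In \<open>graph3\<close> and \<open>graph4\<close> the inner vertices are the
    \<open>YV\<close> ones, while here they are \<open>s\<close> and \<open>s'\<close> from
    \<open>X\<close>; hence the orbits change places.\<close>
  define \<phi> where "\<phi> v = (case v of XV i \<Rightarrow> if i = 1 then t else t' | YV i \<Rightarrow> if i = 1 then s else s')" for v
  have closed: "u \<in> {s, s', t, t'}" if "v \<in> {s, s', t, t'}" "u \<in> Y \<union> X" "m v u \<noteq> 2" for u v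
    using that(1) nbr_cases[OF that(2,3)] by (auto simp: ns nXs' nYs nYs' nXt nXt' nt nt')
  have dist: "s \<noteq> s'" "s \<noteq> t" "s \<noteq> t'" "s' \<noteq> t" "s' \<noteq> t'" "t \<noteq> t'"
    using s' st_ne t'_ne t' s t XY by auto
  have copy: "bi_orbit m E Y X"
    if E: "bigraph_connected E" "bigraph_vertices E = {XV 1, XV 2, YV 1, YV 2}"
      "\<And>a b. \<lbrakk>a \<in> bigraph_vertices E; b \<in> bigraph_vertices E\<rbrakk> \<Longrightarrow> m (\<phi> a) (\<phi> b) = bigraph_matrix E a b" for E
  proof (rule bi_orbitI[OF Yo Xo E(1), of \<phi>])
    have im: "\<phi> ` bigraph_vertices E = {s, s', t, t'}" unfolding E(2) by (auto simp: \<phi>_def)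
    show "u \<in> \<phi> ` bigraph_vertices E"
      if "a \<in> bigraph_vertices E" "u \<in> Y \<union> X" "m (\<phi> a) u \<noteq> 2" for a u
      using closed[of "\<phi> a" u] that im by blast
    show "inj_on \<phi> (bigraph_vertices E)" unfolding E(2) using dist by (auto simp: \<phi>_def inj_on_def)
  qed (use E(2,3) s s' t t' in \<open>auto simp: \<phi>_def split: if_splits\<close>)
  from m_ss show ?thesis
  proof
    assume m: "m s s' = 3"
    have "bi_orbit m graph3 Y X"
      by (rule copy[OF bigraph_connected_graph3]; unfold bigraph_vertices_graphs)
        (auto simp: \<phi>_def bigraph_matrix_graph3 ms m)
    then show ?thesis by blast
  next
    assume m: "m s s' = 4"
    have "bi_orbit m graph4 Y X"
      by (rule copy[OF bigraph_connected_graph4]; unfold bigraph_vertices_graphs)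
        (auto simp: \<phi>_def bigraph_matrix_graph4 ms m)
    then show ?thesis by blast
  qed
qed

end

section \<open>From the classification to the entries of the folded matrix\<close>

context folding
begin

lemma orbit_pair_classification:
  assumes X: "X \<in> fin_orb" and Y: "Y \<in> fin_orb" and ne: "X \<noteq> Y" and s: "s \<in> X" and t: "t \<in> Y"
    and st: "m s t \<noteq> 2"
    and small: "- 1 < folded_form X Y"
  shows "(\<exists>l\<ge>3. bi_orbit_sym m (graph1 l) X Y) \<or> bi_orbit_sym m graph2 X Y \<or>
    bi_orbit_sym m graph3 X Y \<or> bi_orbit_sym m graph4 X Y \<or> bi_orbit_sym m graph5 X Y"
proof -
  note Xo = fin_orb_orb[OF X] and Yo = fin_orb_orb[OF Y]
  have XY: "X \<inter> Y = {}" by (rule orb_disjoint[OF Xo Yo ne])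
  have sS: "s \<in> S" and tS: "t \<in> S" using s t orb_subset Xo Yo by auto
  have ts: "m t s \<noteq> 2" using st m_sym[OF sS tS] by simp
  have l3: "3 \<le> m s t" "3 \<le> m t s"
    using nbr_ge_3[OF sS tS _ st] nbr_ge_3[OF tS sS _ ts] s t XY by auto
  have small': "- 1 < folded_form Y X"
    using small B_sym[OF VG_V[OF folded_root_VG[OF Xo]] VG_V[OF folded_root_VG[OF Yo]]] by simp
  show ?thesis
  proof (cases "nbr X s = {} \<and> nbr Y t = {}")
    case False
    then have "bi_orbit m graph3 Y X \<or> bi_orbit m graph4 Y X \<or> bi_orbit m graph3 X Y \<or> bi_orbit m graph4 X Y"
      using bi_orbit_path[OF X Y ne s t st _ small] bi_orbit_path[OF Y X ne[symmetric] t s ts _ small']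
      by blast
    then show ?thesis by (auto simp: bi_orbit_sym_def)
  next
    case True
    \<comment> \<open>Without inner edges both own values are 1. Two neighbours on both sides would
      make each mixed value at most -1 and their product at least 1, against
      \<open>small_form\<close>.\<close>
    have cases: "card (nbr Y s) = 1 \<or> card (nbr X t) = 1"
    proof (rule ccontr)
      assume *: "\<not> ?thesis"
      have "t \<in> nbr Y s" "s \<in> nbr X t" using s t st ts XY by (auto simp: nbr_def)
      then have "card (nbr Y s) \<noteq> 0" "card (nbr X t) \<noteq> 0" using nbr_finite Xo Yo by auto
      then have "2 \<le> card (nbr Y s)" "2 \<le> card (nbr X t)" using * by linarith+
      moreover have "s \<notin> Y" "t \<notin> X" using s t XY by auto
      ultimately have "1 \<le> - B (root_sum Y) (\<epsilon> s)" "1 \<le> - B (root_sum X) (\<epsilon> t)"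
        using B_root_sum_le[OF Yo sS] B_root_sum_le[OF Xo tS] by auto
      then have "1 * 1 \<le> (- B (root_sum Y) (\<epsilon> s)) * (- B (root_sum X) (\<epsilon> t))"
        by (intro mult_mono) auto
      moreover have "B (root_sum X) (\<epsilon> s) = 1" "B (root_sum Y) (\<epsilon> t) = 1"
        using B_root_sum_nbr[OF Xo sS] B_root_sum_nbr[OF Yo tS] s t True by simp_all
      ultimately show False using small_form[OF X Y ne s t small] by simp
    qed
    then show ?thesis
    proof
      assume "card (nbr Y s) = 1"
      then show ?thesis
        using bi_orbit_star[OF X Y ne s t st _ _ _ small] True l3 by (auto simp: bi_orbit_sym_def)
    next
      assume "card (nbr X t) = 1"
      then show ?thesis
        using bi_orbit_star[OF Y X ne[symmetric] t s ts _ _ _ small'] True l3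
        by (auto simp: bi_orbit_sym_def)
    qed
  qed
qed

text \<open>By transitivity every joined pair between the orbits is a translate of the edge of one
  copy. So all such pairs share one label, which makes the description by \<open>THE\<close> in
  \<open>folded_matrix\<close> meaningful.\<close>

lemma bi_orbit_graph1_label:
  assumes X: "X \<in> fin_orb" and Y: "Y \<in> fin_orb" and ne: "X \<noteq> Y" and bi: "bi_orbit m (graph1 l) X Y"
    and s: "s \<in> X" and t: "t \<in> Y" and st: "m s t \<noteq> 2"
  shows "m s t = l" "folded_form X Y = B (\<epsilon> s) (\<epsilon> t)"
proof -
  note Xo = fin_orb_orb[OF X] and Yo = fin_orb_orb[OF Y]
  from bi_orbit_graph1[OF X Y ne bi] obtain s0 t0 where st0: "s0 \<in> X" "t0 \<in> Y" "m s0 t0 = l"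
    "folded_form X Y = B (\<epsilon> s0) (\<epsilon> t0)"
    and uniq: "\<And>u. \<lbrakk>u \<in> Y; m s0 u \<noteq> 2\<rbrakk> \<Longrightarrow> u = t0"
    by metis
  have S: "s0 \<in> S" "t0 \<in> S" "t \<in> S" using st0 t orb_subset Xo Yo by auto
  obtain g where g: "g \<in> G" "s = g s0" using orb_transitive[OF Xo st0(1) s] .
  obtain h where h: "h \<in> G" "\<And>u. u \<in> S \<Longrightarrow> g (h u) = u"
    using G_inverse_apply[OF g(1)] by blast
  have hS: "h t \<in> S" using h(1) S by simp
  have "m s0 (h t) = m s t" using G_m[OF g(1) S(1) hS] g(2) h(2)[OF S(3)] by simp
  then have "h t = t0" using uniq[OF orb_closed[OF Yo h(1) t]] st by simp
  then have gt: "g t0 = t" using h(2)[OF S(3)] by simp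
  show "m s t = l" using G_m[OF g(1) S(1,2)] g(2) gt st0(3) by simp
  show "folded_form X Y = B (\<epsilon> s) (\<epsilon> t)"
    using B_image[OF g(1) S(1,2)] g(2) gt st0(4) by simp
qed

lemma folded_root_sym:
  "\<lbrakk>X \<in> orb; Y \<in> orb\<rbrakk> \<Longrightarrow>
    folded_form X Y = folded_form Y X"
  by (rule B_sym[OF VG_V[OF folded_root_VG] VG_V[OF folded_root_VG]])

lemma bi_orbit_sym_graph1_label:
  assumes X: "X \<in> fin_orb" and Y: "Y \<in> fin_orb" and ne: "X \<noteq> Y"
    and bi: "bi_orbit_sym m (graph1 l) X Y" and s: "s \<in> X" and t: "t \<in> Y" and st: "m s t \<noteq> 2"
  shows "m s t = l \<and> folded_form X Y = B (\<epsilon> s) (\<epsilon> t)"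
proof -
  note Xo = fin_orb_orb[OF X] and Yo = fin_orb_orb[OF Y]
  have S: "s \<in> S" "t \<in> S" using s t orb_subset Xo Yo by auto
  show ?thesis
  proof (cases "bi_orbit m (graph1 l) X Y")
    case True
    then show ?thesis using bi_orbit_graph1_label[OF X Y ne _ s t st] by blast
  next
    case False
    then have "bi_orbit m (graph1 l) Y X" using bi by (simp add: bi_orbit_sym_def)
    moreover have "m t s \<noteq> 2" using st m_sym[OF S] by simp
    ultimately show ?thesis
      using bi_orbit_graph1_label[OF Y X ne[symmetric] _ t s] m_sym[OF S] folded_root_sym[OF Xo Yo]
        B_sym[of "\<epsilon> s" "\<epsilon> t"] S by simp
  qed
qed

lemma B_folded_le_0:
  assumes "X \<in> fin_orb" "Y \<in> fin_orb" "X \<noteq> Y"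
  shows "folded_form X Y \<le> 0"
proof -
  obtain s t where st: "s \<in> X" "t \<in> Y" using assms fin_orb_orb orb_nonempty by blast
  have "0 \<le> B (root_sum Y) (\<epsilon> s) * B (root_sum X) (\<epsilon> t)"
    using B_root_sum_other[of X Y s] B_root_sum_other[of Y X t] st assms
    by (intro mult_nonpos_nonpos) (auto simp: fin_orb_orb)
  then show ?thesis
    unfolding B_folded_roots[OF assms st]
    using B_root_sum_pos[of X s] B_root_sum_pos[of Y t] st assms by simp
qed

text \<open>Follows the cascade of cases in \<open>folded_matrix\<close>. In all but the last a
  bi-orbit or orthogonality gives the value of the form; the last is where the classification
  enters.\<close>

lemma folded_matrix_value:
  assumes X: "X \<in> fin_orb" and Y: "Y \<in> fin_orb" and ne: "X \<noteq> Y"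
  shows "2 \<le> folded_matrix m X Y \<and>
    (case folded_matrix m X Y of
      enat n \<Rightarrow> folded_form X Y = - cos (pi / real n)
    | \<infinity> \<Rightarrow> folded_form X Y \<le> - 1)"
    (is "_ \<and> ?P (folded_matrix m X Y)")
proof -
  let ?b = "folded_form X Y"
  note Xo = fin_orb_orb[OF X] and Yo = fin_orb_orb[OF Y]
  have XY: "X \<inter> Y = {}" by (rule orb_disjoint[OF Xo Yo ne])
  have sym_value: "?b = - cos (pi / real n)"
    if "bi_orbit_sym m E X Y"
      "\<And>X Y. \<lbrakk>X \<in> fin_orb; Y \<in> fin_orb; X \<noteq> Y; bi_orbit m E X Y\<rbrakk> \<Longrightarrow>
        folded_form X Y = - cos (pi / real n)" for E n
    using that(1) that(2)[OF X Y ne] that(2)[OF Y X ne[symmetric]] folded_root_sym[OF Xo Yo]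
    by (auto simp: bi_orbit_sym_def)
  show ?thesis
  proof (cases "\<forall>s\<in>X. \<forall>t\<in>Y. m s t = 2")
    case True
    obtain s t where st: "s \<in> X" "t \<in> Y" using orb_nonempty Xo Yo by blast
    have "nbr Y s = {}" "s \<notin> Y" "s \<in> S" using True st XY orb_subset[OF Xo] by (auto simp: nbr_def)
    then have "B (root_sum Y) (\<epsilon> s) = 0" using B_root_sum_nbr[OF Yo] by simp
    \<comment> \<open>Zero is \<open>- cos (pi / 2)\<close>, the value prescribed by the label
      2.\<close>
    then have "?b = 0" using B_folded_roots[OF X Y ne st] by simp
    moreover have "folded_matrix m X Y = 2" using True ne by (simp add: folded_matrix_def)
    ultimately show ?thesis by (simp add: numeral_eq_enat)
  next
    case False
    then obtain s t where s: "s \<in> X" and t: "t \<in> Y" and st: "m s t \<noteq> 2" by blast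
    have S: "s \<in> S" "t \<in> S" and st_ne: "t \<noteq> s" using s t orb_subset Xo Yo XY by auto
    show ?thesis
    proof (cases "\<exists>l\<ge>3. bi_orbit_sym m (graph1 l) X Y")
      case True
      then obtain l where l: "3 \<le> l" "bi_orbit_sym m (graph1 l) X Y" by blast
      have lab: "m s t = k" and b: "?b = B (\<epsilon> s) (\<epsilon> t)" if "bi_orbit_sym m (graph1 k) X Y" for k
        using bi_orbit_sym_graph1_label[OF X Y ne that s t st] by auto
      have "(THE l. 3 \<le> l \<and> bi_orbit_sym m (graph1 l) X Y) = m s t"
        using l lab by (intro the_equality) auto
      then have eq: "folded_matrix m X Y = m s t"
        unfolding folded_matrix_def using True False ne by (simp only: if_True if_False simp_thms)
      have "?P (m s t)"
        unfolding b[OF l(2)]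
        using root_finite[OF S st_ne[symmetric]] root_infinite[OF S st_ne[symmetric]]
        by (auto split: enat.splits)
      moreover have "2 \<le> m s t" using m_ge_2[OF S] st_ne by simp
      ultimately show ?thesis using eq by simp
    next
      case no1: False
      show ?thesis
      proof (cases "bi_orbit_sym m graph2 X Y \<or> bi_orbit_sym m graph3 X Y")
        case True
        then have "?b = - cos (pi / real 4)"
          using sym_value[of graph2 4] sym_value[of graph3 4] bi_orbit_value_graph2 bi_orbit_value_graph3 by auto
        moreover have "folded_matrix m X Y = 4"
          unfolding folded_matrix_def using True False no1 ne by (simp only: if_True if_False simp_thms)
        ultimately show ?thesis by (simp add: numeral_eq_enat)
      next
        case no23: False
        show ?thesis
        proof (cases "bi_orbit_sym m graph4 X Y")
          case True
          then have "?b = - cos (pi / real 8)"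
            using sym_value[of graph4 8] bi_orbit_value_graph4 by auto
          moreover have "folded_matrix m X Y = 8"
            unfolding folded_matrix_def using True False no1 no23 ne by (simp only: if_True if_False simp_thms)
          ultimately show ?thesis by (simp add: numeral_eq_enat)
        next
          case no4: False
          show ?thesis
          proof (cases "bi_orbit_sym m graph5 X Y")
            case True
            then have "?b = - cos (pi / real 6)"
              using sym_value[of graph5 6] bi_orbit_value_graph5 by auto
            moreover have "folded_matrix m X Y = 6"
              unfolding folded_matrix_def using True False no1 no23 no4 ne by (simp only: if_True if_False simp_thms)
            ultimately show ?thesis by (simp add: numeral_eq_enat)
          next
            case no5: False
            have "folded_matrix m X Y = \<infinity>"
              unfolding folded_matrix_def using False no1 no23 no4 no5 ne by (simp only: if_True if_False simp_thms)
            \<comment> \<open>The classification read backwards: a value above -1 would make the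
              pair a bi-orbit of one of the five types.\<close>
            moreover have "?b \<le> - 1"
              using orbit_pair_classification[OF X Y ne s t st] no1 no23 no4 no5 by force
            ultimately show ?thesis by simp
          qed
        qed
      qed
    qed
  qed
qed

lemma folded_matrix_sym:
  assumes "X \<in> orb" "Y \<in> orb"
  shows "folded_matrix m X Y = folded_matrix m Y X"
proof -
  have eq: "X = Y \<longleftrightarrow> Y = X" by auto
  have sym: "bi_orbit_sym m E X Y = bi_orbit_sym m E Y X" for E by (auto simp: bi_orbit_sym_def)
  have all: "(\<forall>s\<in>X. \<forall>t\<in>Y. m s t = 2) \<longleftrightarrow> (\<forall>s\<in>Y. \<forall>t\<in>X. m s t = 2)"
    using m_sym orb_subset[OF assms(1)] orb_subset[OF assms(2)] by (metis subsetD)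
  show ?thesis unfolding folded_matrix_def by (simp only: eq sym all)
qed

lemma folded_coxeter_matrix: "coxeter_matrix fin_orb (folded_matrix m)"
  using folded_matrix_sym folded_matrix_value fin_orb_orb
  by (auto simp: coxeter_matrix_def folded_matrix_def[of m X X for X])

section \<open>The folded root basis\<close>

lemma finite_dim_VG: "finite_dim_space VG"
proof -
  obtain b where b: "finite b" "V = span b" using finite_dim by (auto simp: finite_dim_space_def)
  obtain c where c: "c \<subseteq> VG" "independent c" "VG \<subseteq> span c"
    using maximal_independent_subset by metis
  have "c \<subseteq> span b" using c(1) VG_V b(2) by auto
  then have "finite c" using independent_span_bound[OF b(1) c(2)] by blast
  moreover have "span c = VG" using c span_minimal[OF c(1) subspace_VG] by blast
  ultimately show ?thesis unfolding finite_dim_space_def by blast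
qed

lemma folded_root_basis: "root_basis VG B fin_orb (folded_matrix m) (folded_root B \<epsilon>)"
  unfolding root_basis_def
proof (intro conjI ballI impI)
  show "finite_dim_space VG" by (rule finite_dim_VG)
  show "symmetric_bilinear_on VG B"
    using form VG_V unfolding symmetric_bilinear_on_def linear_on_def by blast
  show "folded_root B \<epsilon> ` fin_orb \<subseteq> VG" using folded_root_VG fin_orb_orb by auto
  show "inj_on (folded_root B \<epsilon>) fin_orb"
  proof (rule inj_onI, rule ccontr)
    fix X Y assume "X \<in> fin_orb" "Y \<in> fin_orb" "folded_root B \<epsilon> X = folded_root B \<epsilon> Y" "X \<noteq> Y"
    \<comment> \<open>Equal roots would give the form the value 1, but distinct orbits give at most
      0.\<close>
    then show False using B_folded_le_0[of X Y] folded_root_norm[of X] by simp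
  qed
  show "folded_form X X = 1" if "X \<in> fin_orb" for X
    using that by (rule folded_root_norm)
  show "case folded_matrix m X Y of
      enat n \<Rightarrow> folded_form X Y = - cos (pi / real n)
    | \<infinity> \<Rightarrow> folded_form X Y \<le> - 1"
    if "X \<in> fin_orb" "Y \<in> fin_orb" "X \<noteq> Y" for X Y
    using folded_matrix_value[OF that] by blast
  obtain \<chi> :: "'v \<Rightarrow> real" where \<chi>: "linear_on V \<chi>" "\<And>s. s \<in> S \<Longrightarrow> 0 < \<chi> (\<epsilon> s)"
    using root_basis unfolding root_basis_def by blast
  have "0 < \<chi> (folded_root B \<epsilon> X)" if X: "X \<in> fin_orb" for X
  proof -
    note Xo = fin_orb_orb[OF X]
    note XS = orb_subset[OF Xo]
    have "\<chi> (root_sum X) = (\<Sum>s\<in>X. \<chi> (\<epsilon> s))"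
      unfolding root_sum_def using XS by (intro linear_on_sum[OF \<chi>(1) subspace_V]) auto
    also have "\<dots> > 0" using orb_finite[OF Xo] orb_nonempty[OF Xo] XS \<chi>(2) by (intro sum_pos) auto
    finally show ?thesis
      unfolding folded_root_eq linear_on_scale[OF \<chi>(1) root_sum_V[OF XS]]
      using root_sum_norm_pos[OF X] by simp
  qed
  moreover have "linear_on VG \<chi>" using \<chi>(1) VG_V by (auto simp: linear_on_def)
  ultimately show "\<exists>\<chi> :: 'v \<Rightarrow> real. linear_on VG \<chi> \<and> (\<forall>X\<in>fin_orb. 0 < \<chi> (folded_root B \<epsilon> X))"
    by blast
qed

abbreviation fG :: "'w \<Rightarrow> 'v \<Rightarrow> 'v" where
  "fG u \<equiv> restrict (f u) VG"

text \<open>The restriction is forced by \<open>GL\<close>, whose elements are extensional on the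
  space. Bijectivity on the fixed space comes from the inverse element, which is fixed as
  well.\<close>

lemma fG_rooted_rep:
  "is_rooted_rep (W\<lparr>carrier := WG\<rparr>) fin_orb longest VG B (folded_root B \<epsilon>) fG"
  unfolding is_rooted_rep_def
proof (intro conjI ballI)
  have GL: "fG u \<in> carrier (GL VG)" if u: "u \<in> WG" for u
  proof -
    have i: "inv u \<in> WG" by (rule subgroup.m_inv_closed[OF WG_subgroup u])
    have "f u (f (inv u) x) = x" if "x \<in> VG" for x
      using f_mult[of u "inv u" x] WG_carrier[OF u] VG_V[OF that] by (simp add: f_one)
    then have "bij_betw (f u) VG VG"
      using WG_VG[OF u] WG_VG[OF i] f_inv[OF WG_carrier[OF u] VG_V]
      by (intro bij_betw_byWitness[where f' = "f (inv u)"]) auto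
    then have "fG u \<in> Bij VG" by (simp add: Bij_def cong: bij_betw_cong)
    moreover have "linear_on VG (fG u)"
      using WG_carrier[OF u] subspace_VG VG_V
      by (auto simp: linear_on_def f_add f_scale subspace_add subspace_scale)
    ultimately show ?thesis by (simp add: carrier_GL)
  qed
  show "fG \<in> hom (W\<lparr>carrier := WG\<rparr>) (GL VG)"
  proof (rule homI)
    show "fG u \<in> carrier (GL VG)" if "u \<in> carrier (W\<lparr>carrier := WG\<rparr>)" for u
      using that GL by simp
    show "fG (u \<otimes>\<^bsub>W\<lparr>carrier := WG\<rparr>\<^esub> v) = fG u \<otimes>\<^bsub>GL VG\<^esub> fG v"
      if "u \<in> carrier (W\<lparr>carrier := WG\<rparr>)" "v \<in> carrier (W\<lparr>carrier := WG\<rparr>)" for u v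
      using that GL WG_carrier WG_VG VG_V
      by (auto simp: GL_mult compose_def f_mult restrict_def fun_eq_iff)
  qed
  show "fG (longest X) = reflection_on VG B (folded_root B \<epsilon> X)" if "X \<in> fin_orb" for X
    unfolding reflection_on_def using longest_reflection[OF that] by (intro restrict_ext) simp
qed

lemma folded_generators:
  "coxeter_generators (W\<lparr>carrier := WG\<rparr>) fin_orb (folded_matrix m) longest"
proof (rule subgroup_coxeter_generators[OF WG_subgroup folded_coxeter_matrix generate_longest])
  fix X Y n assume XY: "X \<in> fin_orb" "Y \<in> fin_orb" "folded_matrix m X Y = enat n"
  let ?W = "W\<lparr>carrier := WG\<rparr>"
  define p where "p = longest X \<otimes> longest Y"
  have l: "longest X \<in> WG" "longest Y \<in> WG" using longest_WG XY by auto
  have p: "p \<in> WG" unfolding p_def by (rule subgroup.m_closed[OF WG_subgroup l])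
  have W: "group ?W" by (rule subgroup.subgroup_is_group[OF WG_subgroup is_group])
  have h: "fG \<in> hom ?W (GL VG)" using fG_rooted_rep by (simp add: is_rooted_rep_def)
  \<comment> \<open>The power is taken in the subgroup because only there is \<open>fG\<close> a
    homomorphism into \<open>GL VG\<close>; \<open>nat_pow_consistent\<close> brings the result back
    to \<open>W\<close>.\<close>
  have "fG (p [^]\<^bsub>?W\<^esub> n) = fG p [^]\<^bsub>GL VG\<^esub> n"
    using hom_nat_pow[OF h _ W group_GL[OF subspace_VG], of p n] p by simp
  also have "fG p = reflection_on VG B (folded_root B \<epsilon> X) \<otimes>\<^bsub>GL VG\<^esub> reflection_on VG B (folded_root B \<epsilon> Y)"
    using hom_mult[OF h, of "longest X" "longest Y"] l fG_rooted_rep XY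
    by (simp add: p_def is_rooted_rep_def)
  also have "\<dots> [^]\<^bsub>GL VG\<^esub> n = \<one>\<^bsub>GL VG\<^esub>"
    by (rule reflections_relation[OF folded_coxeter_matrix folded_root_basis XY])
  finally have fGp: "fG (p [^] n) = (\<lambda>x\<in>VG. x)" 
    unfolding nat_pow_consistent[of p n WG, symmetric] GL_one .
  have pn: "p [^] n \<in> WG"
  proof -
    interpret WG: group ?W by (rule W)
    show ?thesis using WG.nat_pow_closed[of p n] p by (simp add: nat_pow_consistent[symmetric])
  qed
  have "f (p [^] n) x = x" if "x \<in> VG" for x using fun_cong[OF fGp, of x] that by simp
  then show "(longest X \<otimes> longest Y) [^] n = \<one>"
    unfolding p_def[symmetric] by (rule WG_faithful[OF pn])
qed

lemma finite_fin_orb: "finite fin_orb"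
proof (rule finite_subset)
  show "fin_orb \<subseteq> Pow S" using orb_subset fin_orb_orb by blast
qed (simp add: finite_S)

lemma folded_reflection_rep:
  "reflection_rep (W\<lparr>carrier := WG\<rparr>) fin_orb (folded_matrix m) longest VG B (folded_root B \<epsilon>) fG"
  by (intro reflection_rep.intro reflection_rep_axioms.intro folded_generators finite_fin_orb
      folded_root_basis fG_rooted_rep form_space_root_basis[OF folded_root_basis])

end

theorem theorem2p3:
  fixes W :: "('w, 'b) monoid_scheme"
    and S :: "'s set"
    and m :: "'s \<Rightarrow> 's \<Rightarrow> enat"
    and \<iota> :: "'s \<Rightarrow> 'w"
    and G :: "('s \<Rightarrow> 's) set"
    and V :: "'v::real_vector set"
    and B :: "'v \<Rightarrow> 'v \<Rightarrow> real"
    and \<epsilon> :: "'s \<Rightarrow> 'v"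
    and \<rho> :: "('s \<Rightarrow> 's) \<Rightarrow> 'v \<Rightarrow> 'v"
  defines "\<S> \<equiv> finite_orbits W S \<iota> G"
    and "WG \<equiv> fixed_subgroup W S \<iota> G"
    and "VG \<equiv> fixed_space G \<rho> V"
    and "w \<equiv> longest_element W \<iota>"
    and "fG \<equiv> (\<lambda>u. restrict (rooted_rep W S \<iota> V B \<epsilon> u) (fixed_space G \<rho> V))"
  assumes "finite S"
    and "coxeter_system W S m \<iota>"
    and "symmetry_group G S m"
    and "root_basis V B S m \<epsilon>"
    and "equivariant_embedding G S V B \<epsilon> \<rho>"
  shows "(generate W (w ` \<S>) = WG \<and>
          coxeter_system (W\<lparr>carrier := WG\<rparr>) \<S> (folded_matrix m) w) \<and>
         (root_basis VG B \<S> (folded_matrix m) (folded_root B \<epsilon>) \<and>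
          is_rooted_rep (W\<lparr>carrier := WG\<rparr>) \<S> w VG B (folded_root B \<epsilon>) fG \<and>
          inj_on fG WG)"
proof -
  note [simp] = \<S>_def WG_def VG_def w_def fG_def
  interpret form_space V B by (rule form_space_root_basis) fact
  interpret coxeter_generators W S m \<iota> by (rule coxeter_system_generators) fact
  \<comment> \<open>That \<open>W\<close> is a Coxeter system enters twice: above to provide
    generators with relations, and here to extend the reflections to
    \<open>rooted_rep\<close>.\<close>
  interpret folding W S m \<iota> V B \<epsilon> "rooted_rep W S \<iota> V B \<epsilon>" G \<rho>
    by unfold_locales (fact | rule is_rooted_rep_rooted_rep, fact+)+
  interpret F: reflection_rep "W\<lparr>carrier := WG\<rparr>" \<S> "folded_matrix m" w VG B "folded_root B \<epsilon>" fG
    using folded_reflection_rep by simp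
  show ?thesis
    using generate_longest F.coxeter_system F.root_basis F.rep F.f_inj by simp
qed

end
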